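(* Let $W$ be a finite Coxeter group of type $A$ (i.e. $W=S_n$, type $A_{n-1}$) or of type $B$ (i.e. $W=B_n$), with Coxeter diagram $G$. Then for every orientation $\vec G$ of $G$, the Cambrian fan $\mathcal F(\vec G)$ is combinatorially isomorphic to the normal fan of the generalized associahedron for $W$.
   Context: A Coxeter system $(W,S)$ has Coxeter diagram $G$: vertex set $S$, with an edge labeled $m(s,t)$ (the order of $st$) between $s\neq t$ whenever $m(s,t)>2$. An orientation $\vec G$ of $G$ is a directed graph on $S$ with exactly one directed edge for each edge of $G$ (keeping labels). The (right) weak order on $W$ is the partial order $v\le w$ iff $I(v)\subseteq I(w)$, where $I(w)$ is the set of reflections $t$ (conjugates of elements of $S$) with $\ell(tw)<\ell(w)$; for finite $W$ it is a lattice. The Cambrian congruence $\Theta(\vec G)$ is the smallest lattice congruence of the weak order on $W$ such that for every directed edge $s\to t$ of $\vec G$, the element $t$ is congruent to the element represented by the alternating word $tsts\cdots$ with $m(s,t)-1$ letters. Realize $W$ as a finite reflection group in $\mathbb R^n$; the reflecting hyperplanes cut $\mathbb R^n$ into regions (closures of components of the complement), and fixing a base region $B$ the map $w\mapsto wB$ is a bijection from $W$ to the regions; the regions and all their faces form the Coxeter fan $\mathcal F$. For a lattice congruence $\Theta$ of the weak order, $\mathcal F_\Theta$ denotes the complete fan whose maximal cones are the unions, over each $\Theta$-class, of the corresponding regions (together with all faces of these cones). The Cambrian fan is $\mathcal F(\vec G):=\mathcal F_{\Theta(\vec G)}$. The generalized associahedron for $W$ (Chapoton–Fomin–Zelevinsky)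 is, in type $A_{n-1}$, the classical associahedron (faces correspond to partial triangulations of a convex $(n+2)$-gon, ordered by reverse inclusion), and in type $B_n$, the cyclohedron (faces correspond to centrally symmetric partial triangulations of a centrally symmetric $(2n+2)$-gon, ordered by reverse inclusion). Two fans are combinatorially isomorphic if their posets of cones are isomorphic. *)

theory Defs
  imports Complex_Main
begin

type_synonym perm = "int \<Rightarrow> int"
type_synonym vec = "int \<Rightarrow> real"

definition sgen :: "int \<Rightarrow> perm" where
  "sgen i = (\<lambda>k. if k = i then i + 1 else if k = i + 1 then i
               else if k = - i then - (i + 1) else if k = - (i + 1) then - i else k)"

definition s0 :: perm where
  "s0 = (\<lambda>k. if k = 1 then -1 else if k = -1 then 1 else k)"

text \<open>Type A_{n-1}: W = S_n, generators the adjacent transpositions (i, i+1), 1 \<le> i < n.\<close>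
definition S_A :: "nat \<Rightarrow> perm set" where
  "S_A n = sgen ` {1..<int n}"

definition S_B :: "nat \<Rightarrow> perm set" where
  "S_B n = insert s0 (sgen ` {1..<int n})"

definition word_prod :: "perm list \<Rightarrow> perm" where
  "word_prod ws = foldr (\<circ>) ws id"

definition cox_group :: "perm set \<Rightarrow> perm set" where
  "cox_group S = {word_prod ws | ws. set ws \<subseteq> S}"

definition cox_len :: "perm set \<Rightarrow> perm \<Rightarrow> nat" where
  "cox_len S w = (LEAST k. \<exists>ws. set ws \<subseteq> S \<and> length ws = k \<and> word_prod ws = w)"

definition reflections :: "perm set \<Rightarrow> perm set" where
  "reflections S = {w \<circ> s \<circ> inv w | w s. w \<in> cox_group S \<and> s \<in> S}"

definition inversions :: "perm set \<Rightarrow> perm \<Rightarrow> perm set" where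
  "inversions S w = {t \<in> reflections S. cox_len S (t \<circ> w) < cox_len S w}"

definition weak_le :: "perm set \<Rightarrow> perm \<Rightarrow> perm \<Rightarrow> bool" where
  "weak_le S v w \<longleftrightarrow> inversions S v \<subseteq> inversions S w"

definition cox_order :: "perm \<Rightarrow> perm \<Rightarrow> nat" where
  "cox_order s t = (LEAST k. k > 0 \<and> (s \<circ> t) ^^ k = id)"

text \<open>Orientations of the Coxeter diagram: exactly one directed edge s \<rightarrow> t per edge {s,t}
  (s \<noteq> t, m(s,t) > 2); the pair (s,t) stands for the directed edge s \<rightarrow> t.\<close>
definition diagram_edge :: "perm set \<Rightarrow> perm \<Rightarrow> perm \<Rightarrow> bool" where
  "diagram_edge S s t \<longleftrightarrow> s \<in> S \<and> t \<in> S \<and> s \<noteq> t \<and> cox_order s t > 2"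

definition orientation :: "perm set \<Rightarrow> (perm \<times> perm) set \<Rightarrow> bool" where
  "orientation S Or \<longleftrightarrow> (\<forall>(s, t) \<in> Or. diagram_edge S s t) \<and>
     (\<forall>s t. diagram_edge S s t \<longrightarrow> ((s, t) \<in> Or \<longleftrightarrow> (t, s) \<notin> Or))"

definition alt_word :: "perm \<Rightarrow> perm \<Rightarrow> nat \<Rightarrow> perm" where
  "alt_word t s k = word_prod (map (\<lambda>i. if even i then t else s) [0..<k])"

definition is_join :: "perm set \<Rightarrow> perm \<Rightarrow> perm \<Rightarrow> perm \<Rightarrow> bool" where
  "is_join S x y j \<longleftrightarrow> j \<in> cox_group S \<and> weak_le S x j \<and> weak_le S y j \<and>
     (\<forall>z \<in> cox_group S. weak_le S x z \<and> weak_le S y z \<longrightarrow> weak_le S j z)"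

definition is_meet :: "perm set \<Rightarrow> perm \<Rightarrow> perm \<Rightarrow> perm \<Rightarrow> bool" where
  "is_meet S x y m \<longleftrightarrow> m \<in> cox_group S \<and> weak_le S m x \<and> weak_le S m y \<and>
     (\<forall>z \<in> cox_group S. weak_le S z x \<and> weak_le S z y \<longrightarrow> weak_le S z m)"

definition lattice_cong :: "perm set \<Rightarrow> (perm \<times> perm) set \<Rightarrow> bool" where
  "lattice_cong S \<Theta> \<longleftrightarrow> equiv (cox_group S) \<Theta> \<and>
     (\<forall>x y z j j'. (x, y) \<in> \<Theta> \<and> z \<in> cox_group S \<and> is_join S x z j \<and> is_join S y z j'
          \<longrightarrow> (j, j') \<in> \<Theta>) \<and>
     (\<forall>x y z m m'. (x, y) \<in> \<Theta> \<and> z \<in> cox_group S \<and> is_meet S x z m \<and> is_meet S y z m'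
          \<longrightarrow> (m, m') \<in> \<Theta>)"

definition cambrian_cong :: "perm set \<Rightarrow> (perm \<times> perm) set \<Rightarrow> (perm \<times> perm) set" where
  "cambrian_cong S Or = \<Inter> {\<Theta>. lattice_cong S \<Theta> \<and>
      (\<forall>(s, t) \<in> Or. (t, alt_word t s (cox_order s t - 1)) \<in> \<Theta>)}"

definition Rn :: "nat \<Rightarrow> vec set" where
  "Rn n = {x. \<forall>i. (i < 1 \<or> i > int n) \<longrightarrow> x i = 0}"

definition ext :: "vec \<Rightarrow> int \<Rightarrow> real" where
  "ext x j = (if j \<ge> 0 then x j else - x (- j))"

definition act :: "nat \<Rightarrow> perm \<Rightarrow> vec \<Rightarrow> vec" where
  "act n w x = (\<lambda>i. if 1 \<le> i \<and> i \<le> int n then ext x (inv w i) else 0)"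

definition chamber_A :: "nat \<Rightarrow> vec set" where
  "chamber_A n = {x \<in> Rn n. \<forall>i \<in> {1..<int n}. x i \<le> x (i + 1)}"

definition chamber_B :: "nat \<Rightarrow> vec set" where
  "chamber_B n = {x \<in> Rn n. 0 \<le> x 1 \<and> (\<forall>i \<in> {1..<int n}. x i \<le> x (i + 1))}"

text \<open>Convexity, segments and faces (literal unfoldings of the HOL-Analysis notions
  convex, closed_segment, open_segment, face_of, for the vector space int \<Rightarrow> real).\<close>
definition vcomb :: "real \<Rightarrow> vec \<Rightarrow> vec \<Rightarrow> vec" where
  "vcomb u a b = (\<lambda>i. (1 - u) * a i + u * b i)"

definition vconvex :: "vec set \<Rightarrow> bool" where
  "vconvex C \<longleftrightarrow> (\<forall>x \<in> C. \<forall>y \<in> C. \<forall>u. 0 \<le> u \<and> u \<le> 1 \<longrightarrow> vcomb u x y \<in> C)"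

definition vopen_segment :: "vec \<Rightarrow> vec \<Rightarrow> vec set" where
  "vopen_segment a b = {vcomb u a b | u. 0 \<le> u \<and> u \<le> 1} - {a, b}"

definition vface_of :: "vec set \<Rightarrow> vec set \<Rightarrow> bool" where
  "vface_of F C \<longleftrightarrow> F \<subseteq> C \<and> vconvex F \<and>
     (\<forall>a \<in> C. \<forall>b \<in> C. \<forall>x \<in> F. x \<in> vopen_segment a b \<longrightarrow> a \<in> F \<and> b \<in> F)"

definition cong_fan_max_cones :: "nat \<Rightarrow> perm set \<Rightarrow> vec set \<Rightarrow> (perm \<times> perm) set \<Rightarrow> vec set set" where
  "cong_fan_max_cones n S B \<Theta> =
     {\<Union> v \<in> \<Theta> `` {w}. act n v ` B | w. w \<in> cox_group S}"

definition cong_fan :: "nat \<Rightarrow> perm set \<Rightarrow> vec set \<Rightarrow> (perm \<times> perm) set \<Rightarrow> vec set set" where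
  "cong_fan n S B \<Theta> = {F. F \<noteq> {} \<and> (\<exists>C \<in> cong_fan_max_cones n S B \<Theta>. vface_of F C)}"

text \<open>Convex N-gon with vertices 0, ..., N-1 in cyclic order; diagonals (i,j) with i<j.\<close>
definition diagonals :: "nat \<Rightarrow> (nat \<times> nat) set" where
  "diagonals N = {(i, j). i < j \<and> j < N \<and> i + 2 \<le> j \<and> \<not> (i = 0 \<and> j + 1 = N)}"

definition crosses :: "nat \<times> nat \<Rightarrow> nat \<times> nat \<Rightarrow> bool" where
  "crosses d e \<longleftrightarrow> (case d of (a, b) \<Rightarrow> case e of (c, d') \<Rightarrow>
     (a < c \<and> c < b \<and> b < d') \<or> (c < a \<and> a < d' \<and> d' < b))"

definition partial_triangulations :: "nat \<Rightarrow> (nat \<times> nat) set set" where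
  "partial_triangulations N =
     {D. D \<subseteq> diagonals N \<and> (\<forall>d \<in> D. \<forall>e \<in> D. \<not> crosses d e)}"

definition antipode :: "nat \<Rightarrow> nat \<times> nat \<Rightarrow> nat \<times> nat" where
  "antipode n d = (case d of (i, j) \<Rightarrow>
     (let i' = (i + n + 1) mod (2 * n + 2); j' = (j + n + 1) mod (2 * n + 2)
      in (min i' j', max i' j')))"

definition cs_partial_triangulations :: "nat \<Rightarrow> (nat \<times> nat) set set" where
  "cs_partial_triangulations n =
     {D \<in> partial_triangulations (2 * n + 2). \<forall>d \<in> D. antipode n d \<in> D}"

text \<open>Cones of the normal fan of a polytope correspond to its nonempty faces with the order
  reversed. Hence the cone poset of the normal fan of the associahedron (faces = partial
  triangulations of the (n+2)-gon under reverse inclusion) is the set of partial triangulations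
  ordered by inclusion; similarly for the cyclohedron.\<close>
definition assoc_normal_fan_A :: "nat \<Rightarrow> (nat \<times> nat) set set" where
  "assoc_normal_fan_A n = partial_triangulations (n + 2)"

definition assoc_normal_fan_B :: "nat \<Rightarrow> (nat \<times> nat) set set" where
  "assoc_normal_fan_B n = cs_partial_triangulations n"

definition comb_iso :: "'a set set \<Rightarrow> 'b set set \<Rightarrow> bool" where
  "comb_iso P Q \<longleftrightarrow> (\<exists>f. bij_betw f P Q \<and> (\<forall>a \<in> P. \<forall>b \<in> P. a \<subseteq> b \<longleftrightarrow> f a \<subseteq> f b))"

end

theory Submission
  imports Defs
begin

text \<open>Place the letters (\<open>1, \<dots>, n\<close> in type A, \<open>\<plusminus>1, \<dots>, \<plusminus>n\<close> in type B) together with two extreme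
  vertices on a polygon, where the orientation of the diagram decides whether a letter is a lower or
  an upper vertex. A point \<open>x\<close> assigns a real number to each letter. Raising a threshold from
  \<open>-\<infinity>\<close> to \<open>\<infinity>\<close> and moving each letter across when its number is reached sweeps the lower boundary
  path of the polygon to the upper one, and the diagonals met on the way form a noncrossing set
  \<open>Dg x\<close>. For a permutation, viewed as a generic point, this is a triangulation.

  Permutations with the same triangulation are connected by exchanges of adjacent letters \<open>a < c\<close>
  that are separated by a lower vertex \<open>a < b < c\<close> placed later or an upper one placed earlier.
  The bottom and top elements of these classes depend monotonically on the permutation, so that
  equality of triangulations is a lattice congruence. Conversely, every such exchange is forced by
  the generating pairs of the Cambrian congruence, by induction on \<open>c - a\<close>. Hence the maximal cones
  are \<open>{x. Dg x \<subseteq> T}\<close> for triangulations \<open>T\<close>, their faces are \<open>{x. Dg x \<subseteq> D}\<close> for \<open>D \<subseteq> T\<close>, and every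
  noncrossing (in type B centrally symmetric) set of diagonals arises as \<open>Dg x\<close>.\<close>


section \<open>Polygons with lower and upper vertices\<close>


text \<open>That the classes form a lattice congruence is reduced to descents. An element without
  contracted descents is determined from below by the join-irreducibles \<open>JJ\<close> of its
  descents, and \<open>JJ\<close> does not change under contracted exchanges. The dual condition
  \<open>MM\<close> controls the top elements. The harder direction is forcing. The witness
  \<open>b\<close> stays fixed and the pair \<open>a < c\<close> is narrowed: a further letter
  \<open>d\<close> strictly between \<open>a\<close> and \<open>c\<close> is carried next to the
  pair, where the hexagon of the orders of \<open>a\<close>, \<open>d\<close>, \<open>c\<close>
  transfers contraction from whichever of \<open>(a, d)\<close> and \<open>(d, c)\<close> encloses
  \<open>b\<close>. The obstacle is type B, where every letter moves together with its negative. The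
  carried letter may meet the mirror image of the pair or disturb \<open>b\<close>, and near the
  centre hexagons are replaced by octagons. The generating pairs are what remains when no further
  letter is available. Both types are treated at once: elements of type A are odd functions on the
  integers as well, and only the set of letters \<open>I\<close> differs.\<close>

locale polygon =
  fixes I :: "int set" and up :: "int \<Rightarrow> bool" and lo hi :: int
  assumes fin: "finite I" and bnd: "\<And>i. i \<in> I \<Longrightarrow> lo < i \<and> i < hi" and lohi: "lo < hi"
begin

definition verts :: "int set" where "verts = insert lo (insert hi I)"
definition edges :: "(int \<times> int) set" where
  "edges = {(a, c). a \<in> verts \<and> c \<in> verts \<and> a < c}"
text \<open>An edge belongs to the path of a processed set \<open>P\<close> exactly when
  \<open>Lo e\<close> is contained in \<open>P\<close> and \<open>Up e\<close> is disjoint from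
  \<open>P\<close>. Endpoints enter with the opposite role of inner letters, since a lower endpoint
  must still be on the path and an upper one must already be on it.\<close>

definition Lo :: "int \<times> int \<Rightarrow> int set" where
  "Lo e = {l \<in> I. fst e < l \<and> l < snd e \<and> \<not> up l \<or> up l \<and> (l = fst e \<or> l = snd e)}"
definition Up :: "int \<times> int \<Rightarrow> int set" where
  "Up e = {l \<in> I. fst e < l \<and> l < snd e \<and> up l \<or> \<not> up l \<and> (l = fst e \<or> l = snd e)}"
text \<open>The two edges make opposite demands on the order of two letters, so no sweep meets both.
  This is crossing of chords, as \<open>xing_crosses\<close> confirms.\<close>

definition xing :: "int \<times> int \<Rightarrow> int \<times> int \<Rightarrow> bool" where
  "xing e f \<longleftrightarrow> Lo e \<inter> Up f \<noteq> {} \<and> Up e \<inter> Lo f \<noteq> {}"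
text \<open>An edge with \<open>Lo e\<close> empty lies on the initial path and one with
  \<open>Up e\<close> empty on the final path; these are the sides of the polygon.\<close>

definition diag :: "(int \<times> int) set" where
  "diag = {e \<in> edges. Lo e \<noteq> {} \<and> Up e \<noteq> {}}"
definition Dg :: "(int \<Rightarrow> 'b::linorder) \<Rightarrow> (int \<times> int) set" where
  "Dg x = {e \<in> diag. \<forall>l \<in> Lo e. \<forall>u \<in> Up e. x l < x u}"

lemma verts_bnd: "v \<in> verts \<Longrightarrow> lo \<le> v \<and> v \<le> hi"
  using bnd lohi by (force simp: verts_def)

lemma Lo_I: "l \<in> Lo e \<Longrightarrow> l \<in> I" and Up_I: "u \<in> Up e \<Longrightarrow> u \<in> I"
  by (auto simp: Lo_def Up_def)

lemma finite_Lo: "finite (Lo e)" and finite_Up: "finite (Up e)"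
  using fin by (auto simp: Lo_def Up_def)

lemma Lo_Up_disj: "e \<in> edges \<Longrightarrow> Lo e \<inter> Up e = {}"
  by (auto simp: Lo_def Up_def edges_def)

lemma diag_edges: "diag \<subseteq> edges"
  by (auto simp: diag_def)

lemma finite_edges: "finite edges"
proof -
  have "edges \<subseteq> verts \<times> verts" by (auto simp: edges_def)
  moreover have "finite verts" using fin by (simp add: verts_def)
  ultimately show ?thesis by (meson finite_SigmaI finite_subset)
qed

lemma finite_diag: "finite diag"
  using finite_edges diag_edges finite_subset by blast

lemma Dg_diag: "Dg x \<subseteq> diag"
  by (auto simp: Dg_def)

lemma finite_Dg: "finite (Dg x)"
  using finite_diag Dg_diag finite_subset by blast

lemma xing_sym: "xing e f \<longleftrightarrow> xing f e"
  by (auto simp: xing_def)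

lemma xing_diag: "e \<in> edges \<Longrightarrow> xing e f \<Longrightarrow> e \<in> diag"
  by (auto simp: xing_def diag_def)

lemma Dg_noncrossing:
  assumes "e \<in> Dg x" "f \<in> Dg x" shows "\<not> xing e f"
proof
  assume "xing e f"
  then obtain p q where "p \<in> Lo e" "p \<in> Up f" "q \<in> Up e" "q \<in> Lo f"
    by (auto simp: xing_def)
  with assms have "x p < x q" "x q < x p" by (auto simp: Dg_def)
  then show False by simp
qed

text \<open>Processing the vertices of a set \<open>P\<close> turns the lower boundary of the polygon into the path
  through the lower vertices outside \<open>P\<close> and the upper vertices in \<open>P\<close>. The edge below is the one
  of this path which spans \<open>p\<close> and \<open>q\<close>.\<close>
lemma path_edge:
  assumes pq: "p \<in> I" "q \<in> I" "p \<in> P" "q \<notin> P"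
    and btw: "\<And>m. m \<in> I \<Longrightarrow> min p q < m \<Longrightarrow> m < max p q \<Longrightarrow> up m \<longleftrightarrow> m \<notin> P"
  obtains f where "f \<in> edges" "p \<in> Lo f" "q \<in> Up f" "Lo f \<subseteq> P" "Up f \<inter> P = {}"
proof -
  \<comment> \<open>\<open>Z\<close> is the vertex set of the path. By assumption none of its
    vertices lies strictly between the two letters, so the edge runs from the last vertex weakly
    left of both to the first vertex weakly right of both.\<close>
  define Z where "Z = insert lo (insert hi {m \<in> I. up m \<longleftrightarrow> m \<in> P})"
  define a where "a = min p q"
  define c where "c = max p q"
  have "p \<noteq> q" using pq by auto
  then have ac: "a \<in> I" "c \<in> I" "a < c" using pq by (auto simp: a_def c_def min_def max_def)
  have finZ: "finite Z" using fin by (simp add: Z_def)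
  have neA: "{z \<in> Z. z \<le> a} \<noteq> {}" and neC: "{z \<in> Z. c \<le> z} \<noteq> {}"
    using ac bnd[of a] bnd[of c] by (auto simp: Z_def)
  define a2 where "a2 = Max {z \<in> Z. z \<le> a}"
  define c2 where "c2 = Min {z \<in> Z. c \<le> z}"
  have a2: "a2 \<in> Z" "a2 \<le> a" using Max_in[OF _ neA] finZ by (auto simp: a2_def)
  have c2: "c2 \<in> Z" "c \<le> c2" using Min_in[OF _ neC] finZ by (auto simp: c2_def)
  have a2max: "z \<le> a2" if "z \<in> Z" "z \<le> a" for z
    using that finZ by (auto simp: a2_def)
  have c2min: "c2 \<le> z" if "z \<in> Z" "c \<le> z" for z
    using that finZ by (auto simp: c2_def)
  have nob: "z \<notin> Z" if "z \<in> I" "a2 < z" "z < c2" "z \<noteq> a" "z \<noteq> c" for z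
    using a2max[of z] c2min[of z] btw[of z] that bnd[of z] by (force simp: Z_def a_def c_def)
  have inI: "a \<notin> Z \<Longrightarrow> a2 < a" "c \<notin> Z \<Longrightarrow> c < c2"
    using a2 c2 by (auto simp: order_less_le)
  have inZ: "a \<in> Z \<Longrightarrow> a2 = a" "c \<in> Z \<Longrightarrow> c2 = c"
    using a2max[of a] a2 c2min[of c] c2 by auto
  have aZ: "a \<in> Z \<longleftrightarrow> (up a \<longleftrightarrow> a \<in> P)" "c \<in> Z \<longleftrightarrow> (up c \<longleftrightarrow> c \<in> P)"
    using ac bnd[of a] bnd[of c] by (auto simp: Z_def)
  have ZI: "z \<in> I \<Longrightarrow> z \<in> Z \<longleftrightarrow> (up z \<longleftrightarrow> z \<in> P)" for z
    using bnd[of z] by (auto simp: Z_def)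
  have nob': "z \<notin> Z" if "z \<in> I" "a2 < z" "z < c2" for z
    using nob[OF that] inZ that by auto
  have lt: "a2 < c2" using a2 c2 ac by simp
  have 1: "(a2, c2) \<in> edges"
    using a2 c2 lt by (auto simp: edges_def verts_def Z_def)
  have 2: "p \<in> Lo (a2, c2)" "q \<in> Up (a2, c2)"
    using pq inI inZ aZ a2 c2 ac lt
    by (auto simp: Lo_def Up_def a_def c_def min_def max_def split: if_splits)
  have 3: "Lo (a2, c2) \<subseteq> P" "Up (a2, c2) \<inter> P = {}"
    using nob' ZI a2 c2 by (auto simp: Lo_def Up_def)
  from 1 2 3 show ?thesis using that by blast
qed

lemma edges_less: "e \<in> edges \<Longrightarrow> fst e < snd e"
  by (auto simp: edges_def)

text \<open>Among all pairs violating the demands of \<open>e\<close> a closest one is taken. A path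
  vertex between its two letters would form a closer violating pair, so \<open>path_edge\<close>
  applies, and the edge found makes the reverse demand on this pair.\<close>

lemma crossing_path_edge:
  assumes e: "e \<in> edges" and l: "l \<in> Lo e" "l \<notin> P" and u: "u \<in> Up e" "u \<in> P"
  obtains f where "f \<in> edges" "xing e f" "Lo f \<subseteq> P" "Up f \<inter> P = {}"
proof -
  let ?Q = "\<lambda>lu. fst lu \<in> Lo e \<and> fst lu \<notin> P \<and> snd lu \<in> Up e \<and> snd lu \<in> P"
  obtain lu where lu: "?Q lu" and mn: "\<And>lu'. ?Q lu' \<Longrightarrow> nat \<bar>fst lu - snd lu\<bar> \<le> nat \<bar>fst lu' - snd lu'\<bar>"
    using ex_has_least_nat[of ?Q "(l,u)" "\<lambda>lu. nat \<bar>fst lu - snd lu\<bar>"] l u by auto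
  obtain l0 u0 where [simp]: "lu = (l0, u0)" by (cases lu)
  have lu0: "l0 \<in> Lo e" "l0 \<notin> P" "u0 \<in> Up e" "u0 \<in> P" using lu by auto
  have "up m \<longleftrightarrow> m \<notin> P" if m: "m \<in> I" "min u0 l0 < m" "m < max u0 l0" for m
  proof -
    have ins: "fst e < m \<and> m < snd e"
      using m lu0 edges_less[OF e] by (auto simp: Lo_def Up_def min_def max_def split: if_splits)
    show ?thesis
    proof (cases "up m")
      case True
      then have "m \<in> Up e" using ins m by (auto simp: Up_def)
      then show ?thesis using mn[of "(l0, m)"] m lu0 True
        by (auto simp: min_def max_def split: if_splits)
    next
      case False
      then have "m \<in> Lo e" using ins m by (auto simp: Lo_def)
      then show ?thesis using mn[of "(m, u0)"] m lu0 False
        by (cases "m \<in> P") (auto simp: min_def max_def split: if_splits)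
    qed
  qed
  then obtain f where f: "f \<in> edges" "u0 \<in> Lo f" "l0 \<in> Up f" "Lo f \<subseteq> P" "Up f \<inter> P = {}"
    using path_edge[of u0 l0 P] lu0 Lo_I Up_I by blast
  then have "xing e f" using lu0 by (auto simp: xing_def)
  then show ?thesis using that f by blast
qed

text \<open>If \<open>x l > x u\<close>, then at the stage \<open>{i. x i \<le> x u}\<close> of the
  sweep the letter \<open>u\<close> is processed and \<open>l\<close> is not, so the path at this
  stage contains a diagonal crossing \<open>e\<close>. Ties in \<open>x\<close> explain why only
  weak inequalities appear.\<close>

lemma compat_iff:
  assumes e: "e \<in> edges"
  shows "(\<forall>f \<in> Dg x. \<not> xing e f) \<longleftrightarrow> (\<forall>l \<in> Lo e. \<forall>u \<in> Up e. x l \<le> x u)"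
proof
  assume nc: "\<forall>f \<in> Dg x. \<not> xing e f"
  show "\<forall>l \<in> Lo e. \<forall>u \<in> Up e. x l \<le> x u"
  proof (intro ballI, rule ccontr)
    fix l u assume lu: "l \<in> Lo e" "u \<in> Up e" "\<not> x l \<le> x u"
    obtain f where f: "f \<in> edges" "xing e f" "Lo f \<subseteq> {i. x i \<le> x u}" "Up f \<inter> {i. x i \<le> x u} = {}"
      using crossing_path_edge[OF e, of l "{i. x i \<le> x u}" u] lu by auto
    have "f \<in> diag" using f xing_diag xing_sym by blast
    moreover have "x l' < x u'" if "l' \<in> Lo f" "u' \<in> Up f" for l' u'
    proof -
      have "x l' \<le> x u" "\<not> x u' \<le> x u" using f that by auto
      then show ?thesis by simp
    qed
    ultimately have "f \<in> Dg x" by (auto simp: Dg_def)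
    then show False using nc f by blast
  qed
next
  assume le: "\<forall>l \<in> Lo e. \<forall>u \<in> Up e. x l \<le> x u"
  show "\<forall>f \<in> Dg x. \<not> xing e f"
  proof (intro ballI notI)
    fix f assume f: "f \<in> Dg x" "xing e f"
    then obtain p q where "p \<in> Lo e" "p \<in> Up f" "q \<in> Up e" "q \<in> Lo f"
      by (auto simp: xing_def)
    then have "x p \<le> x q" "x q < x p" using le f by (auto simp: Dg_def)
    then show False by simp
  qed
qed

lemma Dg_compat:
  assumes "e \<in> edges" "\<And>f. f \<in> Dg x \<Longrightarrow> \<not> xing e f" "l \<in> Lo e" "u \<in> Up e" shows "x l \<le> x u"
  using compat_iff[of e x] assms by blast

lemma Dg_subset_compat:
  assumes "Dg x \<subseteq> Dg g" "e \<in> Dg g" "l \<in> Lo e" "u \<in> Up e" shows "x l \<le> x u"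
  by (rule Dg_compat[where e = e]) (use assms Dg_noncrossing Dg_diag diag_edges in blast)+

text \<open>Without ties the weak inequalities of \<open>compat_iff\<close> become strict. Hence a
  generic point has a maximal noncrossing set, that is, a triangulation.\<close>

lemma Dg_inj_maximal:
  assumes "inj_on g I" "e \<in> diag" "\<And>f. f \<in> Dg g \<Longrightarrow> \<not> xing e f" shows "e \<in> Dg g"
proof -
  have "g l < g u" if "l \<in> Lo e" "u \<in> Up e" for l u
  proof -
    have "g l \<le> g u" using Dg_compat[of e g l u] assms that diag_edges by blast
    moreover have "l \<noteq> u" using Lo_Up_disj[of e] that assms diag_edges by blast
    then have "g l \<noteq> g u" using assms(1) that Lo_I Up_I by (meson inj_onD)
    ultimately show ?thesis by simp
  qed
  then show ?thesis using assms by (auto simp: Dg_def)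
qed

lemma Dg_subset_of_compat:
  assumes g: "inj_on g I" and z: "\<And>e l u. e \<in> Dg g \<Longrightarrow> l \<in> Lo e \<Longrightarrow> u \<in> Up e \<Longrightarrow> z l \<le> z u"
  shows "Dg z \<subseteq> Dg g"
proof
  fix f assume f: "f \<in> Dg z"
  have "\<not> xing f e" if "e \<in> Dg g" for e
  proof -
    have "\<forall>f\<in>Dg z. \<not> xing e f" using compat_iff[of e z] z that Dg_diag diag_edges by blast
    then show ?thesis using f xing_sym by blast
  qed
  then show "f \<in> Dg g" using Dg_inj_maximal[OF g] f Dg_diag by blast
qed

lemma Dg_inj_eq:
  assumes "inj_on g I" "inj_on h I" "Dg g \<subseteq> Dg h" shows "Dg g = Dg h"
proof -
  have "Dg h \<subseteq> Dg g"
    using Dg_inj_maximal[OF assms(1)] Dg_diag Dg_noncrossing assms(3) by blast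
  then show ?thesis using assms by blast
qed

section \<open>Triangles at a diagonal and the inequalities of a cone\<close>

definition lst :: "(int \<Rightarrow> int) \<Rightarrow> int \<times> int \<Rightarrow> int" where
  "lst g e = (ARG_MAX g l. l \<in> Lo e)"
definition ust :: "(int \<Rightarrow> int) \<Rightarrow> int \<times> int \<Rightarrow> int" where
  "ust g e = (ARG_MIN g u. u \<in> Up e)"

lemma lst: assumes "e \<in> diag"
  shows "lst g e \<in> Lo e" "l \<in> Lo e \<Longrightarrow> g l \<le> g (lst g e)"
proof -
  have ne: "Lo e \<noteq> {}" using assms by (simp add: diag_def)
  then have "Max (g ` Lo e) \<in> g ` Lo e" using finite_Lo by simp
  then obtain k where k: "k \<in> Lo e" "g k = Max (g ` Lo e)" by auto
  have mx: "g y \<le> g k" if "y \<in> Lo e" for y using that k finite_Lo by simp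
  show "lst g e \<in> Lo e" unfolding lst_def
    by (rule arg_maxI[where x = k]) (use k mx in \<open>auto simp: not_less\<close>)
  show "l \<in> Lo e \<Longrightarrow> g l \<le> g (lst g e)" unfolding lst_def
    by (rule arg_maxI[where x = k]) (use k mx in \<open>auto simp: not_less\<close>)
qed

lemma ust: assumes "e \<in> diag"
  shows "ust g e \<in> Up e" "u \<in> Up e \<Longrightarrow> g (ust g e) \<le> g u"
proof -
  have ne: "Up e \<noteq> {}" using assms by (simp add: diag_def)
  then have "Min (g ` Up e) \<in> g ` Up e" using finite_Up by simp
  then obtain k where k: "k \<in> Up e" "g k = Min (g ` Up e)" by auto
  have mx: "g k \<le> g y" if "y \<in> Up e" for y using that k finite_Up by simp
  show "ust g e \<in> Up e" unfolding ust_def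
    by (rule arg_minI[where x = k]) (use k mx in \<open>auto simp: not_less\<close>)
  show "u \<in> Up e \<Longrightarrow> g (ust g e) \<le> g u" unfolding ust_def
    by (rule arg_minI[where x = k]) (use k mx in \<open>auto simp: not_less\<close>)
qed

lemma Dg_of_path:
  assumes "f \<in> edges" "p \<in> Lo f" "q \<in> Up f" "Lo f \<subseteq> P" "Up f \<inter> P = {}"
    "\<And>i j. i \<in> I \<Longrightarrow> j \<in> I \<Longrightarrow> i \<in> P \<Longrightarrow> j \<notin> P \<Longrightarrow> g i < g j"
  shows "f \<in> Dg g"
  using assms Lo_I Up_I unfolding Dg_def diag_def by blast

text \<open>Just before \<open>lst g e\<close> is processed, the other letters of
  \<open>Lo e\<close> are processed and those of \<open>Up e\<close> are not. Hence no path vertex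
  lies strictly between \<open>l\<close> and \<open>lst g e\<close>, and the path has an edge
  spanning both.\<close>

lemma below_lst:
  assumes g: "inj_on g I" and e: "e \<in> Dg g" and l: "l \<in> Lo e" "l \<noteq> lst g e"
  obtains f where "f \<in> Dg g" "l \<in> Lo f" "lst g e \<in> Up f"
proof -
  have ed: "e \<in> diag" using e Dg_diag by blast
  let ?m = "lst g e"
  have m: "?m \<in> Lo e" by (rule lst(1)[OF ed])
  have lt: "g k < g ?m" if "k \<in> Lo e" "k \<noteq> ?m" for k
  proof -
    have "g k \<noteq> g ?m" using g m that Lo_I inj_onD by metis
    then show ?thesis using lst(2)[OF ed that(1), of g] by simp
  qed
  let ?P = "{i. g i < g ?m}"
  have "up k \<longleftrightarrow> k \<notin> ?P" if k: "k \<in> I" "min l ?m < k" "k < max l ?m" for k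
  proof -
    have ins: "fst e < k \<and> k < snd e"
      using k l m edges_less[of e] ed diag_edges by (auto simp: Lo_def min_def max_def split: if_splits)
    show ?thesis
    proof (cases "up k")
      case True
      then have "k \<in> Up e" using ins k by (auto simp: Up_def)
      then have "g ?m < g k" using e m by (auto simp: Dg_def)
      then show ?thesis using True by simp
    next
      case False
      then have "k \<in> Lo e" using ins k by (auto simp: Lo_def)
      moreover have "k \<noteq> ?m" using k l by (auto simp: min_def max_def split: if_splits)
      ultimately show ?thesis using lt False by simp
    qed
  qed
  then obtain f where f: "f \<in> edges" "l \<in> Lo f" "?m \<in> Up f" "Lo f \<subseteq> ?P" "Up f \<inter> ?P = {}"
    using path_edge[of l ?m ?P] l m lt Lo_I by auto
  have "f \<in> Dg g" by (rule Dg_of_path[OF f]) auto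
  then show ?thesis using that f by blast
qed

lemma above_ust:
  assumes g: "inj_on g I" and e: "e \<in> Dg g" and u: "u \<in> Up e" "u \<noteq> ust g e"
  obtains f where "f \<in> Dg g" "ust g e \<in> Lo f" "u \<in> Up f"
proof -
  have ed: "e \<in> diag" using e Dg_diag by blast
  let ?m = "ust g e"
  have m: "?m \<in> Up e" by (rule ust(1)[OF ed])
  have lt: "g ?m < g k" if "k \<in> Up e" "k \<noteq> ?m" for k
  proof -
    have "g k \<noteq> g ?m" using g m that Up_I inj_onD by metis
    then show ?thesis using ust(2)[OF ed that(1), of g] by simp
  qed
  let ?P = "{i. g i \<le> g ?m}"
  have "up k \<longleftrightarrow> k \<notin> ?P" if k: "k \<in> I" "min ?m u < k" "k < max ?m u" for k
  proof -
    have ins: "fst e < k \<and> k < snd e"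
      using k u m edges_less[of e] ed diag_edges by (auto simp: Up_def min_def max_def split: if_splits)
    show ?thesis
    proof (cases "up k")
      case True
      then have "k \<in> Up e" using ins k by (auto simp: Up_def)
      moreover have "k \<noteq> ?m" using k u by (auto simp: min_def max_def split: if_splits)
      ultimately show ?thesis using lt True by (simp add: not_le)
    next
      case False
      then have "k \<in> Lo e" using ins k by (auto simp: Lo_def)
      then have "g k < g ?m" using e m by (auto simp: Dg_def)
      then show ?thesis using False by simp
    qed
  qed
  then obtain f where f: "f \<in> edges" "?m \<in> Lo f" "u \<in> Up f" "Lo f \<subseteq> ?P" "Up f \<inter> ?P = {}"
    using path_edge[of ?m u ?P] u m lt[OF u] Up_I by (auto simp: not_le)
  have "f \<in> Dg g" by (rule Dg_of_path[OF f]) auto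
  then show ?thesis using that f by blast
qed

text \<open>\<open>lst\<close> and \<open>ust\<close> label the two triangles at a diagonal of a triangulation; the inequalities
  between these labels cut out the cone of the triangulation.\<close>
lemma Dg_subset_iff:
  assumes g: "inj_on g I"
  shows "Dg z \<subseteq> Dg g \<longleftrightarrow> (\<forall>e \<in> Dg g. z (lst g e) \<le> z (ust g e))"
proof
  assume "Dg z \<subseteq> Dg g"
  then show "\<forall>e \<in> Dg g. z (lst g e) \<le> z (ust g e)"
    using Dg_subset_compat[of z g] lst(1) ust(1) Dg_diag by blast
next
  assume tree: "\<forall>e \<in> Dg g. z (lst g e) \<le> z (ust g e)"
  have "z l \<le> z u" if "e \<in> Dg g" "l \<in> Lo e" "u \<in> Up e" for e l u
    using that
  \<comment> \<open>The inequality is split along \<open>l\<close>, \<open>lst g e\<close>,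
    \<open>ust g e\<close>, \<open>u\<close>. The outer two links are demanded by other diagonals
    and concern pairs closer together in \<open>g\<close>; the middle link is the
    hypothesis.\<close>
  proof (induction "nat (g u - g l)" arbitrary: e l u rule: less_induct)
    case less
    let ?l = "lst g e" and ?u = "ust g e"
    have ed: "e \<in> diag" using less.prems Dg_diag by blast
    have ord: "g l \<le> g ?l" "g ?l < g ?u" "g ?u \<le> g u"
      using lst[OF ed] ust[OF ed] less.prems by (auto simp: Dg_def)
    have "z l \<le> z ?l"
    proof (cases "l = ?l")
      case False
      obtain f where f: "f \<in> Dg g" "l \<in> Lo f" "?l \<in> Up f"
        using below_lst[OF g less.prems(1,2) False] by blast
      have "nat (g ?l - g l) < nat (g u - g l)" using ord by auto
      then show ?thesis using less.hyps f by blast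
    qed simp
    moreover have "z ?u \<le> z u"
    proof (cases "u = ?u")
      case False
      obtain f where f: "f \<in> Dg g" "?u \<in> Lo f" "u \<in> Up f"
        using above_ust[OF g less.prems(1,3) False] by blast
      have "nat (g u - g ?u) < nat (g u - g l)" using ord by auto
      then show ?thesis using less.hyps f by blast
    qed simp
    moreover have "z ?l \<le> z ?u" using tree less.prems by blast
    ultimately show ?case by order
  qed
  then show "Dg z \<subseteq> Dg g" using Dg_subset_of_compat[OF g] by blast
qed

text \<open>Inside the cone \<open>x l \<le> x (lst g e)\<close> and
  \<open>x (ust g e) \<le> x u\<close> hold anyway, so strictness at this single pair makes all
  demands of \<open>e\<close> strict.\<close>

lemma mem_Dg_iff:
  assumes g: "inj_on g I" and x: "Dg x \<subseteq> Dg g" and e: "e \<in> Dg g"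
  shows "e \<in> Dg x \<longleftrightarrow> x (lst g e) < x (ust g e)"
proof
  have ed: "e \<in> diag" using e Dg_diag by blast
  show "e \<in> Dg x \<Longrightarrow> x (lst g e) < x (ust g e)"
    using lst(1)[OF ed] ust(1)[OF ed] by (auto simp: Dg_def)
  assume lt: "x (lst g e) < x (ust g e)"
  have "x l < x u" if lu: "l \<in> Lo e" "u \<in> Up e" for l u
  proof -
    have "x l \<le> x (lst g e)"
    proof (cases "l = lst g e")
      case False
      obtain f where f: "f \<in> Dg g" "l \<in> Lo f" "lst g e \<in> Up f"
        using below_lst[OF g e lu(1) False] by blast
      then show ?thesis using Dg_subset_compat[OF x] by blast
    qed simp
    moreover have "x (ust g e) \<le> x u"
    proof (cases "u = ust g e")
      case False
      obtain f where f: "f \<in> Dg g" "ust g e \<in> Lo f" "u \<in> Up f"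
        using above_ust[OF g e lu(2) False] by blast
      then show ?thesis using Dg_subset_compat[OF x] by blast
    qed simp
    ultimately show ?thesis using lt by order
  qed
  then show "e \<in> Dg x" using ed by (auto simp: Dg_def)
qed

definition tiebreak :: "(int \<Rightarrow> 'a::linorder) \<Rightarrow> (int \<Rightarrow> 'b::linorder) \<Rightarrow> int \<Rightarrow> int \<Rightarrow> bool" where
  "tiebreak x g i j \<longleftrightarrow> x i < x j \<or> x i = x j \<and> g i < g j"

text \<open>This will show that the regions of one class cover the whole closed cone: a boundary
  point lies in the region of the order obtained by breaking its ties as \<open>g\<close> does, and
  this order has the same triangulation.\<close>

lemma Dg_tiebreak:
  assumes g: "inj_on g I" and x: "Dg x \<subseteq> Dg g" and h: "inj_on h I"
    and ord: "\<And>i j. i \<in> I \<Longrightarrow> j \<in> I \<Longrightarrow> h i < h j \<longleftrightarrow> tiebreak x g i j"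
  shows "Dg h = Dg g"
proof -
  have "e \<in> Dg h" if e: "e \<in> Dg g" for e
  proof -
    have "h l < h u" if lu: "l \<in> Lo e" "u \<in> Up e" for l u
    proof -
      have "g l < g u" using e lu by (auto simp: Dg_def)
      moreover have "x l \<le> x u" using Dg_subset_compat[OF x e lu] .
      ultimately show ?thesis using ord lu Lo_I Up_I by (auto simp: tiebreak_def)
    qed
    then show ?thesis using e by (auto simp: Dg_def)
  qed
  then show ?thesis using Dg_inj_eq[OF g h] by blast
qed

lemma Dg_refine:
  assumes "\<And>i j. i \<in> I \<Longrightarrow> j \<in> I \<Longrightarrow> h i < h j \<Longrightarrow> x i \<le> x j" "inj_on h I"
  shows "Dg x \<subseteq> Dg h"
proof
  fix e assume e: "e \<in> Dg x"
  have "h l < h u" if lu: "l \<in> Lo e" "u \<in> Up e" for l u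
  proof (rule ccontr)
    have lt: "x l < x u" using e lu by (auto simp: Dg_def)
    assume "\<not> h l < h u"
    moreover have "h l \<noteq> h u" using assms(2) lt lu Lo_I Up_I by (metis inj_onD less_irrefl)
    ultimately have "h u < h l" by simp
    then have "x u \<le> x l" using assms(1) lu Lo_I Up_I by blast
    then show False using lt by simp
  qed
  then show "e \<in> Dg h" using e by (auto simp: Dg_def)
qed

end

section \<open>Signed permutations and the weak order\<close>


definition swp :: "int \<Rightarrow> int \<Rightarrow> perm" where
  "swp i j = (\<lambda>k. if k = i then j else if k = j then i else if k = - i then - j
                  else if k = - j then - i else k)"

lemma sgen_swp: "sgen i = swp i (i + 1)" and s0_swp: "s0 = swp (-1) 1"
  by (auto simp: sgen_def s0_def swp_def)

lemma swp_swp [simp]: "i \<noteq> 0 \<Longrightarrow> j \<noteq> 0 \<Longrightarrow> swp i j (swp i j k) = k"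
  by (auto simp: swp_def)

lemma swp_swp_comp [simp]: "i \<noteq> 0 \<Longrightarrow> j \<noteq> 0 \<Longrightarrow> swp i j \<circ> swp i j = id"
  by (auto simp: fun_eq_iff)

lemma swp_odd: "i \<noteq> 0 \<Longrightarrow> j \<noteq> 0 \<Longrightarrow> swp i j (- k) = - swp i j k"
  by (auto simp: swp_def)

lemma swp_commute: "i \<noteq> 0 \<Longrightarrow> j \<noteq> 0 \<Longrightarrow> swp i j = swp j i"
  by (auto simp: swp_def fun_eq_iff)

lemma swp_neg: "i \<noteq> 0 \<Longrightarrow> j \<noteq> 0 \<Longrightarrow> swp (- i) (- j) = swp i j"
  by (auto simp: swp_def fun_eq_iff)

lemma swp_left [simp]: "swp i j i = j" and swp_right [simp]: "swp i j j = i"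
  by (auto simp: swp_def)

lemma swp_other: "k \<notin> {i, j, - i, - j} \<Longrightarrow> swp i j k = k"
  by (auto simp: swp_def)

lemma swp_neg_left [simp]: "i \<noteq> 0 \<Longrightarrow> j \<noteq> 0 \<Longrightarrow> swp i j (- i) = - j"
  and swp_neg_right [simp]: "i \<noteq> 0 \<Longrightarrow> j \<noteq> 0 \<Longrightarrow> swp i j (- j) = - i"
  by (auto simp: swp_def)

lemma swp_moved: "swp i j p \<noteq> p \<Longrightarrow> p \<in> {i, j, - i, - j}"
  by (auto simp: swp_def split: if_splits)

lemma swp_unique:
  assumes "i \<noteq> 0" "j \<noteq> 0" "swp i j p = q" "p \<noteq> q" shows "swp p q = swp i j"
proof -
  have "p \<in> {i, j, - i, - j}" using swp_moved assms by metis
  then show ?thesis using assms swp_commute swp_neg by auto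
qed

lemma inv_swp: "i \<noteq> 0 \<Longrightarrow> j \<noteq> 0 \<Longrightarrow> inv (swp i j) = swp i j"
  by (rule inv_unique_comp) auto

lemma bij_swp: "i \<noteq> 0 \<Longrightarrow> j \<noteq> 0 \<Longrightarrow> bij (swp i j)"
  by (rule o_bij[of "swp i j"]) auto

lemma word_prod_append: "word_prod (us @ vs) = word_prod us \<circ> word_prod vs"
  by (induction us) (auto simp: word_prod_def)

lemma word_prod_Nil [simp]: "word_prod [] = id"
  and word_prod_Cons: "word_prod (s # ws) = s \<circ> word_prod ws"
  by (auto simp: word_prod_def)

locale coxeter =
  fixes typeB :: bool and n :: nat
  assumes n1: "n \<ge> 1"
begin

text \<open>Folding the parameter keeps the simplifier from specializing the constants below to
  \<open>True\<close> or \<open>False\<close> in case distinctions.\<close>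
definition t :: bool where "t \<longleftrightarrow> typeB"

definition S :: "perm set" where "S = (if t then S_B n else S_A n)"
definition I :: "int set" where
  "I = {i. 1 \<le> i \<and> i \<le> int n \<or> t \<and> - int n \<le> i \<and> i \<le> - 1}"
abbreviation W :: "perm set" where "W \<equiv> cox_group S"
text \<open>Since \<open>0\<close> is not a letter, \<open>-1\<close> and \<open>1\<close> are
  neighbours in type B. This puts \<open>s0\<close> on the same footing as the adjacent
  transpositions.\<close>

definition consec :: "int \<Rightarrow> int \<Rightarrow> bool" where
  "consec i j \<longleftrightarrow> i \<in> I \<and> j \<in> I \<and> i < j \<and> (\<forall>k \<in> I. \<not> (i < k \<and> k < j))"
text \<open>Inversions are recorded by values, because multiplication by a reflection from the left
  exchanges values. In type B the pairs \<open>(i, j)\<close> and \<open>(- j, - i)\<close> stand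
  for the same reflection.\<close>

definition NN :: "perm \<Rightarrow> (int \<times> int) set" where
  "NN w = {(i, j). i \<in> I \<and> j \<in> I \<and> i < j \<and> inv w j < inv w i}"

lemma finite_I: "finite I"
  by (rule finite_subset[of _ "{- int n..int n}"]) (auto simp: I_def)

lemma I_nz: "i \<in> I \<Longrightarrow> i \<noteq> 0"
  by (auto simp: I_def)

lemma I_neg: "t \<Longrightarrow> i \<in> I \<Longrightarrow> - i \<in> I"
  by (auto simp: I_def)

lemma I_pos: "\<not> t \<Longrightarrow> i \<in> I \<Longrightarrow> 0 < i"
  by (auto simp: I_def)

lemma not_t_neg: "\<not> t \<Longrightarrow> i \<in> I \<Longrightarrow> - i \<notin> I"
  by (auto simp: I_def)

lemma consec_iff: "consec i j \<longleftrightarrow> i \<in> I \<and> j \<in> I \<and> (j = i + 1 \<or> i = - 1 \<and> j = 1)"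
proof
  assume c: "consec i j"
  then have ij: "i \<in> I" "j \<in> I" "i < j" by (auto simp: consec_def)
  have "i + 1 \<in> I \<or> i = -1" using ij by (auto simp: I_def)
  moreover have "1 \<in> I" using n1 by (auto simp: I_def)
  ultimately show "i \<in> I \<and> j \<in> I \<and> (j = i + 1 \<or> i = - 1 \<and> j = 1)"
    using c I_nz[of j] unfolding consec_def by force
next
  assume "i \<in> I \<and> j \<in> I \<and> (j = i + 1 \<or> i = - 1 \<and> j = 1)"
  then show "consec i j" unfolding consec_def using I_nz by force
qed

lemma consec_neg: "t \<Longrightarrow> consec i j \<Longrightarrow> consec (- j) (- i)"
proof -
  assume "t" and c: "consec i j"
  have "\<not> (- j < k \<and> k < - i)" if "k \<in> I" for k
    using c I_neg[OF \<open>t\<close> that] unfolding consec_def by force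
  then show "consec (- j) (- i)" using c I_neg[OF \<open>t\<close>] unfolding consec_def by simp
qed

lemma consec_nz: "consec i j \<Longrightarrow> i \<noteq> 0 \<and> j \<noteq> 0"
  using I_nz by (auto simp: consec_def)

lemma S_iff: "s \<in> S \<longleftrightarrow> (\<exists>i j. consec i j \<and> s = swp i j)"
proof
  assume "s \<in> S"
  then consider k where "1 \<le> k" "k < int n" "s = swp k (k + 1)" | "t" "s = swp (-1) 1"
    by (auto simp: S_def S_A_def S_B_def sgen_swp s0_swp split: if_splits)
  then show "\<exists>i j. consec i j \<and> s = swp i j"
  proof cases
    case 1
    then have "consec k (k+1)" by (auto simp: consec_iff I_def)
    then show ?thesis using 1 by blast
  next
    case 2
    then have "consec (-1) 1" using n1 by (auto simp: consec_iff I_def)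
    then show ?thesis using 2 by blast
  qed
next
  assume "\<exists>i j. consec i j \<and> s = swp i j"
  then obtain i j where c: "consec i j" and s: "s = swp i j" by blast
  show "s \<in> S"
  proof (cases "i = -1 \<and> j = 1")
    case True
    then have "t" using c I_pos[of i] by (auto simp: consec_def)
    then show ?thesis using s True by (auto simp: S_def S_B_def s0_swp)
  next
    case False
    then have j: "j = i + 1" and ij: "i \<in> I" "j \<in> I" using c by (auto simp: consec_iff)
    show ?thesis
    proof (cases "i > 0")
      case True
      then have "s \<in> sgen ` {1..<int n}" using s j ij by (auto simp: sgen_swp I_def)
      then show ?thesis by (auto simp: S_def S_A_def S_B_def)
    next
      case False
      then have "i < 0" "j < 0" using I_nz[OF ij(1)] I_nz[OF ij(2)] j by auto
      moreover have "s = swp (- j) (- i)"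
        using s swp_neg[of i j] swp_commute[of "- i" "- j"] I_nz ij by auto
      then have "s = sgen (- j)" using j by (simp add: sgen_swp)
      moreover have "- j \<in> {1..<int n}" using ij j \<open>j < 0\<close> by (auto simp: I_def)
      ultimately show ?thesis by (auto simp: S_def S_A_def S_B_def)
    qed
  qed
qed

text \<open>An exchange of neighbours reverses only the comparison of the two exchanged entries and
  its mirror image. Zero has to be excluded because it lies between the neighbours \<open>-1\<close>
  and \<open>1\<close>.\<close>

lemma swp_mono:
  assumes c: "consec i j" and pq: "p < q" "p \<noteq> 0" "q \<noteq> 0" "swp i j p \<noteq> q"
  shows "swp i j p < swp i j q"
proof -
  have "i \<noteq> 0" "j \<noteq> 0" "j = i + 1 \<or> i = - 1 \<and> j = 1"
    using c consec_nz by (auto simp: consec_iff)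
  then show ?thesis using pq unfolding swp_def by (smt (verit))
qed

lemma swp_I: assumes "i \<in> I" "j \<in> I" "k \<in> I" shows "swp i j k \<in> I"
  using assms by (cases t) (auto simp: swp_def I_neg not_t_neg)

section \<open>Group elements as odd permutations preserving the letters\<close>

definition signed_perm :: "perm \<Rightarrow> bool" where
  "signed_perm w \<longleftrightarrow> bij w \<and> (\<forall>k. w (- k) = - w k) \<and> w ` I = I \<and> (\<forall>k. int n < \<bar>k\<bar> \<longrightarrow> w k = k)"

lemma signed_perm_id: "signed_perm id"
  by (auto simp: signed_perm_def)

lemma signed_perm_comp: "signed_perm v \<Longrightarrow> signed_perm w \<Longrightarrow> signed_perm (v \<circ> w)"
  unfolding signed_perm_def by (simp add: bij_comp) (metis image_image)

lemma signed_perm_swp: assumes "i \<in> I" "j \<in> I" shows "signed_perm (swp i j)"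
proof -
  have nz: "i \<noteq> 0" "j \<noteq> 0" using assms I_nz by auto
  have "swp i j ` I = I"
  proof
    show "swp i j ` I \<subseteq> I" using swp_I assms by blast
    show "I \<subseteq> swp i j ` I"
      using swp_I[OF assms] nz by (metis image_eqI subsetI swp_swp)
  qed
  moreover have "swp i j k = k" if "int n < \<bar>k\<bar>" for k
    using that assms by (auto simp: swp_def I_def)
  ultimately show ?thesis using nz by (auto simp: signed_perm_def bij_swp swp_odd)
qed

lemma S_signed: "s \<in> S \<Longrightarrow> signed_perm s"
  using S_iff signed_perm_swp by (auto simp: consec_def)

lemma S_invol: "s \<in> S \<Longrightarrow> s \<circ> s = id"
  using S_iff consec_nz swp_swp_comp by metis

lemma W_signed: assumes "w \<in> W" shows "signed_perm w"
proof -
  obtain ws where ws: "set ws \<subseteq> S" "w = word_prod ws" using assms by (auto simp: cox_group_def)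
  then show ?thesis
    by (induction ws arbitrary: w)
      (auto simp: signed_perm_id word_prod_Cons S_signed intro!: signed_perm_comp)
qed

lemma word_W: "set ws \<subseteq> S \<Longrightarrow> word_prod ws \<in> W"
  by (auto simp: cox_group_def)

lemma W_comp: assumes "v \<in> W" "w \<in> W" shows "v \<circ> w \<in> W"
proof -
  obtain vs ws where "set vs \<subseteq> S" "v = word_prod vs" "set ws \<subseteq> S" "w = word_prod ws"
    using assms by (auto simp: cox_group_def)
  then show ?thesis using word_W[of "vs @ ws"] by (auto simp: word_prod_append)
qed

lemma S_W: "s \<in> S \<Longrightarrow> s \<in> W"
  using word_W[of "[s]"] by (simp add: word_prod_def)

lemma id_W: "id \<in> W"
  using word_W[of "[]"] by simp

lemma W_bij: "w \<in> W \<Longrightarrow> bij w"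
  using W_signed signed_perm_def by blast

lemma inv_inv_W: "w \<in> W \<Longrightarrow> w (inv w k) = k" "w \<in> W \<Longrightarrow> inv w (w k) = k"
  using W_bij by (auto simp: bij_def surj_f_inv_f)

lemma inv_eq_iff: "w \<in> W \<Longrightarrow> inv w i = inv w j \<longleftrightarrow> i = j"
  using inv_inv_W by metis

lemma inv_odd: "w \<in> W \<Longrightarrow> inv w (- k) = - inv w k"
  using W_signed[of w] inv_inv_W[of w] unfolding signed_perm_def by metis

lemma inv_zero: "w \<in> W \<Longrightarrow> inv w 0 = 0"
  using inv_odd[of w 0] by simp

lemma inv_zero_iff: "w \<in> W \<Longrightarrow> inv w k = 0 \<longleftrightarrow> k = 0"
  using inv_zero inv_eq_iff by metis

lemma W_image: "w \<in> W \<Longrightarrow> w ` I = I"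
  using W_signed signed_perm_def by blast

lemma W_I: "w \<in> W \<Longrightarrow> k \<in> I \<Longrightarrow> w k \<in> I"
  using W_image by blast

lemma inv_I: assumes "w \<in> W" shows "inv w k \<in> I \<longleftrightarrow> k \<in> I"
proof
  show "inv w k \<in> I \<Longrightarrow> k \<in> I" using W_I[OF assms, of "inv w k"] inv_inv_W[OF assms] by simp
  assume "k \<in> I"
  then obtain j where "j \<in> I" "k = w j" using W_image assms by blast
  then show "inv w k \<in> I" using inv_inv_W assms by simp
qed

lemma W_range: "w \<in> W \<Longrightarrow> int n < \<bar>k\<bar> \<Longrightarrow> w k = k"
  using W_signed signed_perm_def by blast

lemma W_inverse: assumes "w \<in> W" shows "inv w \<in> W"
proof -
  obtain ws where ws: "set ws \<subseteq> S" "w = word_prod ws" using assms by (auto simp: cox_group_def)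
  then show ?thesis
  proof (induction ws arbitrary: w)
    case Nil then show ?case using id_W by (simp only: word_prod_Nil inv_id)
  next
    case (Cons s ws)
    have "inv s = s" using S_invol[of s] Cons.prems inv_unique_comp by auto
    moreover have "bij s" "bij (word_prod ws)" using Cons.prems S_W word_W W_bij by auto
    ultimately have "inv w = inv (word_prod ws) \<circ> s"
      using Cons.prems(2) o_inv_distrib[of s "word_prod ws"] by (simp only: word_prod_Cons)
    moreover have "inv (word_prod ws) \<circ> s \<in> W" using Cons by (intro W_comp[OF _ S_W]) auto
    ultimately show ?case by (simp only:)
  qed
qed

lemma conj_swp:
  assumes w: "w \<in> W" and nz: "i \<noteq> 0" "j \<noteq> 0"
  shows "w \<circ> swp i j = swp (w i) (w j) \<circ> w"
proof -
  have odd: "w (- k) = - w k" for k using W_signed[OF w] by (auto simp: signed_perm_def)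
  have inj: "w a = w b \<longleftrightarrow> a = b" for a b using W_bij[OF w] by (auto simp: bij_def inj_eq)
  have inj': "w a = - w b \<longleftrightarrow> a = - b" for a b using inj[of a "- b"] odd by simp
  show ?thesis by (rule ext) (simp add: swp_def inj inj' odd)
qed

lemma inv_flip:
  assumes w: "w \<in> W" and nz: "p \<noteq> 0" "q \<noteq> 0"
  shows "inv (swp p q \<circ> w) = inv w \<circ> swp p q"
  using o_inv_distrib[OF bij_swp W_bij] assms inv_swp by simp

lemma flip_conj:
  assumes w: "w \<in> W" and nz: "p \<noteq> 0" "q \<noteq> 0"
  shows "swp p q \<circ> w = w \<circ> swp (inv w p) (inv w q)"
  using conj_swp[OF w, of "inv w p" "inv w q"] inv_inv_W[OF w] inv_zero_iff[OF w] nz by simp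

text \<open>Exchanging two values at neighbouring positions is multiplication from the right by the
  generator of these positions.\<close>

lemma flip_W:
  assumes w: "w \<in> W" and c: "consec (inv w p) (inv w q)"
  shows "swp p q \<circ> w \<in> W"
proof -
  have nz: "p \<noteq> 0" "q \<noteq> 0" using consec_nz[OF c] inv_zero_iff[OF w] by auto
  have "swp (inv w p) (inv w q) \<in> S" using c S_iff by blast
  then show ?thesis using flip_conj[OF w nz] W_comp S_W w by simp
qed

lemma flip_order:
  assumes w: "w \<in> W" and c: "consec (inv w p) (inv w q)" and nz: "r1 \<noteq> 0" "r2 \<noteq> 0"
    and lt: "inv w r1 < inv w r2" and ne: "(r1, r2) \<notin> {(p, q), (- q, - p)}"
  shows "inv (swp p q \<circ> w) r1 < inv (swp p q \<circ> w) r2"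
proof -
  let ?i = "inv w p" and ?j = "inv w q"
  have pq: "p \<noteq> 0" "q \<noteq> 0" "p \<in> I" "q \<in> I" using c inv_I[OF w] I_nz by (auto simp: consec_def)
  have nz': "?i \<noteq> 0" "?j \<noteq> 0" using consec_nz[OF c] by auto
  have "inv (swp p q \<circ> w) = swp ?i ?j \<circ> inv w"
    using flip_conj[OF w pq(1,2)] o_inv_distrib[OF W_bij[OF w] bij_swp[OF nz']] inv_swp[OF nz'] by simp
  moreover have "swp ?i ?j (inv w r1) \<noteq> inv w r2"
  proof
    assume a: "swp ?i ?j (inv w r1) = inv w r2"
    then have "inv w r1 \<in> {?i, ?j, - ?i, - ?j}" using lt by (intro swp_moved) simp
    then have "inv w r1 = ?i \<and> inv w r2 = ?j \<or> inv w r1 = - ?j \<and> inv w r2 = - ?i"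
      using a[symmetric] lt c nz' by (auto simp: consec_def)
    then show False using ne inv_eq_iff[OF w] by (auto simp flip: inv_odd[OF w])
  qed
  ultimately show ?thesis
    using swp_mono[OF c lt] nz inv_zero_iff[OF w] by simp
qed

text \<open>By \<open>flip_order\<close> no comparison changes besides the exchanged pair and its
  mirror image. In type A the intersection with \<open>I \<times> I\<close> removes the mirror
  image, which involves negative numbers.\<close>

lemma NN_flip:
  assumes w: "w \<in> W" and c: "consec (inv w p) (inv w q)" and pq: "p < q"
  shows "NN (swp p q \<circ> w) = NN w \<union> {(p, q), (- q, - p)} \<inter> I \<times> I"
proof -
  let ?w = "swp p q \<circ> w"
  have pqI: "p \<in> I" "q \<in> I" "inv w p < inv w q" using c inv_I[OF w] by (auto simp: consec_def)
  have nz: "p \<noteq> 0" "q \<noteq> 0" using pqI I_nz by auto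
  have W': "?w \<in> W" by (rule flip_W[OF w c])
  have "(i, j) \<in> NN ?w \<longleftrightarrow> (i, j) \<in> NN w \<union> {(p, q), (- q, - p)} \<inter> I \<times> I" if "i \<in> I" "j \<in> I" "i < j" for i j
  proof (cases "(i, j) \<in> {(p, q), (- q, - p)}")
    case True
    then have "inv ?w j < inv ?w i"
      using inv_flip[OF w nz] pqI nz inv_odd[OF w] by auto
    then show ?thesis using True that by (auto simp: NN_def)
  next
    case False
    have "inv ?w j < inv ?w i \<longleftrightarrow> inv w j < inv w i"
    proof
      assume "inv w j < inv w i"
      then show "inv ?w j < inv ?w i" using flip_order[OF w c, of j i] that pq I_nz by auto
    next
      assume a: "inv ?w j < inv ?w i"
      show "inv w j < inv w i"
      proof (rule ccontr)
        assume "\<not> ?thesis"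
        then have "inv w i < inv w j" using inv_eq_iff[OF w, of i j] that by linarith
        then show False using flip_order[OF w c, of i j] that False I_nz a by auto
      qed
    qed
    then show ?thesis using False that by (auto simp: NN_def)
  qed
  note iff = this
  have R: "i \<in> I \<and> j \<in> I \<and> i < j" if "(i, j) \<in> NN w \<union> {(p, q), (- q, - p)} \<inter> I \<times> I" for i j
    using that pq by (auto simp: NN_def)
  have L: "i \<in> I \<and> j \<in> I \<and> i < j" if "(i, j) \<in> NN ?w" for i j
    using that by (auto simp: NN_def)
  show ?thesis
  proof (intro equalityI subrelI)
    fix i j assume "(i, j) \<in> NN ?w"
    then show "(i, j) \<in> NN w \<union> {(p, q), (- q, - p)} \<inter> I \<times> I" using L iff by blast
  next
    fix i j assume "(i, j) \<in> NN w \<union> {(p, q), (- q, - p)} \<inter> I \<times> I"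
    then show "(i, j) \<in> NN ?w" using R iff by blast
  qed
qed

lemma NN_I: "NN w \<subseteq> I \<times> I"
  by (auto simp: NN_def)

lemma finite_NN: "finite (NN w)"
  using finite_I NN_I finite_subset by (metis finite_SigmaI)

lemma NN_sym: "w \<in> W \<Longrightarrow> (i, j) \<in> NN w \<Longrightarrow> t \<Longrightarrow> (- j, - i) \<in> NN w"
  using I_neg inv_odd by (auto simp: NN_def)

lemma NN_trans: "w \<in> W \<Longrightarrow> (i, j) \<in> NN w \<Longrightarrow> (j, k) \<in> NN w \<Longrightarrow> (i, k) \<in> NN w"
  by (auto simp: NN_def)

lemma not_NN: "w \<in> W \<Longrightarrow> i \<in> I \<Longrightarrow> j \<in> I \<Longrightarrow> i < j \<Longrightarrow> (i, j) \<notin> NN w \<longleftrightarrow> inv w i < inv w j"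
  using inv_eq_iff[of w i j] by (auto simp: NN_def)

lemma NN_id: "NN id = {}"
  by (auto simp: NN_def)

section \<open>Words, length and inversion sets\<close>

text \<open>This is the strong exchange property. Some letter of the word is the one at which
  \<open>i\<close> and \<open>j\<close> change their order, and its conjugate by the prefix before
  it is the reflection exchanging them.\<close>

lemma deletion:
  assumes "set ws \<subseteq> S" "i < j" "i \<noteq> 0" "j \<noteq> 0" "inv (word_prod ws) j < inv (word_prod ws) i"
  obtains us s vs where "ws = us @ s # vs" "swp i j = word_prod us \<circ> s \<circ> inv (word_prod us)"
proof -
  have "\<exists>us s vs. ws = us @ s # vs \<and> swp i j = word_prod us \<circ> s \<circ> inv (word_prod us)"
    using assms
  proof (induction ws rule: rev_induct)
    case Nil then show ?case by simp
  next
    case (snoc s ws)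
    let ?v = "word_prod ws"
    have v: "?v \<in> W" and s: "s \<in> S" using snoc.prems word_W by auto
    obtain a b where ab: "consec a b" "s = swp a b" using s S_iff by blast
    have nz: "a \<noteq> 0" "b \<noteq> 0" using consec_nz ab by auto
    have inv: "inv (word_prod (ws @ [s])) = swp a b \<circ> inv ?v"
      using o_inv_distrib[OF W_bij[OF v] bij_swp[OF nz]] inv_swp[OF nz] ab
      by (simp add: word_prod_append word_prod_Cons)
    show ?case
    proof (cases "inv ?v j < inv ?v i")
      case True
      have "set ws \<subseteq> S" using snoc.prems by simp
      from snoc.IH[OF this snoc.prems(2-4) True] obtain us s' vs
        where "ws = us @ s' # vs" "swp i j = word_prod us \<circ> s' \<circ> inv (word_prod us)" by blast
      then show ?thesis by (intro exI[of _ us] exI[of _ s'] exI[of _ "vs @ [s]"]) simp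
    next
      case False
      then have lt: "inv ?v i < inv ?v j" using inv_eq_iff[OF v, of i j] snoc.prems by linarith
      \<comment> \<open>The prefix does not invert the pair, so the last letter does; by
        \<open>swp_mono\<close> it must exchange precisely the positions of \<open>i\<close> and
        \<open>j\<close>.\<close>
      have "swp a b (inv ?v i) = inv ?v j"
        using swp_mono[OF ab(1) lt] inv_zero_iff[OF v] snoc.prems inv by fastforce
      then have "swp (inv ?v i) (inv ?v j) = s" using swp_unique[OF nz, of "inv ?v i"] lt ab by simp
      then have "swp i j \<circ> ?v = ?v \<circ> s" using flip_conj[OF v] snoc.prems by auto
      then have "swp i j = ?v \<circ> s \<circ> inv ?v"
        using W_bij[OF v] by (metis bij_def comp_assoc comp_id surj_iff)
      then show ?thesis by (intro exI[of _ ws] exI[of _ s] exI[of _ "[]"]) simp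
    qed
  qed
  then show ?thesis using that by blast
qed

lemma cox_len_word:
  assumes "w \<in> W"
  obtains ws where "set ws \<subseteq> S" "length ws = cox_len S w" "word_prod ws = w"
proof -
  have "\<exists>k ws. set ws \<subseteq> S \<and> length ws = k \<and> word_prod ws = w"
    using assms by (auto simp: cox_group_def)
  then have "\<exists>ws. set ws \<subseteq> S \<and> length ws = cox_len S w \<and> word_prod ws = w"
    unfolding cox_len_def by (rule LeastI_ex)
  then show ?thesis using that by blast
qed

lemma cox_len_le: "set ws \<subseteq> S \<Longrightarrow> cox_len S (word_prod ws) \<le> length ws"
  unfolding cox_len_def by (rule Least_le) blast

text \<open>Multiplication by the reflection deletes the letter found by \<open>deletion\<close>
  from a shortest word of \<open>w\<close>.\<close>

lemma NN_reflection:
  assumes w: "w \<in> W" and ij: "(i, j) \<in> NN w"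
  shows "swp i j \<in> reflections S" "cox_len S (swp i j \<circ> w) < cox_len S w"
proof -
  have ij': "i \<in> I" "j \<in> I" "i < j" "inv w j < inv w i" using ij by (auto simp: NN_def)
  obtain ws where ws: "set ws \<subseteq> S" "length ws = cox_len S w" "word_prod ws = w"
    using cox_len_word[OF w] .
  obtain us s vs where d: "ws = us @ s # vs" "swp i j = word_prod us \<circ> s \<circ> inv (word_prod us)"
    using deletion[OF ws(1), of i j] ij' I_nz ws(3) by metis
  have u: "word_prod us \<in> W" and s: "s \<in> S" using ws d word_W by auto
  show "swp i j \<in> reflections S" using d u s by (auto simp: reflections_def)
  have "inv (word_prod us) \<circ> word_prod us = id" using W_bij[OF u] by (simp add: bij_def)
  moreover have "w = word_prod us \<circ> s \<circ> word_prod vs"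
    using ws(3) d(1) by (simp add: word_prod_append word_prod_Cons comp_assoc)
  ultimately have "swp i j \<circ> w = word_prod us \<circ> (s \<circ> s) \<circ> word_prod vs"
    using d(2) by (simp add: comp_assoc) (metis comp_assoc comp_id)
  then have "swp i j \<circ> w = word_prod (us @ vs)"
    using S_invol[OF s] by (simp add: word_prod_append)
  then have "cox_len S (swp i j \<circ> w) \<le> length (us @ vs)"
    using cox_len_le[of "us @ vs"] ws d by auto
  then show "cox_len S (swp i j \<circ> w) < cox_len S w" using ws(2) d(1) by simp
qed

lemma reflections_W: "r \<in> reflections S \<Longrightarrow> r \<in> W"
  using W_comp W_inverse S_W by (auto simp: reflections_def)

lemma reflection_swp:
  assumes "r \<in> reflections S"
  obtains i j where "i \<in> I" "j \<in> I" "i < j" "r = swp i j"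
proof -
  obtain v s where v: "v \<in> W" and s: "s \<in> S" and r: "r = v \<circ> s \<circ> inv v"
    using assms by (auto simp: reflections_def)
  obtain a b where ab: "consec a b" "s = swp a b" using s S_iff by blast
  have nz: "a \<noteq> 0" "b \<noteq> 0" "a \<in> I" "b \<in> I" "a \<noteq> b" using consec_nz ab by (auto simp: consec_def)
  have r': "r = swp (v a) (v b)"
    using conj_swp[OF v nz(1,2)] r ab W_bij[OF v] by (metis bij_def comp_assoc comp_id surj_iff)
  have vI: "v a \<in> I" "v b \<in> I" "v a \<noteq> v b" using W_I[OF v] nz W_bij[OF v] by (auto simp: bij_def inj_eq)
  then have "r = swp (v b) (v a)" using r' swp_commute I_nz by simp
  then show ?thesis using that[of "v a" "v b"] that[of "v b" "v a"] vI r' by linarith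
qed

text \<open>If the pair is not inverted in \<open>w\<close>, it is inverted in the product with the
  reflection. Applying \<open>NN_reflection\<close> to that product shows that the length goes
  up.\<close>

lemma inversions_iff:
  assumes w: "w \<in> W" and ij: "i \<in> I" "j \<in> I" "i < j"
  shows "swp i j \<in> inversions S w \<longleftrightarrow> (i, j) \<in> NN w"
proof
  assume "(i, j) \<in> NN w"
  then show "swp i j \<in> inversions S w" using NN_reflection[OF w] by (auto simp: inversions_def)
next
  assume a: "swp i j \<in> inversions S w"
  then have r: "swp i j \<in> W" using reflections_W by (auto simp: inversions_def)
  have nz: "i \<noteq> 0" "j \<noteq> 0" using ij I_nz by auto
  show "(i, j) \<in> NN w"
  proof (rule ccontr)
    assume "(i, j) \<notin> NN w"
    then have lt: "inv w i < inv w j" using not_NN[OF w ij] by simp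
    have W': "swp i j \<circ> w \<in> W" using W_comp r w by blast
    have "(i, j) \<in> NN (swp i j \<circ> w)" using lt ij inv_flip[OF w nz] by (simp add: NN_def)
    from NN_reflection(2)[OF W' this] have "cox_len S w < cox_len S (swp i j \<circ> w)"
      using nz by (simp flip: comp_assoc)
    then show False using a by (simp add: inversions_def)
  qed
qed

lemma weak_le_iff: assumes "v \<in> W" "w \<in> W" shows "weak_le S v w \<longleftrightarrow> NN v \<subseteq> NN w"
proof
  assume le: "weak_le S v w"
  show "NN v \<subseteq> NN w"
  proof (rule subrelI)
    fix i j assume a: "(i, j) \<in> NN v"
    then have "i \<in> I" "j \<in> I" "i < j" by (auto simp: NN_def)
    then show "(i, j) \<in> NN w" using inversions_iff[OF assms(1)] inversions_iff[OF assms(2)] le a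
      unfolding weak_le_def by blast
  qed
next
  assume le: "NN v \<subseteq> NN w"
  have "r \<in> inversions S w" if r: "r \<in> inversions S v" for r
  proof -
    have "r \<in> reflections S" using r by (auto simp: inversions_def)
    then obtain i j where "i \<in> I" "j \<in> I" "i < j" "r = swp i j" using reflection_swp by blast
    then show ?thesis using inversions_iff assms le r by blast
  qed
  then show "weak_le S v w" by (auto simp: weak_le_def)
qed

lemma NN_order: "w \<in> W \<Longrightarrow> i \<in> I \<Longrightarrow> j \<in> I \<Longrightarrow>
   inv w i < inv w j \<longleftrightarrow> (if i < j then (i, j) \<notin> NN w else (j, i) \<in> NN w)"
  using inv_eq_iff[of w i j] by (auto simp: NN_def)

lemma strict_mono_on_finite_id:
  fixes h :: "int \<Rightarrow> int"
  assumes A: "finite A" "h ` A = A" "\<And>i j. i \<in> A \<Longrightarrow> j \<in> A \<Longrightarrow> i < j \<longleftrightarrow> h i < h j" and p: "p \<in> A"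
  shows "h p = p"
proof -
  have inj: "inj_on h A" using A(3) by (intro inj_onI) (metis less_irrefl linorder_cases)
  have "{q \<in> A. q < h p} = h ` {q \<in> A. q < p}"
  proof
    show "h ` {q \<in> A. q < p} \<subseteq> {q \<in> A. q < h p}" using A(2,3) p by auto
    show "{q \<in> A. q < h p} \<subseteq> h ` {q \<in> A. q < p}"
    proof
      fix x assume x: "x \<in> {q \<in> A. q < h p}"
      then obtain q where "q \<in> A" "x = h q" using A(2) by blast
      then show "x \<in> h ` {q \<in> A. q < p}" using A(3)[of q p] p x by auto
    qed
  qed
  moreover have "card (h ` {q \<in> A. q < p}) = card {q \<in> A. q < p}"
    by (rule card_image) (use inj in \<open>auto intro: inj_on_subset\<close>)
  ultimately have eq: "card {q \<in> A. q < h p} = card {q \<in> A. q < p}" by simp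
  have mono: "card {q \<in> A. q < x} < card {q \<in> A. q < y}" if "x \<in> A" "x < y" for x y
    by (rule psubset_card_mono) (use that A(1) in auto)
  show ?thesis using mono[of p "h p"] mono[of "h p" p] eq p A(2) by force
qed

lemma NN_inj: assumes v: "v \<in> W" and w: "w \<in> W" and eq: "NN v = NN w" shows "v = w"
proof -
  have ord: "inv v i < inv v j \<longleftrightarrow> inv w i < inv w j" if "i \<in> I" "j \<in> I" for i j
    using NN_order v w that eq by simp
  have I': "inv w (v p) = p" if p: "p \<in> I" for p
  proof (rule strict_mono_on_finite_id[OF finite_I _ _ p, of "\<lambda>p. inv w (v p)"])
    have "(\<lambda>p. inv w (v p)) ` I = inv w ` I" using W_image[OF v] by (metis image_image)
    then show "(\<lambda>p. inv w (v p)) ` I = I" using W_image[OF W_inverse[OF w]] by simp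
    show "i < j \<longleftrightarrow> inv w (v i) < inv w (v j)" if "i \<in> I" "j \<in> I" for i j
      using ord[of "v i" "v j"] W_I[OF v] that inv_inv_W[OF v] by simp
  qed
  have vI: "v p = w p" if "p \<in> I" for p using I'[OF that] inv_inv_W[OF w] by metis
  show ?thesis
  proof
    fix k
    have odd: "v (- k) = - v k" "w (- k) = - w k" for k
      using W_signed[OF v] W_signed[OF w] by (auto simp: signed_perm_def)
    have "k \<in> I \<or> - k \<in> I \<or> int n < \<bar>k\<bar> \<or> k = 0" by (auto simp: I_def)
    then show "v k = w k" using vI[of k] vI[of "- k"] odd[of k] odd[of 0]
      W_range[OF v, of k] W_range[OF w, of k] by auto
  qed
qed

section \<open>Realizing orders and biclosed sets, joins and meets\<close>

lemma strict_mono_of_consec: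
  fixes f :: "int \<Rightarrow> 'a::order"
  assumes "\<And>i j. consec i j \<Longrightarrow> f i < f j" "i \<in> I" "j \<in> I" "i < j"
  shows "f i < f j"
  using assms(2-4)
proof (induction "nat (j - i)" arbitrary: i j rule: less_induct)
  case less
  show ?case
  proof (cases "consec i j")
    case False
    then obtain k where k: "k \<in> I" "i < k" "k < j" using less.prems by (auto simp: consec_def)
    have "f i < f k" using less.hyps[of k i] less.prems k by simp
    also have "f k < f j" using less.hyps[of j k] less.prems k by simp
    finally show ?thesis .
  qed (use assms in blast)
qed

text \<open>Bubble sort. If neighbours \<open>i\<close>, \<open>j\<close> are out of order,
  precomposing \<open>f\<close> with their exchange maps the inversions of the new function
  injectively to the inversions of \<open>f\<close> other than \<open>(i, j)\<close>, and the
  exchange is a generator.\<close>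

lemma realize:
  fixes f :: "int \<Rightarrow> int"
  assumes "inj_on f I" "\<And>i. i \<in> I \<Longrightarrow> - i \<in> I \<Longrightarrow> f (- i) = - f i"
  shows "\<exists>w \<in> W. \<forall>i \<in> I. \<forall>j \<in> I. inv w i < inv w j \<longleftrightarrow> f i < f j"
  using assms
proof (induction "card {(i, j). i \<in> I \<and> j \<in> I \<and> i < j \<and> f j < f i}" arbitrary: f rule: less_induct)
  case less
  let ?N = "\<lambda>f::int\<Rightarrow>int. {(i, j). i \<in> I \<and> j \<in> I \<and> i < j \<and> f j < f i}"
  have finN: "finite (?N f)" for f
    by (rule finite_subset[of _ "I \<times> I"]) (use finite_I in auto)
  show ?case
  proof (cases "\<exists>i j. consec i j \<and> f j < f i")
    case False
    then have "f i < f j" if "consec i j" for i j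
      using that less.prems(1) inj_onD[OF less.prems(1), of i j] by (force simp: consec_def not_less)
    then have mono: "f i < f j" if "i \<in> I" "j \<in> I" "i < j" for i j
      using strict_mono_of_consec that by blast
    have "i < j \<longleftrightarrow> f i < f j" if "i \<in> I" "j \<in> I" for i j
      using mono[of i j] mono[of j i] that by (cases i j rule: linorder_cases) auto
    then show ?thesis using id_W by (intro bexI[of _ id]) auto
  next
    case True
    then obtain i j where ij: "consec i j" "f j < f i" by blast
    let ?s = "swp i j"
    have ijI: "i \<in> I" "j \<in> I" "i < j" using ij by (auto simp: consec_def)
    have nz: "i \<noteq> 0" "j \<noteq> 0" using ijI I_nz by auto
    have sI: "?s k \<in> I" if "k \<in> I" for k using swp_I ijI that by blast
    have inj': "inj_on (f \<circ> ?s) I"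
      using less.prems(1) sI nz unfolding inj_on_def by (metis comp_apply swp_swp)
    have odd': "(f \<circ> ?s) (- k) = - (f \<circ> ?s) k" if "k \<in> I" "- k \<in> I" for k
      using less.prems(2)[of "?s k"] sI[of k] sI[of "- k"] that swp_odd[OF nz, of k] by simp
    have "(\<lambda>(a, b). (?s a, ?s b)) ` ?N (f \<circ> ?s) \<subseteq> ?N f - {(i, j)}"
    proof
      fix ab' assume "ab' \<in> (\<lambda>(a, b). (?s a, ?s b)) ` ?N (f \<circ> ?s)"
      then obtain a b where ab: "ab' = (?s a, ?s b)" "a \<in> I" "b \<in> I" "a < b" "f (?s b) < f (?s a)" by auto
      have "?s a \<noteq> b"
      proof
        assume sa: "?s a = b"
        then have sb: "?s b = a" using nz by auto
        have "a \<in> {i, j, -i, -j}" using sa ab swp_moved[of i j a] by auto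
        then have "(a, b) = (i, j) \<or> (a, b) = (- j, - i)" using sa nz ab ijI by auto
        then show False
        proof
          assume "(a, b) = (i, j)" then show False using sa sb ij ab by auto
        next
          assume "(a, b) = (- j, - i)"
          then show False using sa sb ij ab less.prems(2)[of i] less.prems(2)[of j] ijI by auto
        qed
      qed
      then have "?s a < ?s b" using swp_mono[OF ij(1) ab(4)] ab I_nz by auto
      moreover have "(?s a, ?s b) \<noteq> (i, j)"
      proof
        assume e: "(?s a, ?s b) = (i, j)"
        then have "?s (?s a) = j" "?s (?s b) = i" by simp_all
        then have "a = j" "b = i" unfolding swp_swp[OF nz] .
        then show False using ab ijI by simp
      qed
      ultimately show "ab' \<in> ?N f - {(i, j)}" using ab sI by auto
    qed
    then have "card ((\<lambda>(a, b). (?s a, ?s b)) ` ?N (f \<circ> ?s)) \<le> card (?N f - {(i, j)})"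
      using finN by (intro card_mono) auto
    moreover have "card ((\<lambda>(a, b). (?s a, ?s b)) ` ?N (f \<circ> ?s)) = card (?N (f \<circ> ?s))"
      by (rule card_image, rule inj_onI) (use nz in \<open>auto, (metis swp_swp)+\<close>)
    moreover have "card (?N f - {(i, j)}) < card (?N f)"
      by (rule psubset_card_mono) (use finN ij ijI in auto)
    ultimately have "card (?N (f \<circ> ?s)) < card (?N f)" by linarith
    from less.hyps[OF this inj' odd'] obtain w where
      w: "w \<in> W" "\<forall>a\<in>I. \<forall>b\<in>I. inv w a < inv w b \<longleftrightarrow> (f \<circ> ?s) a < (f \<circ> ?s) b" by blast
    have "?s \<circ> w \<in> W" using W_comp S_W S_iff ij w by blast
    moreover have "inv (?s \<circ> w) a < inv (?s \<circ> w) b \<longleftrightarrow> f a < f b" if "a \<in> I" "b \<in> I" for a b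
      using inv_flip[OF w(1) nz] w(2) sI that nz by simp
    ultimately show ?thesis by blast
  qed
qed

lemma realize_order:
  assumes irr: "\<And>i. i \<in> I \<Longrightarrow> \<not> R i i"
    and tr: "\<And>i j k. i \<in> I \<Longrightarrow> j \<in> I \<Longrightarrow> k \<in> I \<Longrightarrow> R i j \<Longrightarrow> R j k \<Longrightarrow> R i k"
    and tot: "\<And>i j. i \<in> I \<Longrightarrow> j \<in> I \<Longrightarrow> i \<noteq> j \<Longrightarrow> R i j \<or> R j i"
    and odd: "\<And>i j. t \<Longrightarrow> i \<in> I \<Longrightarrow> j \<in> I \<Longrightarrow> R i j \<Longrightarrow> R (- j) (- i)"
  obtains w where "w \<in> W" "\<And>i j. i \<in> I \<Longrightarrow> j \<in> I \<Longrightarrow> inv w i < inv w j \<longleftrightarrow> R i j"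
proof -
  \<comment> \<open>The number of smaller letters minus the number of larger ones, rather than the
    rank alone: it changes sign when the order is reversed by negation, which gives the oddness that
    \<open>realize\<close> asks for.\<close>
  define f where "f i = int (card {j \<in> I. R j i}) - int (card {j \<in> I. R i j})" for i
  have mono: "f i < f j" if ij: "i \<in> I" "j \<in> I" "R i j" for i j
  proof -
    have "{k \<in> I. R k i} \<subseteq> {k \<in> I. R k j}" using tr[OF _ ij(1,2) _ ij(3)] by blast
    then have "{k \<in> I. R k i} \<subset> {k \<in> I. R k j}" using ij irr[OF ij(1)] by blast
    then have "card {k \<in> I. R k i} < card {k \<in> I. R k j}"
      using finite_I by (intro psubset_card_mono) simp_all
    moreover have "{k \<in> I. R j k} \<subseteq> {k \<in> I. R i k}" using tr[OF ij(1,2) _ ij(3)] by blast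
    then have "card {k \<in> I. R j k} \<le> card {k \<in> I. R i k}"
      using finite_I by (intro card_mono) simp_all
    ultimately show ?thesis by (simp add: f_def)
  qed
  have iff: "f i < f j \<longleftrightarrow> R i j" if "i \<in> I" "j \<in> I" for i j
    using mono[of i j] mono[of j i] tot[of i j] that by (cases "i = j") (auto simp: irr)
  have inj: "inj_on f I"
    by (rule inj_onI) (metis iff less_irrefl tot)
  have odd': "f (- i) = - f i" if i: "i \<in> I" "- i \<in> I" for i
  proof -
    have t using i not_t_neg by blast
    have 1: "{j \<in> I. R j (- i)} = uminus ` {j \<in> I. R i j}"
    proof (intro set_eqI iffI)
      fix k assume "k \<in> {j \<in> I. R j (- i)}"
      then have "- k \<in> {j \<in> I. R i j}" using odd[OF \<open>t\<close>, of k "- i"] i I_neg \<open>t\<close> by auto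
      then show "k \<in> uminus ` {j \<in> I. R i j}" by force
    next
      fix k assume "k \<in> uminus ` {j \<in> I. R i j}"
      then show "k \<in> {j \<in> I. R j (- i)}" using odd[OF \<open>t\<close>] i I_neg \<open>t\<close> by auto
    qed
    have 2: "{j \<in> I. R (- i) j} = uminus ` {j \<in> I. R j i}"
    proof (intro set_eqI iffI)
      fix k assume "k \<in> {j \<in> I. R (- i) j}"
      then have "- k \<in> {j \<in> I. R j i}" using odd[OF \<open>t\<close>, of "- i" k] i I_neg \<open>t\<close> by auto
      then show "k \<in> uminus ` {j \<in> I. R j i}" by force
    next
      fix k assume "k \<in> uminus ` {j \<in> I. R j i}"
      then show "k \<in> {j \<in> I. R (- i) j}" using odd[OF \<open>t\<close>] i I_neg \<open>t\<close> by auto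
    qed
    show ?thesis unfolding f_def 1 2 by (simp add: card_image)
  qed
  obtain w where "w \<in> W" "\<forall>i \<in> I. \<forall>j \<in> I. inv w i < inv w j \<longleftrightarrow> f i < f j"
    using realize[OF inj odd'] by blast
  then show ?thesis using that iff by auto
qed

text \<open>The classical description of inversion sets: the set and its complement among increasing
  pairs are both transitive, and in type B the set is closed under the mirror image.\<close>

definition biclosed :: "(int \<times> int) set \<Rightarrow> bool" where
  "biclosed T \<longleftrightarrow> (\<forall>(i, j) \<in> T. i \<in> I \<and> j \<in> I \<and> i < j) \<and> trans T \<and>
     (\<forall>i j k. (i, k) \<in> T \<and> j \<in> I \<and> i < j \<and> j < k \<longrightarrow> (i, j) \<in> T \<or> (j, k) \<in> T) \<and>
     (t \<longrightarrow> (\<forall>(i, j) \<in> T. (- j, - i) \<in> T))"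

lemma biclosedD:
  assumes "biclosed T"
  shows "(i, j) \<in> T \<Longrightarrow> i \<in> I \<and> j \<in> I \<and> i < j"
    and "(i, j) \<in> T \<Longrightarrow> (j, k) \<in> T \<Longrightarrow> (i, k) \<in> T"
    and "(i, k) \<in> T \<Longrightarrow> j \<in> I \<Longrightarrow> i < j \<Longrightarrow> j < k \<Longrightarrow> (i, j) \<in> T \<or> (j, k) \<in> T"
    and "t \<Longrightarrow> (i, j) \<in> T \<Longrightarrow> (- j, - i) \<in> T"
  using assms unfolding biclosed_def by (blast dest: transD)+

lemma NN_biclosed: assumes w: "w \<in> W" shows "biclosed (NN w)"
proof -
  have "trans (NN w)" using NN_trans[OF w] by (meson transI)
  moreover have "(i, j) \<in> NN w \<or> (j, k) \<in> NN w" if "(i, k) \<in> NN w" "j \<in> I" "i < j" "j < k" for i j k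
    using that by (auto simp: NN_def)
  ultimately show ?thesis using NN_sym[OF w] by (auto simp: biclosed_def NN_def)
qed

text \<open>Reversing exactly the pairs of \<open>T\<close> in the natural order yields a linear
  order. Its transitivity uses transitivity of \<open>T\<close> and of its complement according to
  the directions of the two comparisons.\<close>

lemma realize_biclosed: assumes T: "biclosed T" obtains w where "w \<in> W" "NN w = T"
proof -
  define R where "R i j \<longleftrightarrow> i < j \<and> (i, j) \<notin> T \<or> j < i \<and> (j, i) \<in> T" for i j
  have T1: "(i, j) \<in> T \<Longrightarrow> i \<in> I \<and> j \<in> I \<and> i < j" for i j using T by (auto simp: biclosed_def)
  have T2: "(i, j) \<in> T \<Longrightarrow> (j, k) \<in> T \<Longrightarrow> (i, k) \<in> T" for i j k
    using T by (auto simp: biclosed_def dest: transD)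
  have T3: "(i, k) \<in> T \<Longrightarrow> j \<in> I \<Longrightarrow> i < j \<Longrightarrow> j < k \<Longrightarrow> (i, j) \<in> T \<or> (j, k) \<in> T" for i j k
    using T by (auto simp: biclosed_def)
  have T4: "t \<Longrightarrow> (i, j) \<in> T \<Longrightarrow> (- j, - i) \<in> T" for i j
    using T by (auto simp: biclosed_def)
  have T5: "t \<Longrightarrow> (- j, - i) \<in> T \<Longrightarrow> (i, j) \<in> T" for i j using T4[of "- j" "- i"] by simp
  obtain w where w: "w \<in> W" "\<And>i j. i \<in> I \<Longrightarrow> j \<in> I \<Longrightarrow> inv w i < inv w j \<longleftrightarrow> R i j"
  proof (rule realize_order[of R])
    show "R i k" if ijk: "i \<in> I" "j \<in> I" "k \<in> I" "R i j" "R j k" for i j k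
    proof -
      consider "i < j" "(i, j) \<notin> T" "j < k" "(j, k) \<notin> T" | "i < j" "(i, j) \<notin> T" "k < j" "(k, j) \<in> T"
        | "j < i" "(j, i) \<in> T" "j < k" "(j, k) \<notin> T" | "j < i" "(j, i) \<in> T" "k < j" "(k, j) \<in> T"
        using ijk(4,5) unfolding R_def by blast
      then show ?thesis
      proof cases
        case 1 then show ?thesis using T3[of i k j] ijk unfolding R_def by auto
      next
        case 2 then show ?thesis using T2[of i k j] T3[of k j i] ijk unfolding R_def
          by (cases i k rule: linorder_cases) auto
      next
        case 3 then show ?thesis using T2[of j i k] T3[of j i k] ijk unfolding R_def
          by (cases i k rule: linorder_cases) auto
      next
        case 4 then show ?thesis using T2[of k j i] unfolding R_def by auto
      qed
    qed
    show "R (- j) (- i)" if "t" "i \<in> I" "j \<in> I" "R i j" for i j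
      using that T4[of j i] T5[of j i] unfolding R_def by auto
  qed (auto simp: R_def)
  have "NN w = T" using w(2) T1 by (fastforce simp: NN_def R_def)
  then show ?thesis using that w by blast
qed

text \<open>The point to check is the splitting condition for a chain: \<open>j\<close> is compared
  with the start \<open>m\<close> of the last step \<open>(m, k)\<close>, and either the induction
  hypothesis or the splitting of that single step applies. This gives joins explicitly.\<close>

lemma biclosed_join:
  assumes X: "biclosed X" and Y: "biclosed Y" shows "biclosed ((X \<union> Y)\<^sup>+)"
proof -
  let ?T = "(X \<union> Y)\<^sup>+"
  have ord: "i \<in> I \<and> j \<in> I \<and> i < j" if "(i, j) \<in> ?T" for i j
    using that by (induction rule: trancl_induct) (use X Y in \<open>auto simp: biclosed_def\<close>)
  have sp: "(i, j) \<in> ?T \<or> (j, k) \<in> ?T" if "(i, k) \<in> ?T" "j \<in> I" "i < j" "j < k" for i j k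
    using that
  proof (induction rule: trancl_induct)
    case (base k)
    then have "(i, j) \<in> X \<union> Y \<or> (j, k) \<in> X \<union> Y" using biclosedD(3)[OF X] biclosedD(3)[OF Y] by blast
    then show ?case by blast
  next
    case (step m k)
    consider "j < m" | "j = m" | "m < j" by linarith
    then show ?case
    proof cases
      case 1
      then show ?thesis using step by (meson trancl.trancl_into_trancl)
    next
      case 2
      then show ?thesis using step by blast
    next
      case 3
      then have "(m, j) \<in> X \<union> Y \<or> (j, k) \<in> X \<union> Y"
        using step biclosedD(3)[OF X] biclosedD(3)[OF Y] by blast
      then show ?thesis using step by (meson r_into_trancl trancl.trancl_into_trancl)
    qed
  qed
  have sym: "(- j, - i) \<in> ?T" if t "(i, j) \<in> ?T" for i j
    using that(2)
  proof (induction rule: trancl_induct)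
    case (base j)
    then show ?case using biclosedD(4)[OF X \<open>t\<close>] biclosedD(4)[OF Y \<open>t\<close>] by blast
  next
    case (step m k)
    then have "(- k, - m) \<in> X \<union> Y" using biclosedD(4)[OF X \<open>t\<close>] biclosedD(4)[OF Y \<open>t\<close>] by blast
    then show ?case using step by (meson r_into_trancl trancl_trans)
  qed
  show ?thesis unfolding biclosed_def using ord sp sym by auto
qed

text \<open>Noninversions are biclosed too and reverse the order, so the construction of joins also
  produces meets.\<close>

definition CN :: "perm \<Rightarrow> (int \<times> int) set" where
  "CN w = {(i, j). i \<in> I \<and> j \<in> I \<and> i < j \<and> (i, j) \<notin> NN w}"

lemma biclosed_compl:
  assumes T: "biclosed T" shows "biclosed {(i, j). i \<in> I \<and> j \<in> I \<and> i < j \<and> (i, j) \<notin> T}"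
proof -
  let ?C = "{(i, j). i \<in> I \<and> j \<in> I \<and> i < j \<and> (i, j) \<notin> T}"
  have "trans ?C"
  proof (rule transI)
    fix i j k assume "(i, j) \<in> ?C" "(j, k) \<in> ?C"
    then show "(i, k) \<in> ?C" using biclosedD(3)[OF T, of i k j] by auto
  qed
  moreover have "(i, j) \<in> ?C \<or> (j, k) \<in> ?C" if "(i, k) \<in> ?C" "j \<in> I" "i < j" "j < k" for i j k
    using biclosedD(2)[OF T, of i j k] that by auto
  moreover have "(- j, - i) \<in> ?C" if "t" "(i, j) \<in> ?C" for i j
    using biclosedD(4)[OF T that(1), of "- j" "- i"] that I_neg by auto
  ultimately show ?thesis unfolding biclosed_def by auto
qed

lemma CN_biclosed: "w \<in> W \<Longrightarrow> biclosed (CN w)"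
  unfolding CN_def using biclosed_compl NN_biclosed by blast

lemma CN_antimono: "CN w \<subseteq> CN v \<longleftrightarrow> NN v \<subseteq> NN w"
  by (auto simp: CN_def NN_def)

lemma join_exists:
  assumes "x \<in> W" "y \<in> W" obtains j where "j \<in> W" "NN j = (NN x \<union> NN y)\<^sup>+"
  using realize_biclosed[OF biclosed_join[OF NN_biclosed NN_biclosed]] assms by metis

lemma meet_exists:
  assumes "x \<in> W" "y \<in> W" obtains m where "m \<in> W" "CN m = (CN x \<union> CN y)\<^sup>+"
proof -
  let ?T = "(CN x \<union> CN y)\<^sup>+"
  have b: "biclosed ?T" using biclosed_join CN_biclosed assms by blast
  obtain m where m: "m \<in> W" "NN m = {(i, j). i \<in> I \<and> j \<in> I \<and> i < j \<and> (i, j) \<notin> ?T}"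
    using realize_biclosed[OF biclosed_compl[OF b]] by blast
  have "CN m = ?T" using b unfolding CN_def m by (auto simp: biclosed_def)
  then show ?thesis using that m by blast
qed

lemma is_join_iff: assumes "x \<in> W" "y \<in> W"
  shows "is_join S x y j \<longleftrightarrow> j \<in> W \<and> NN x \<subseteq> NN j \<and> NN y \<subseteq> NN j \<and>
     (\<forall>z \<in> W. NN x \<subseteq> NN z \<and> NN y \<subseteq> NN z \<longrightarrow> NN j \<subseteq> NN z)"
  unfolding is_join_def using assms weak_le_iff by auto

lemma is_meet_iff: assumes "x \<in> W" "y \<in> W"
  shows "is_meet S x y j \<longleftrightarrow> j \<in> W \<and> NN j \<subseteq> NN x \<and> NN j \<subseteq> NN y \<and>
     (\<forall>z \<in> W. NN z \<subseteq> NN x \<and> NN z \<subseteq> NN y \<longrightarrow> NN z \<subseteq> NN j)"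
  unfolding is_meet_def using assms weak_le_iff by auto

lemma is_join_trancl: assumes "x \<in> W" "y \<in> W" "j \<in> W" "NN j = (NN x \<union> NN y)\<^sup>+"
  shows "is_join S x y j"
proof -
  have "(NN x \<union> NN y)\<^sup>+ \<subseteq> NN z" if "z \<in> W" "NN x \<subseteq> NN z" "NN y \<subseteq> NN z" for z
  proof -
    have "trans (NN z)" using NN_trans[OF that(1)] by (meson transI)
    then show ?thesis using that by (metis Un_least trancl_id trancl_mono_subset)
  qed
  then show ?thesis using is_join_iff assms by auto
qed

lemma is_meet_trancl: assumes "x \<in> W" "y \<in> W" "j \<in> W" "CN j = (CN x \<union> CN y)\<^sup>+"
  shows "is_meet S x y j"
proof -
  have "(CN x \<union> CN y)\<^sup>+ \<subseteq> CN z" if "z \<in> W" "CN x \<subseteq> CN z" "CN y \<subseteq> CN z" for z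
  proof -
    have "trans (CN z)" using CN_biclosed[OF that(1)] by (simp add: biclosed_def)
    then show ?thesis using that by (metis Un_least trancl_id trancl_mono_subset)
  qed
  then show ?thesis using is_meet_iff assms unfolding CN_antimono[symmetric] by auto
qed

end

section \<open>The Cambrian congruence as equality of triangulations\<close>


text \<open>The vertex \<open>b\<close> witnesses that exchanging the adjacent letters \<open>a < c\<close> is contracted by the
  Cambrian congruence: then \<open>b\<close> lies on the path between \<open>a\<close> and \<open>c\<close>.\<close>
definition wit :: "(int \<Rightarrow> bool) \<Rightarrow> (int \<Rightarrow> int) \<Rightarrow> int \<Rightarrow> int \<Rightarrow> int \<Rightarrow> bool" where
  "wit up f b a c \<longleftrightarrow> a < b \<and> b < c \<and>
     (if up b then f b < f a \<and> f b < f c else f a < f b \<and> f c < f b)"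
definition ctr :: "int set \<Rightarrow> (int \<Rightarrow> bool) \<Rightarrow> (int \<Rightarrow> int) \<Rightarrow> int \<Rightarrow> int \<Rightarrow> bool" where
  "ctr I up f a c \<longleftrightarrow> (\<exists>b \<in> I. wit up f b a c)"
definition adjv :: "int set \<Rightarrow> (int \<Rightarrow> int) \<Rightarrow> int \<Rightarrow> int \<Rightarrow> bool" where
  "adjv I f p q \<longleftrightarrow> p \<in> I \<and> q \<in> I \<and> f p < f q \<and> (\<forall>r \<in> I. \<not> (f p < f r \<and> f r < f q))"
text \<open>The join-irreducible that belongs to an uncontracted descent \<open>(a, c)\<close> lies below \<open>g\<close>.\<close>
definition JJ :: "int set \<Rightarrow> (int \<Rightarrow> bool) \<Rightarrow> int \<Rightarrow> int \<Rightarrow> (int \<Rightarrow> int) \<Rightarrow> bool" where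
  "JJ I up a c g \<longleftrightarrow> (\<forall>v \<in> I. \<forall>u \<in> I. a \<le> u \<and> u < v \<and> v \<le> c \<and> (v = c \<or> \<not> up v) \<and> (u = a \<or> up u)
     \<longrightarrow> g v < g u)"

text \<open>A letter strictly between \<open>a\<close> and \<open>c\<close> that is not a witness
  must precede \<open>c\<close> if it is lower and follow \<open>a\<close> if it is upper, because
  \<open>c\<close> and \<open>a\<close> are adjacent in \<open>f\<close>.\<close>

lemma JJ_descent:
  assumes inj: "inj_on f I" and "a < c" "adjv I f c a" "\<not> ctr I up f a c" shows "JJ I up a c f"
  unfolding JJ_def
proof (intro ballI impI)
  fix v u assume vu: "v \<in> I" "u \<in> I" "a \<le> u \<and> u < v \<and> v \<le> c \<and> (v = c \<or> \<not> up v) \<and> (u = a \<or> up u)"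
  have ca: "f c < f a" "\<And>r. r \<in> I \<Longrightarrow> \<not> (f c < f r \<and> f r < f a)" "a \<in> I" "c \<in> I"
    using assms(3) by (auto simp: adjv_def)
  have "f v \<le> f c"
  proof (cases "v = c")
    case False
    then have "\<not> wit up f v a c" "a < v" "v < c" "\<not> up v" using assms(4) vu by (auto simp: ctr_def)
    moreover have "f v \<noteq> f a" using inj_onD[OF inj _ vu(1) ca(3)] vu by auto
    ultimately show ?thesis using ca(2)[OF vu(1)] ca(1) by (auto simp: wit_def)
  qed simp
  moreover have "f a \<le> f u"
  proof (cases "u = a")
    case False
    then have "\<not> wit up f u a c" "a < u" "u < c" "up u" using assms(4) vu by (auto simp: ctr_def)
    moreover have "f u \<noteq> f c" using inj_onD[OF inj _ vu(2) ca(4)] vu by auto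
    ultimately show ?thesis using ca(2)[OF vu(2)] ca(1) by (auto simp: wit_def)
  qed simp
  ultimately show "f v < f u" using ca(1) by simp
qed

text \<open>An element is the join of the join-irreducibles of its descents. For an inversion that
  no intermediate letter splits, the proof finds a descent whose condition \<open>JJ\<close>
  contains this inversion.\<close>

lemma inversions_le_of_JJ:
  fixes f g :: "int \<Rightarrow> int"
  assumes fin: "finite I" and inj: "inj_on f I"
    and desc: "\<And>a c. a < c \<Longrightarrow> adjv I f c a \<Longrightarrow> \<not> ctr I up f a c \<and> JJ I up a c g"
    and ac: "a \<in> I" "c \<in> I" "a < c" "f c < f a"
  shows "g c < g a"
  using ac
proof (induction "nat (f a - f c)" arbitrary: a c rule: less_induct)
  case less
  show ?case
  proof (cases "\<exists>b \<in> I. a < b \<and> b < c \<and> f c < f b \<and> f b < f a")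
    case True
    then obtain b where b: "b \<in> I" "a < b" "b < c" "f c < f b" "f b < f a" by blast
    have "g c < g b" using less.hyps[of b c] b less.prems by simp
    also have "g b < g a" using less.hyps[of a b] b less.prems by simp
    finally show ?thesis .
  next
    case False
    have neq: "f x \<noteq> f y" if "x \<in> I" "y \<in> I" "x \<noteq> y" for x y using inj that by (meson inj_onD)
    \<comment> \<open>Since no letter placed between \<open>c\<close> and \<open>a\<close> has a
      value between them, every such letter is small or large. \<open>B\<close> is the last large
      one before \<open>a\<close>, and \<open>s\<close>, the letter right after \<open>B\<close>, is
      then at most \<open>a\<close>. If \<open>c\<close> were upper and different from
      \<open>B\<close>, or \<open>a\<close> lower and different from \<open>s\<close>, it would
      witness that the descent at \<open>B\<close>, \<open>s\<close> is contracted.\<close>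
    let ?M = "{z \<in> I. f c \<le> f z \<and> f z < f a \<and> c \<le> z}"
    have M: "finite (f ` ?M)" "f ` ?M \<noteq> {}" using fin less.prems by auto
    obtain B where B: "B \<in> ?M" "f B = Max (f ` ?M)" using Max_in[OF M] by force
    have Bmax: "f z \<le> f B" if "z \<in> ?M" for z using that B Max_ge[OF M(1)] by auto
    let ?N = "{z \<in> I. f B < f z}"
    have N: "finite (f ` ?N)" "f ` ?N \<noteq> {}" using fin less.prems B by auto
    obtain s where s: "s \<in> ?N" "f s = Min (f ` ?N)" using Min_in[OF N] by force
    have smin: "f s \<le> f z" if "z \<in> ?N" for z using that s Min_le[OF N(1)] by auto
    have "f s \<le> f a" using smin[of a] less.prems B by auto
    have sa: "s \<le> a"
    proof (rule ccontr)
      assume "\<not> s \<le> a"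
      then have "f s < f a" using \<open>f s \<le> f a\<close> neq[of s a] s less.prems by force
      moreover have "s < c" using Bmax[of s] calculation s B by force
      ultimately show False using False \<open>\<not> s \<le> a\<close> s B by force
    qed
    have BS: "B \<in> I" "s \<in> I" "f B < f s" "c \<le> B" "f c \<le> f B" using s B by auto
    have adj: "adjv I f B s" using BS smin by (force simp: adjv_def)
    have nj: "\<not> ctr I up f s B" "JJ I up s B g" using desc[OF _ adj] sa BS less.prems by auto
    have "c = B \<or> \<not> up c"
    proof (rule ccontr)
      assume "\<not> ?thesis"
      then have "wit up f c s B" using sa less.prems BS neq[of c B] by (auto simp: wit_def)
      then show False using nj less.prems by (auto simp: ctr_def)
    qed
    moreover have "a = s \<or> up a"
    proof (rule ccontr)
      assume "\<not> ?thesis"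
      then have "wit up f a s B" using sa less.prems BS neq[of a s] \<open>f s \<le> f a\<close> by (auto simp: wit_def)
      then show False using nj less.prems by (auto simp: ctr_def)
    qed
    ultimately show ?thesis using nj(2) less.prems sa BS unfolding JJ_def by blast
  qed
qed

text \<open>No comparison demanded by \<open>JJ\<close> is contracted in \<open>g\<close>: for a
  candidate witness \<open>b\<close> between \<open>u\<close> and \<open>v\<close>, the condition
  \<open>JJ\<close> also demands \<open>v\<close> before an upper \<open>b\<close> and a lower
  \<open>b\<close> before \<open>u\<close>. Hence these inversions of \<open>g\<close> were present
  in \<open>f\<close> already.\<close>

lemma JJ_contract:
  assumes le: "\<And>i j. i \<in> I \<Longrightarrow> j \<in> I \<Longrightarrow> i < j \<Longrightarrow> f j < f i \<Longrightarrow> g j < g i"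
    and new: "\<And>i j. i \<in> I \<Longrightarrow> j \<in> I \<Longrightarrow> i < j \<Longrightarrow> g j < g i \<Longrightarrow> f j < f i \<or> ctr I up g i j"
  shows "JJ I up a c f \<longleftrightarrow> JJ I up a c g"
proof
  show "JJ I up a c f \<Longrightarrow> JJ I up a c g" using le unfolding JJ_def by blast
  assume J: "JJ I up a c g"
  show "JJ I up a c f"
    unfolding JJ_def
  proof (intro ballI impI)
    fix v u assume vu: "v \<in> I" "u \<in> I" "a \<le> u \<and> u < v \<and> v \<le> c \<and> (v = c \<or> \<not> up v) \<and> (u = a \<or> up u)"
    then have gvu: "g v < g u" using J by (auto simp: JJ_def)
    have "\<not> wit up g b u v" if b: "b \<in> I" for b
    proof
      assume w: "wit up g b u v"
      then have "u < b" "b < v" by (auto simp: wit_def)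
      show False
      proof (cases "up b")
        case True
        then have "g v < g b" using J vu b \<open>u < b\<close> \<open>b < v\<close> unfolding JJ_def by force
        then show False using w True by (auto simp: wit_def)
      next
        case False
        then have "g b < g u" using J vu b \<open>u < b\<close> \<open>b < v\<close> unfolding JJ_def by force
        then show False using w False by (auto simp: wit_def)
      qed
    qed
    then have "\<not> ctr I up g u v" by (auto simp: ctr_def)
    then show "f v < f u" using new gvu vu by blast
  qed
qed

text \<open>Negating all values exchanges inversions and noninversions but keeps the witnesses.\<close>
lemma wit_neg: "wit (up \<circ> uminus) (f \<circ> uminus) (- b) (- c) (- a) \<longleftrightarrow> wit up f b a c"
  by (auto simp: wit_def)

lemma ctr_neg: "ctr (uminus ` I) (up \<circ> uminus) (f \<circ> uminus) (- c) (- a) \<longleftrightarrow> ctr I up f a c"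
  by (simp add: ctr_def wit_neg[unfolded comp_def] comp_def)

lemma adjv_neg: "adjv (uminus ` I) (f \<circ> uminus) (- p) (- q) \<longleftrightarrow> adjv I f p q"
  by (auto simp: adjv_def)

text \<open>The dual of \<open>JJ\<close>: the meet-irreducible belonging to an uncontracted ascent
  \<open>(a, c)\<close> lies above \<open>g\<close>. Negating the letters lets every statement about
  \<open>MM\<close> follow from one about \<open>JJ\<close>.\<close>

definition MM :: "int set \<Rightarrow> (int \<Rightarrow> bool) \<Rightarrow> int \<Rightarrow> int \<Rightarrow> (int \<Rightarrow> int) \<Rightarrow> bool" where
  "MM I up a c g \<longleftrightarrow> JJ (uminus ` I) (up \<circ> uminus) (- c) (- a) (g \<circ> uminus)"

lemma MM_ascent:
  assumes "inj_on f I" "a < c" "adjv I f a c" "\<not> ctr I up f a c" shows "MM I up a c f"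
  unfolding MM_def
  by (rule JJ_descent) (use assms in \<open>auto simp: adjv_neg ctr_neg inj_on_def\<close>)

lemma noninversions_le_of_MM:
  fixes f g :: "int \<Rightarrow> int"
  assumes fin: "finite I" and inj: "inj_on f I"
    and asc: "\<And>a c. a < c \<Longrightarrow> adjv I f a c \<Longrightarrow> \<not> ctr I up f a c \<and> MM I up a c g"
    and ac: "a \<in> I" "c \<in> I" "a < c" "f a < f c"
  shows "g a < g c"
proof -
  have "(g \<circ> uminus) (- a) < (g \<circ> uminus) (- c)"
  proof (rule inversions_le_of_JJ[of "uminus ` I" "f \<circ> uminus" "up \<circ> uminus" "g \<circ> uminus" "- c" "- a"])
    fix a' c' :: int assume "a' < c'" "adjv (uminus ` I) (f \<circ> uminus) c' a'"
    then show "\<not> ctr (uminus ` I) (up \<circ> uminus) (f \<circ> uminus) a' c' \<and>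
        JJ (uminus ` I) (up \<circ> uminus) a' c' (g \<circ> uminus)"
      using asc[of "- c'" "- a'"] adjv_neg[of I f "- c'" "- a'"] ctr_neg[of I up f "- a'" "- c'"]
      by (simp add: MM_def)
  qed (use fin inj ac in \<open>auto simp: inj_on_def\<close>)
  then show ?thesis by simp
qed

lemma MM_contract:
  assumes inj: "inj_on f I" "inj_on g I"
    and le: "\<And>i j. i \<in> I \<Longrightarrow> j \<in> I \<Longrightarrow> i < j \<Longrightarrow> f j < f i \<Longrightarrow> g j < g i"
    and new: "\<And>i j. i \<in> I \<Longrightarrow> j \<in> I \<Longrightarrow> i < j \<Longrightarrow> g j < g i \<Longrightarrow> f j < f i \<or> ctr I up f i j"
  shows "MM I up a c f \<longleftrightarrow> MM I up a c g"
  unfolding MM_def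
proof (rule JJ_contract[symmetric])
  have tot: "f j < f i \<longleftrightarrow> \<not> f i < f j" "g j < g i \<longleftrightarrow> \<not> g i < g j" if "i \<in> I" "j \<in> I" "i < j" for i j
    using inj that by (metis inj_onD less_irrefl not_less_iff_gr_or_eq)+
  fix i j assume ij: "i \<in> uminus ` I" "j \<in> uminus ` I" "i < j"
  then have ij': "- j \<in> I" "- i \<in> I" "- j < - i" by auto
  show "(g \<circ> uminus) j < (g \<circ> uminus) i \<Longrightarrow> (f \<circ> uminus) j < (f \<circ> uminus) i"
    using le[OF ij'] tot[OF ij'] by auto
  show "(f \<circ> uminus) j < (f \<circ> uminus) i \<Longrightarrow> (g \<circ> uminus) j < (g \<circ> uminus) i \<or>
      ctr (uminus ` I) (up \<circ> uminus) (f \<circ> uminus) i j"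
    using new[OF ij'] tot[OF ij'] ctr_neg[of I up f "- i" "- j"] by auto
qed

context polygon begin

text \<open>The path right after \<open>c\<close> is processed contains an edge with
  \<open>c\<close> in \<open>Lo\<close> and \<open>a\<close> in \<open>Up\<close>, as there is no
  witness between them. All comparisons in \<open>JJ\<close> are among the demands of this
  diagonal.\<close>

lemma JJ_of_Dg:
  fixes f g :: "int \<Rightarrow> int"
  assumes inj: "inj_on f I" and ac: "a < c" "adjv I f c a" "\<not> ctr I up f a c" and D: "Dg f \<subseteq> Dg g"
  shows "JJ I up a c g"
proof -
  let ?P = "{z. f z \<le> f c}"
  have ca: "c \<in> I" "a \<in> I" "f c < f a" "\<And>r. r \<in> I \<Longrightarrow> \<not> (f c < f r \<and> f r < f a)" using ac by (auto simp: adjv_def)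
  have "up m \<longleftrightarrow> m \<notin> ?P" if m: "m \<in> I" "min c a < m" "m < max c a" for m
  proof -
    have "a < m" "m < c" using m ac by auto
    moreover have "\<not> wit up f m a c" using ac m by (auto simp: ctr_def)
    moreover have "f m \<noteq> f a" "f m \<noteq> f c" using inj_onD[OF inj, of m a] inj_onD[OF inj, of m c] m ca calculation by auto
    ultimately show ?thesis using ca(3) ca(4)[OF m(1)] by (auto simp: wit_def split: if_splits)
  qed
  then obtain e where e: "e \<in> edges" "c \<in> Lo e" "a \<in> Up e" "Lo e \<subseteq> ?P" "Up e \<inter> ?P = {}"
    using path_edge[of c a ?P] ca by auto
  have "e \<in> Dg f" by (rule Dg_of_path[OF e]) auto
  then have eg: "e \<in> Dg g" using D by blast
  have sp: "fst e \<le> a" "c \<le> snd e"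
    using e(2,3) edges_less[OF e(1)] ac by (auto simp: Lo_def Up_def)
  show ?thesis
    unfolding JJ_def
  proof (intro ballI impI)
    fix v u assume vu: "v \<in> I" "u \<in> I" "a \<le> u \<and> u < v \<and> v \<le> c \<and> (v = c \<or> \<not> up v) \<and> (u = a \<or> up u)"
    have "v \<in> Lo e"
    proof (cases "v = c")
      case False then show ?thesis using vu sp by (auto simp: Lo_def)
    qed (use e in simp)
    moreover have "u \<in> Up e"
    proof (cases "u = a")
      case False then show ?thesis using vu sp by (auto simp: Up_def)
    qed (use e in simp)
    ultimately show "g v < g u" using eg by (auto simp: Dg_def)
  qed
qed

text \<open>Suppose a diagonal of \<open>f\<close> demands \<open>l\<close> before \<open>u\<close>.
  A letter between them is itself subject to the diagonal: a lower one precedes \<open>u\<close>, an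
  upper one follows \<open>l\<close>. It is therefore no witness, and a contracted exchange cannot
  reverse \<open>l\<close> and \<open>u\<close>.\<close>

lemma Dg_contract:
  fixes f g :: "int \<Rightarrow> int"
  assumes inj: "inj_on f I" "inj_on g I"
    and le: "\<And>i j. i \<in> I \<Longrightarrow> j \<in> I \<Longrightarrow> i < j \<Longrightarrow> f j < f i \<Longrightarrow> g j < g i"
    and new: "\<And>i j. i \<in> I \<Longrightarrow> j \<in> I \<Longrightarrow> i < j \<Longrightarrow> g j < g i \<Longrightarrow> f j < f i \<or> ctr I up f i j"
  shows "Dg f = Dg g"
proof (rule Dg_inj_eq[OF inj], rule subsetI)
  fix e assume e: "e \<in> Dg f"
  have e': "e \<in> edges" using e Dg_diag diag_edges by blast
  have "g l < g u" if lu: "l \<in> Lo e" "u \<in> Up e" for l u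
  proof -
    have I: "l \<in> I" "u \<in> I" using lu Lo_I Up_I by auto
    have ne: "l \<noteq> u" using Lo_Up_disj[OF e'] lu by blast
    then have gne: "g l \<noteq> g u" using inj_onD[OF inj(2)] I by blast
    have flu: "f l < f u" using e lu by (auto simp: Dg_def)
    have nw: "\<not> wit up f b (min l u) (max l u)" if b: "b \<in> I" for b
    proof
      assume w: "wit up f b (min l u) (max l u)"
      then have mm: "min l u < b" "b < max l u" by (auto simp: wit_def)
      have ins: "fst e < b \<and> b < snd e"
        using mm lu edges_less[OF e'] by (auto simp: Lo_def Up_def min_def max_def split: if_splits)
      show False
      proof (cases "up b")
        case True
        then have "b \<in> Up e" using ins b by (auto simp: Up_def)
        then have "f l < f b" using e lu by (auto simp: Dg_def)
        then show False using w True by (auto simp: wit_def min_def max_def split: if_splits)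
      next
        case False
        then have "b \<in> Lo e" using ins b by (auto simp: Lo_def)
        then have "f b < f u" using e lu by (auto simp: Dg_def)
        then show False using w False by (auto simp: wit_def min_def max_def split: if_splits)
      qed
    qed
    show ?thesis
    proof (cases "l < u")
      case True
      then have "\<not> ctr I up f l u" using nw by (auto simp: ctr_def)
      then show ?thesis using new[OF I True] flu gne by force
    next
      case False
      then show ?thesis using le[OF I(2,1)] flu ne by simp
    qed
  qed
  then show "e \<in> Dg g" using e by (auto simp: Dg_def)
qed

end

section \<open>Classes of the congruence, their bottoms and tops\<close>

text \<open>The assumption on \<open>up\<close> makes the polygon of type B centrally symmetric:
  negation of letters is the half turn, which interchanges lower and upper vertices.\<close>

locale cambrian = coxeter +
  fixes up :: "int \<Rightarrow> bool"
  assumes up_neg: "t \<Longrightarrow> i \<in> I \<Longrightarrow> up (- i) \<longleftrightarrow> \<not> up i"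
begin

definition lo :: int where "lo = (if t then - int n - 1 else 0)"
definition hi :: int where "hi = int n + 1"

sublocale polygon I up lo hi
  by unfold_locales (auto simp: finite_I, auto simp: I_def lo_def hi_def)

lemma inj_inv: "w \<in> W \<Longrightarrow> inj_on (inv w) I"
  using inv_eq_iff by (auto simp: inj_on_def)

lemma adjv_consec: assumes w: "w \<in> W" shows "adjv I (inv w) p q \<longleftrightarrow> consec (inv w p) (inv w q)"
proof
  assume a: "adjv I (inv w) p q"
  have "\<not> (inv w p < k \<and> k < inv w q)" if "k \<in> I" for k
    using a W_I[OF w that] inv_inv_W[OF w, of k] unfolding adjv_def by metis
  then show "consec (inv w p) (inv w q)" using a inv_I[OF w] by (auto simp: adjv_def consec_def)
next
  assume "consec (inv w p) (inv w q)"
  then show "adjv I (inv w) p q" using inv_I[OF w] by (auto simp: adjv_def consec_def)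
qed

definition cstep :: "perm \<Rightarrow> perm \<Rightarrow> bool" where
  "cstep x y \<longleftrightarrow> x \<in> W \<and> (\<exists>p q. p < q \<and> consec (inv x p) (inv x q) \<and> ctr I up (inv x) p q \<and> y = swp p q \<circ> x)"

lemma wit_mirror:
  assumes "x \<in> W" "t" "b \<in> I" "wit up (inv x) b p q" shows "wit up (inv x) (- b) (- q) (- p)"
  using assms up_neg by (auto simp: wit_def inv_odd)

lemma ctr_mirror:
  assumes "x \<in> W" "t" "ctr I up (inv x) p q" shows "ctr I up (inv x) (- q) (- p)"
  using assms wit_mirror I_neg unfolding ctr_def by blast

lemma wit_flip:
  assumes x: "x \<in> W" and c: "consec (inv x p) (inv x q)" and b: "b \<in> I" "b \<noteq> p" "b \<noteq> q"
    and ac: "{a, c} = {p, q}"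
  shows "wit up (inv (swp p q \<circ> x)) b a c \<longleftrightarrow> wit up (inv x) b a c"
proof -
  let ?y = "swp p q \<circ> x"
  have pq: "p \<in> I" "q \<in> I" "p \<noteq> q" using c inv_I[OF x] by (auto simp: consec_def)
  have nz: "p \<noteq> 0" "q \<noteq> 0" "b \<noteq> 0" using pq b I_nz by auto
  have y: "?y \<in> W" by (rule flip_W[OF x c])
  note fl = flip_order[OF x c]
  have 1: "inv ?y b < inv ?y p \<longleftrightarrow> inv x b < inv x p"
    using fl[of b p] fl[of p b] nz b pq inv_eq_iff[OF x, of b p] by (smt (verit) Pair_inject insertE singletonD)
  have 2: "inv ?y b < inv ?y q \<longleftrightarrow> inv x b < inv x q"
    using fl[of b q] fl[of q b] nz b pq inv_eq_iff[OF x, of b q] by (smt (verit) Pair_inject insertE singletonD)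
  have 3: "inv ?y b \<noteq> inv ?y p" "inv ?y b \<noteq> inv ?y q" "inv x b \<noteq> inv x p" "inv x b \<noteq> inv x q"
    using inv_eq_iff[OF x] inv_eq_iff[OF y] b by auto
  have "a = p \<and> c = q \<or> a = q \<and> c = p" using ac by (auto simp: doubleton_eq_iff)
  then show ?thesis using 1 2 3 unfolding wit_def by (smt (verit))
qed

text \<open>The exchange changes the position of no witness relative to the pair, so contraction can
  be read off at the lower or at the upper end of a cover.\<close>

lemma ctr_flip:
  assumes x: "x \<in> W" and c: "consec (inv x p) (inv x q)" and "{a, c} = {p, q}" "a < c"
  shows "ctr I up (inv (swp p q \<circ> x)) a c \<longleftrightarrow> ctr I up (inv x) a c"
proof -
  have "b \<noteq> p \<and> b \<noteq> q" if "wit up f b a c" for b f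
    using that assms by (auto simp: wit_def doubleton_eq_iff)
  then show ?thesis using wit_flip[OF x c] assms unfolding ctr_def by blast
qed

lemma cstep_W: "cstep x y \<Longrightarrow> x \<in> W" "cstep x y \<Longrightarrow> y \<in> W"
  using flip_W by (auto simp: cstep_def)

lemma cstep_NN:
  assumes s: "cstep x y"
  shows "NN x \<subset> NN y" "(a, c) \<in> NN y - NN x \<Longrightarrow> ctr I up (inv x) a c \<and> ctr I up (inv y) a c"
proof -
  obtain p q where pq: "p < q" "consec (inv x p) (inv x q)" "ctr I up (inv x) p q" "y = swp p q \<circ> x"
    and x: "x \<in> W" using s by (auto simp: cstep_def)
  have y: "y \<in> W" using s cstep_W by blast
  have N: "NN y = NN x \<union> {(p, q), (- q, - p)} \<inter> I \<times> I" using NN_flip[OF x pq(2,1)] pq(4) by simp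
  have I: "p \<in> I" "q \<in> I" "inv x p < inv x q" using pq(2) inv_I[OF x] by (auto simp: consec_def)
  have "(p, q) \<in> NN y" using N I(1,2) by blast
  moreover have "(p, q) \<notin> NN x" using I(3) by (simp add: NN_def)
  ultimately show "NN x \<subset> NN y" using N by blast
  have cy: "ctr I up (inv y) p q" using ctr_flip[OF x pq(2) refl pq(1)] pq by simp
  assume "(a, c) \<in> NN y - NN x"
  then have "(a, c) = (p, q) \<or> (a, c) = (- q, - p) \<and> - q \<in> I" using N by auto
  then show "ctr I up (inv x) a c \<and> ctr I up (inv y) a c"
  proof
    assume "(a, c) = (- q, - p) \<and> - q \<in> I"
    moreover then have t using not_t_neg I by blast
    ultimately show ?thesis using ctr_mirror x y pq cy by auto
  qed (use pq cy in simp)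
qed

lemma cstep_invariants:
  assumes s: "cstep x y"
  shows "Dg (inv x) = Dg (inv y)" "JJ I up a c (inv x) = JJ I up a c (inv y)"
    "MM I up a c (inv x) = MM I up a c (inv y)"
proof -
  have x: "x \<in> W" and y: "y \<in> W" using s cstep_W by auto
  have le: "inv y j < inv y i" if "i \<in> I" "j \<in> I" "i < j" "inv x j < inv x i" for i j
    using cstep_NN(1)[OF s] that by (auto simp: NN_def)
  have new: "inv x j < inv x i \<or> ctr I up (inv x) i j \<and> ctr I up (inv y) i j"
    if "i \<in> I" "j \<in> I" "i < j" "inv y j < inv y i" for i j
    using cstep_NN(2)[OF s, of i j] that by (auto simp: NN_def)
  show "Dg (inv x) = Dg (inv y)"
    by (rule Dg_contract) (use le new inj_inv x y in blast)+
  show "JJ I up a c (inv x) = JJ I up a c (inv y)"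
    by (rule JJ_contract) (use le new in blast)+
  show "MM I up a c (inv x) = MM I up a c (inv y)"
    by (rule MM_contract) (use le new inj_inv x y in blast)+
qed

lemma csteps_invariants:
  assumes "cstep\<^sup>*\<^sup>* x y"
  shows "Dg (inv x) = Dg (inv y)" "JJ I up a c (inv x) = JJ I up a c (inv y)"
    "MM I up a c (inv x) = MM I up a c (inv y)" "NN x \<subseteq> NN y" "x \<in> W \<longleftrightarrow> y \<in> W"
proof -
  have "Dg (inv x) = Dg (inv y) \<and> (\<forall>a c. JJ I up a c (inv x) = JJ I up a c (inv y)) \<and>
    (\<forall>a c. MM I up a c (inv x) = MM I up a c (inv y)) \<and> NN x \<subseteq> NN y \<and> (x \<in> W \<longleftrightarrow> y \<in> W)"
    using assms
  proof (induction rule: rtranclp_induct)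
    case (step y z)
    show ?case using step.IH cstep_invariants[OF step.hyps(2)] cstep_NN(1)[OF step.hyps(2)]
        cstep_W[OF step.hyps(2)] by auto
  qed simp
  then show "Dg (inv x) = Dg (inv y)" "JJ I up a c (inv x) = JJ I up a c (inv y)"
    "MM I up a c (inv x) = MM I up a c (inv y)" "NN x \<subseteq> NN y" "x \<in> W \<longleftrightarrow> y \<in> W" by blast+
qed

lemma exists_bottom:
  assumes "x \<in> W" obtains b where "cstep\<^sup>*\<^sup>* b x" "\<And>z. \<not> cstep z b"
proof -
  have "\<exists>b. cstep\<^sup>*\<^sup>* b x \<and> (\<forall>z. \<not> cstep z b)" using assms
  proof (induction "card (NN x)" arbitrary: x rule: less_induct)
    case less
    show ?case
    proof (cases "\<exists>z. cstep z x")
      case True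
      then obtain z where z: "cstep z x" by blast
      then have "card (NN z) < card (NN x)" using psubset_card_mono[OF finite_NN cstep_NN(1)] by blast
      then obtain b where "cstep\<^sup>*\<^sup>* b z" "\<forall>z. \<not> cstep z b" using less.hyps cstep_W z by blast
      then show ?thesis using z by (meson rtranclp.rtrancl_into_rtrancl)
    qed blast
  qed
  then show ?thesis using that by blast
qed

lemma exists_top:
  assumes "x \<in> W" obtains b where "cstep\<^sup>*\<^sup>* x b" "\<And>z. \<not> cstep b z"
proof -
  have fin: "finite (I \<times> I)" using finite_I by simp
  have "\<exists>b. cstep\<^sup>*\<^sup>* x b \<and> (\<forall>z. \<not> cstep b z)" using assms
  proof (induction "card (I \<times> I - NN x)" arbitrary: x rule: less_induct)
    case less
    show ?case
    proof (cases "\<exists>z. cstep x z")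
      case True
      then obtain z where z: "cstep x z" by blast
      then have "I \<times> I - NN z \<subset> I \<times> I - NN x" using cstep_NN(1)[OF z] NN_I[of z] by blast
      then have "card (I \<times> I - NN z) < card (I \<times> I - NN x)" using fin by (intro psubset_card_mono) auto
      then obtain b where "cstep\<^sup>*\<^sup>* z b" "\<forall>z. \<not> cstep b z" using less.hyps cstep_W z by blast
      then show ?thesis using z by (meson converse_rtranclp_into_rtranclp)
    qed blast
  qed
  then show ?thesis using that by blast
qed

lemma bottom_no_ctr:
  assumes x: "x \<in> W" and b: "\<And>z. \<not> cstep z x" and ac: "a < c" "adjv I (inv x) c a"
  shows "\<not> ctr I up (inv x) a c"
proof
  assume ct: "ctr I up (inv x) a c"
  have c: "consec (inv x c) (inv x a)" using ac adjv_consec[OF x] by simp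
  have I: "a \<in> I" "c \<in> I" using c inv_I[OF x] by (auto simp: consec_def)
  then have nz: "a \<noteq> 0" "c \<noteq> 0" using I_nz by auto
  let ?y = "swp c a \<circ> x"
  have y: "?y \<in> W" by (rule flip_W[OF x c])
  have "inv ?y = inv x \<circ> swp c a" using inv_flip[OF x nz(2,1)] .
  then have "consec (inv ?y a) (inv ?y c)" using c by simp
  moreover have "ctr I up (inv ?y) a c" using ctr_flip[OF x c _ ac(1)] ct by auto
  moreover have "x = swp a c \<circ> ?y"
    using swp_commute[OF nz] nz by (simp add: comp_assoc[symmetric])
  ultimately have "cstep ?y x" using y ac(1) unfolding cstep_def by blast
  then show False using b by blast
qed

lemma top_no_ctr:
  assumes x: "x \<in> W" and b: "\<And>z. \<not> cstep x z" and ac: "a < c" "adjv I (inv x) a c"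
  shows "\<not> ctr I up (inv x) a c"
  using assms adjv_consec[OF x] unfolding cstep_def by blast

lemma NN_subset_iff: "NN x \<subseteq> NN y \<longleftrightarrow>
  (\<forall>i \<in> I. \<forall>j \<in> I. i < j \<and> inv x j < inv x i \<longrightarrow> inv y j < inv y i)"
  by (auto simp: NN_def)

text \<open>A bottom element has only uncontracted descents, so \<open>inversions_le_of_JJ\<close>
  compares it with any element satisfying the same conditions \<open>JJ\<close>.\<close>

lemma bottom_le:
  assumes x: "x \<in> W" and b: "\<And>z. \<not> cstep z x"
    and JJ: "\<And>a c. JJ I up a c (inv x) \<Longrightarrow> JJ I up a c (inv y)"
  shows "NN x \<subseteq> NN y"
  unfolding NN_subset_iff
proof (intro ballI impI)
  fix a c assume "a \<in> I" "c \<in> I" "a < c \<and> inv x c < inv x a"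
  then show "inv y c < inv y a"
    using inversions_le_of_JJ[OF finite_I inj_inv[OF x], of up "inv y" a c]
      bottom_no_ctr[OF x b] JJ_descent[OF inj_inv[OF x]] JJ by blast
qed

lemma bottom_le_Dg:
  assumes x: "x \<in> W" and b: "\<And>z. \<not> cstep z x" and D: "Dg (inv x) \<subseteq> Dg (inv y)"
  shows "NN x \<subseteq> NN y"
  unfolding NN_subset_iff
proof (intro ballI impI)
  fix a c assume "a \<in> I" "c \<in> I" "a < c \<and> inv x c < inv x a"
  then show "inv y c < inv y a"
    using inversions_le_of_JJ[OF finite_I inj_inv[OF x], of up "inv y" a c]
      bottom_no_ctr[OF x b] JJ_of_Dg[OF inj_inv[OF x]] D by blast
qed

lemma le_top:
  assumes x: "x \<in> W" and y: "y \<in> W" and b: "\<And>z. \<not> cstep x z"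
    and MM: "\<And>a c. MM I up a c (inv x) \<Longrightarrow> MM I up a c (inv y)"
  shows "NN y \<subseteq> NN x"
proof -
  have "inv y a < inv y c" if "a \<in> I" "c \<in> I" "a < c" "inv x a < inv x c" for a c
    using noninversions_le_of_MM[OF finite_I inj_inv[OF x], of up "inv y" a c]
      top_no_ctr[OF x b] MM_ascent[OF inj_inv[OF x]] MM that by blast
  then show ?thesis using inv_eq_iff[OF x] unfolding NN_subset_iff by (metis not_less_iff_gr_or_eq)
qed

lemma JJ_mono: "NN x \<subseteq> NN y \<Longrightarrow> JJ I up a c (inv x) \<Longrightarrow> JJ I up a c (inv y)"
  unfolding NN_subset_iff JJ_def by blast

lemma MM_mono:
  assumes "x \<in> W" "y \<in> W" "NN x \<subseteq> NN y" "MM I up a c (inv y)" shows "MM I up a c (inv x)"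
proof -
  have "inv x i < inv x j" if "i \<in> I" "j \<in> I" "i < j" "inv y i < inv y j" for i j
    using assms(3) that inv_eq_iff[OF assms(1), of i j] unfolding NN_subset_iff
    by (metis less_asym linorder_cases)
  then have *: "inv x (- u) < inv x (- v)" if "u \<in> uminus ` I" "v \<in> uminus ` I" "v < u" "inv y (- u) < inv y (- v)" for u v
    using that by auto
  show ?thesis using assms(4) * unfolding MM_def JJ_def comp_def by (metis (no_types, lifting))
qed

lemma bottoms_eq:
  assumes x: "cstep\<^sup>*\<^sup>* b x" "\<And>z. \<not> cstep z b" "x \<in> W" and y: "cstep\<^sup>*\<^sup>* b' y" "\<And>z. \<not> cstep z b'" "y \<in> W"
    and D: "Dg (inv x) = Dg (inv y)"
  shows "b = b'"
proof -
  have b: "b \<in> W" "b' \<in> W" using csteps_invariants(5) x y by blast+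
  have "Dg (inv b) = Dg (inv b')" using csteps_invariants(1) x y D by metis
  then show ?thesis using bottom_le_Dg[OF b(1) x(2)] bottom_le_Dg[OF b(2) y(2)] NN_inj[OF b] by blast
qed

lemma bottom_mono:
  assumes x: "cstep\<^sup>*\<^sup>* b x" "\<And>z. \<not> cstep z b" "x \<in> W" and y: "cstep\<^sup>*\<^sup>* b' y" and le: "NN x \<subseteq> NN y"
  shows "NN b \<subseteq> NN b'"
proof (rule bottom_le)
  show "b \<in> W" using csteps_invariants(5) x by blast
  show "\<not> cstep z b" for z by (rule x(2))
  show "JJ I up a c (inv b')" if "JJ I up a c (inv b)" for a c
    using JJ_mono[OF le] csteps_invariants(2)[OF x(1)] csteps_invariants(2)[OF y(1)] that by simp
qed

lemma top_mono:
  assumes y: "cstep\<^sup>*\<^sup>* y b'" "\<And>z. \<not> cstep b' z" "y \<in> W" and x: "cstep\<^sup>*\<^sup>* x b" "x \<in> W" and le: "NN x \<subseteq> NN y"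
  shows "NN b \<subseteq> NN b'"
proof (rule le_top)
  show "b' \<in> W" "b \<in> W" using csteps_invariants(5) x y by blast+
  show "\<not> cstep b' z" for z by (rule y(2))
  show "MM I up a c (inv b)" if "MM I up a c (inv b')" for a c
    using MM_mono[OF x(2) y(3) le] csteps_invariants(3)[OF x(1)] csteps_invariants(3)[OF y(1)] that by simp
qed

text \<open>Equal triangulations give a common bottom by \<open>bottoms_eq\<close>, and
  \<open>MM\<close> is constant along the contracted steps from this bottom up to both tops.\<close>

lemma tops_eq:
  assumes x: "cstep\<^sup>*\<^sup>* x b" "\<And>z. \<not> cstep b z" "x \<in> W" and y: "cstep\<^sup>*\<^sup>* y b'" "\<And>z. \<not> cstep b' z" "y \<in> W"
    and D: "Dg (inv x) = Dg (inv y)"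
  shows "b = b'"
proof -
  obtain c c' where c: "cstep\<^sup>*\<^sup>* c x" "\<And>z. \<not> cstep z c" and c': "cstep\<^sup>*\<^sup>* c' y" "\<And>z. \<not> cstep z c'"
    using exists_bottom[OF x(3)] exists_bottom[OF y(3)] by metis
  have "c = c'" by (rule bottoms_eq[OF c x(3) c' y(3) D])
  then have inv: "MM I up a d (inv b) = MM I up a d (inv b')" for a d
    using csteps_invariants(3)[OF c(1)] csteps_invariants(3)[OF c'(1)]
      csteps_invariants(3)[OF x(1)] csteps_invariants(3)[OF y(1)] by simp
  have "b \<in> W" "b' \<in> W" using csteps_invariants(5) x y by blast+
  then show ?thesis using le_top[of b b'] le_top[of b' b] x y inv NN_inj by blast
qed

definition camb_rel :: "(perm \<times> perm) set" where
  "camb_rel = {(x, y). x \<in> W \<and> y \<in> W \<and> Dg (inv x) = Dg (inv y)}"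

text \<open>The usual criterion for lattice congruences: each class has a bottom and a top, and the
  two projections preserve the order. Joins are compared through tops, meets through
  bottoms.\<close>

lemma lattice_cong_camb_rel: "lattice_cong S camb_rel"
  unfolding lattice_cong_def
proof (intro conjI allI impI)
  show "equiv W camb_rel"
    by (rule equivI) (auto simp: camb_rel_def refl_on_def sym_def trans_def)
next
  fix x y z j j' assume A: "(x, y) \<in> camb_rel \<and> z \<in> W \<and> is_join S x z j \<and> is_join S y z j'"
  \<comment> \<open>\<open>x\<close> lies below its top, which is also the top of \<open>y\<close>
    and hence lies below the top \<open>b'\<close> of \<open>j'\<close>. As \<open>z\<close> lies
    below \<open>b'\<close> too, so does \<open>j\<close>, and then so does the top of
    \<open>j\<close>. The reverse inclusion is the same statement with \<open>x\<close> and
    \<open>y\<close> interchanged.\<close>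
  have half: "NN b \<subseteq> NN b'"
    if xy: "x \<in> W" "y \<in> W" "Dg (inv x) = Dg (inv y)" and z: "z \<in> W" and J: "is_join S x z j" "is_join S y z j'"
      and b: "cstep\<^sup>*\<^sup>* j b" and b': "cstep\<^sup>*\<^sup>* j' b'" "\<And>z. \<not> cstep b' z" for x y j j' b b'
  proof -
    have j: "j \<in> W" "NN z \<subseteq> NN j" "NN x \<subseteq> NN j" "\<And>w. w \<in> W \<Longrightarrow> NN x \<subseteq> NN w \<Longrightarrow> NN z \<subseteq> NN w \<Longrightarrow> NN j \<subseteq> NN w"
      using J(1) is_join_iff[OF xy(1) z] by auto
    have j': "j' \<in> W" "NN z \<subseteq> NN j'" "NN y \<subseteq> NN j'"
      using J(2) is_join_iff[OF xy(2) z] by auto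
    obtain tx where tx: "cstep\<^sup>*\<^sup>* x tx" "\<And>z. \<not> cstep tx z" using exists_top[OF xy(1)] by blast
    obtain ty where ty: "cstep\<^sup>*\<^sup>* y ty" "\<And>z. \<not> cstep ty z" using exists_top[OF xy(2)] by blast
    have "tx = ty" by (rule tops_eq[OF tx xy(1) ty xy(2,3)])
    moreover have "NN ty \<subseteq> NN b'" by (rule top_mono[OF b' j'(1) ty(1) xy(2) j'(3)])
    ultimately have "NN x \<subseteq> NN b'" using csteps_invariants(4)[OF tx(1)] by blast
    moreover have b'W: "b' \<in> W" and "NN z \<subseteq> NN b'" using csteps_invariants(4,5)[OF b'(1)] j' by auto
    ultimately have "NN j \<subseteq> NN b'" using j by blast
    then show ?thesis by (rule top_mono[OF rtranclp.rtrancl_refl b'(2) b'W b j(1)])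
  qed
  have xy: "x \<in> W" "y \<in> W" "Dg (inv x) = Dg (inv y)" and z: "z \<in> W"
    and J: "is_join S x z j" "is_join S y z j'" using A by (auto simp: camb_rel_def)
  have jW: "j \<in> W" "j' \<in> W" using J by (auto simp: is_join_def)
  obtain b where b: "cstep\<^sup>*\<^sup>* j b" "\<And>z. \<not> cstep b z" using exists_top[OF jW(1)] by blast
  obtain b' where b': "cstep\<^sup>*\<^sup>* j' b'" "\<And>z. \<not> cstep b' z" using exists_top[OF jW(2)] by blast
  have "NN b = NN b'" using half[OF xy z J b(1) b'] half[OF xy(2,1) xy(3)[symmetric] z J(2,1) b'(1) b] by blast
  moreover have "b \<in> W" "b' \<in> W" using csteps_invariants(5)[OF b(1)] csteps_invariants(5)[OF b'(1)] jW by auto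
  ultimately have "b = b'" using NN_inj by blast
  then show "(j, j') \<in> camb_rel"
    using csteps_invariants(1)[OF b(1)] csteps_invariants(1)[OF b'(1)] jW by (simp add: camb_rel_def)
next
  fix x y z m m' assume A: "(x, y) \<in> camb_rel \<and> z \<in> W \<and> is_meet S x z m \<and> is_meet S y z m'"
  have half: "NN b \<subseteq> NN b'"
    if xy: "x \<in> W" "y \<in> W" "Dg (inv x) = Dg (inv y)" and z: "z \<in> W" and J: "is_meet S x z m" "is_meet S y z m'"
      and b: "cstep\<^sup>*\<^sup>* b m" "\<And>z. \<not> cstep z b" and b': "cstep\<^sup>*\<^sup>* b' m'" for x y m m' b b'
  proof -
    have m: "m \<in> W" "NN m \<subseteq> NN z" "NN m \<subseteq> NN x"
      using J(1) is_meet_iff[OF xy(1) z] by auto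
    have m': "m' \<in> W" "\<And>w. w \<in> W \<Longrightarrow> NN w \<subseteq> NN y \<Longrightarrow> NN w \<subseteq> NN z \<Longrightarrow> NN w \<subseteq> NN m'"
      using J(2) is_meet_iff[OF xy(2) z] by auto
    obtain bx where bx: "cstep\<^sup>*\<^sup>* bx x" "\<And>z. \<not> cstep z bx" using exists_bottom[OF xy(1)] by blast
    obtain bb where bb: "cstep\<^sup>*\<^sup>* bb y" "\<And>z. \<not> cstep z bb" using exists_bottom[OF xy(2)] by blast
    have "bx = bb" by (rule bottoms_eq[OF bx xy(1) bb xy(2,3)])
    moreover have "NN b \<subseteq> NN bx" by (rule bottom_mono[OF b m(1) bx(1) m(3)])
    ultimately have "NN b \<subseteq> NN y" using csteps_invariants(4)[OF bb(1)] by blast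
    moreover have bW: "b \<in> W" and "NN b \<subseteq> NN z" using csteps_invariants(4,5)[OF b(1)] m by auto
    ultimately have "NN b \<subseteq> NN m'" using m' by blast
    then show ?thesis by (rule bottom_mono[OF rtranclp.rtrancl_refl b(2) bW b'])
  qed
  have xy: "x \<in> W" "y \<in> W" "Dg (inv x) = Dg (inv y)" and z: "z \<in> W"
    and J: "is_meet S x z m" "is_meet S y z m'" using A by (auto simp: camb_rel_def)
  have mW: "m \<in> W" "m' \<in> W" using J by (auto simp: is_meet_def)
  obtain b where b: "cstep\<^sup>*\<^sup>* b m" "\<And>z. \<not> cstep z b" using exists_bottom[OF mW(1)] by blast
  obtain b' where b': "cstep\<^sup>*\<^sup>* b' m'" "\<And>z. \<not> cstep z b'" using exists_bottom[OF mW(2)] by blast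
  have "NN b = NN b'" using half[OF xy z J b b'(1)] half[OF xy(2,1) xy(3)[symmetric] z J(2,1) b' b(1)] by blast
  moreover have "b \<in> W" "b' \<in> W" using csteps_invariants(5)[OF b(1)] csteps_invariants(5)[OF b'(1)] mW by auto
  ultimately have "b = b'" using NN_inj by blast
  then show "(m, m') \<in> camb_rel"
    using csteps_invariants(1)[OF b(1)] csteps_invariants(1)[OF b'(1)] mW by (simp add: camb_rel_def)
qed

lemma camb_rel_connected:
  assumes "(x, y) \<in> camb_rel" obtains b where "cstep\<^sup>*\<^sup>* b x" "cstep\<^sup>*\<^sup>* b y"
proof -
  have xy: "x \<in> W" "y \<in> W" "Dg (inv x) = Dg (inv y)" using assms by (auto simp: camb_rel_def)
  obtain b where b: "cstep\<^sup>*\<^sup>* b x" "\<And>z. \<not> cstep z b" using exists_bottom[OF xy(1)] by blast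
  obtain c where c: "cstep\<^sup>*\<^sup>* c y" "\<And>z. \<not> cstep z c" using exists_bottom[OF xy(2)] by blast
  have "b = c" by (rule bottoms_eq[OF b xy(1) c xy(2,3)])
  then show ?thesis using that b c by blast
qed

end

section \<open>Forcing of contracted edges\<close>


context coxeter begin

lemma consec_pos: "consec i j \<Longrightarrow> 1 \<le> i \<Longrightarrow> j = i + 1"
  by (auto simp: consec_iff)

lemma pos_flip: "w \<in> W \<Longrightarrow> p \<noteq> 0 \<Longrightarrow> q \<noteq> 0 \<Longrightarrow> inv (swp p q \<circ> w) r = inv w (swp p q r)"
  using inv_flip by simp

lemma flip_flip: "p \<noteq> 0 \<Longrightarrow> q \<noteq> 0 \<Longrightarrow> swp p q \<circ> (swp p q \<circ> w) = w"
  by (simp add: comp_assoc[symmetric])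

lemma pos_neq:
  assumes "w \<in> W" "inv w p \<noteq> inv w q" "inv w p \<noteq> - inv w q" shows "p \<noteq> q" "p \<noteq> - q"
  using assms inv_odd[of w q] by auto

lemma flip_asc_le: "w \<in> W \<Longrightarrow> consec (inv w p) (inv w q) \<Longrightarrow> p < q \<Longrightarrow> NN w \<subseteq> NN (swp p q \<circ> w)"
  using NN_flip by auto

lemma flip_desc_le:
  assumes w: "w \<in> W" and c: "consec (inv w p) (inv w q)" and "q < p"
  shows "NN (swp p q \<circ> w) \<subseteq> NN w"
proof -
  have nz: "p \<noteq> 0" "q \<noteq> 0" using consec_nz[OF c] inv_zero_iff[OF w] by auto
  have w': "swp p q \<circ> w \<in> W" by (rule flip_W[OF w c])
  have "consec (inv (swp p q \<circ> w) q) (inv (swp p q \<circ> w) p)" using c pos_flip[OF w nz] by simp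
  then have "NN (swp p q \<circ> w) \<subseteq> NN (swp q p \<circ> (swp p q \<circ> w))" using flip_asc_le[OF w'] assms by blast
  then show ?thesis unfolding swp_commute[OF nz(2,1)] flip_flip[OF nz] .
qed

definition edge :: "perm \<Rightarrow> int \<Rightarrow> int \<Rightarrow> bool" where
  "edge y a c \<longleftrightarrow> y \<in> W \<and> a < c \<and> consec (inv y a) (inv y c)"

lemma edgeD:
  assumes "edge y a c"
  shows "y \<in> W" "a < c" "consec (inv y a) (inv y c)" "a \<in> I" "c \<in> I" "a \<noteq> 0" "c \<noteq> 0"
    "swp a c \<circ> y \<in> W" "NN (swp a c \<circ> y) = NN y \<union> {(a, c), (- c, - a)} \<inter> I \<times> I"
    "(a, c) \<in> NN (swp a c \<circ> y)" "(a, c) \<notin> NN y"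
proof -
  show y: "y \<in> W" and ac: "a < c" and c: "consec (inv y a) (inv y c)" using assms by (auto simp: edge_def)
  show I: "a \<in> I" "c \<in> I" using c inv_I[OF y] by (auto simp: consec_def)
  show "a \<noteq> 0" "c \<noteq> 0" using I I_nz by auto
  show "swp a c \<circ> y \<in> W" by (rule flip_W[OF y c])
  show N: "NN (swp a c \<circ> y) = NN y \<union> {(a, c), (- c, - a)} \<inter> I \<times> I" by (rule NN_flip[OF y c ac])
  show "(a, c) \<in> NN (swp a c \<circ> y)" using N I by auto
  show "(a, c) \<notin> NN y" using c by (auto simp: NN_def consec_def)
qed

text \<open>In type B the flip adds a pair and its mirror image at once. By symmetry of inversion
  sets, an element above \<open>y\<close> containing one of them contains the other.\<close>

lemma flip_least:
  assumes e: "edge y a c" and z: "z \<in> W" "NN y \<subseteq> NN z" and r: "r \<in> NN (swp a c \<circ> y)" "r \<notin> NN y" "r \<in> NN z"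
  shows "NN (swp a c \<circ> y) \<subseteq> NN z"
proof -
  have "r = (a, c) \<or> r = (- c, - a)" using r edgeD(9)[OF e] by auto
  moreover have "(a, c) \<in> NN z \<and> (- c, - a) \<in> I \<times> I \<longrightarrow> (- c, - a) \<in> NN z"
    using NN_sym[OF z(1), of a c] not_t_neg edgeD(4)[OF e] by auto
  moreover have "(- c, - a) \<in> NN z \<longrightarrow> (a, c) \<in> NN z"
  proof
    assume m: "(- c, - a) \<in> NN z"
    then have "- a \<in> I" by (auto simp: NN_def)
    then have t using not_t_neg edgeD(4)[OF e] by blast
    then show "(a, c) \<in> NN z" using NN_sym[OF z(1) m] by simp
  qed
  ultimately show ?thesis using r(3) z(2) edgeD(9)[OF e] by auto
qed

lemma edge_mirror: assumes "t" "edge y a c" shows "edge y (- c) (- a)" "swp (- c) (- a) = swp a c"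
proof -
  show "edge y (- c) (- a)" using assms consec_neg inv_odd by (auto simp: edge_def)
  show "swp (- c) (- a) = swp a c"
    using edgeD(6,7)[OF assms(2)] swp_neg[of c a] swp_commute[of a c] by simp
qed

end

section \<open>Forcing through joins, meets and hexagons\<close>

text \<open>The assumptions are the generating pairs with their alternating words rewritten as
  exchanges of values; \<open>gens_iff\<close> supplies the translation. The side of
  \<open>b\<close> records the direction of the diagram edge between the two generators moving
  \<open>b\<close>.\<close>

locale forcing = cambrian +
  fixes \<Theta> :: "(perm \<times> perm) set"
  assumes cong: "lattice_cong S \<Theta>"
    and gen_low: "\<And>b. 2 \<le> b \<Longrightarrow> b < int n \<Longrightarrow> \<not> up b \<Longrightarrow>
        (swp b (b + 1), swp (b - 1) (b + 1) \<circ> swp b (b + 1)) \<in> \<Theta>"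
    and gen_up: "\<And>b. 2 \<le> b \<Longrightarrow> b < int n \<Longrightarrow> up b \<Longrightarrow>
        (swp (b - 1) b, swp (b - 1) (b + 1) \<circ> swp (b - 1) b) \<in> \<Theta>"
    and gen0_low: "t \<Longrightarrow> 2 \<le> n \<Longrightarrow> \<not> up 1 \<Longrightarrow>
        (swp 1 2, swp (- 2) 1 \<circ> (swp (- 2) 2 \<circ> swp 1 2)) \<in> \<Theta>"
    and gen0_up: "t \<Longrightarrow> 2 \<le> n \<Longrightarrow> up 1 \<Longrightarrow>
        (swp (- 1) 1, swp (- 2) 2 \<circ> (swp (- 1) 2 \<circ> swp (- 1) 1)) \<in> \<Theta>"
begin

lemma Th_equiv: "equiv W \<Theta>"
  using cong by (auto simp: lattice_cong_def)

lemma Th_W: "(x, y) \<in> \<Theta> \<Longrightarrow> x \<in> W \<and> y \<in> W"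
  using Th_equiv by (meson equiv_class_eq_iff)

lemma Th_sym: "(x, y) \<in> \<Theta> \<Longrightarrow> (y, x) \<in> \<Theta>"
  using Th_equiv by (meson equivE symD)

lemma Th_trans: "(x, y) \<in> \<Theta> \<Longrightarrow> (y, z) \<in> \<Theta> \<Longrightarrow> (x, z) \<in> \<Theta>"
  using Th_equiv by (meson equivE transD)

lemma Th_join: "(x, y) \<in> \<Theta> \<Longrightarrow> z \<in> W \<Longrightarrow> is_join S x z j \<Longrightarrow> is_join S y z j' \<Longrightarrow> (j, j') \<in> \<Theta>"
  using cong unfolding lattice_cong_def by blast

lemma Th_meet: "(x, y) \<in> \<Theta> \<Longrightarrow> z \<in> W \<Longrightarrow> is_meet S x z j \<Longrightarrow> is_meet S y z j' \<Longrightarrow> (j, j') \<in> \<Theta>"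
  using cong unfolding lattice_cong_def by blast

abbreviation Good :: "perm \<Rightarrow> int \<Rightarrow> int \<Rightarrow> bool" where
  "Good y a c \<equiv> (y, swp a c \<circ> y) \<in> \<Theta>"

lemma is_join_le: "x \<in> W \<Longrightarrow> y \<in> W \<Longrightarrow> NN x \<subseteq> NN y \<Longrightarrow> is_join S x y y"
  by (simp add: is_join_iff)

lemma is_join_ge: "x \<in> W \<Longrightarrow> y \<in> W \<Longrightarrow> NN y \<subseteq> NN x \<Longrightarrow> is_join S x y x"
  by (simp add: is_join_iff)

lemma is_meet_le: "x \<in> W \<Longrightarrow> y \<in> W \<Longrightarrow> NN x \<subseteq> NN y \<Longrightarrow> is_meet S x y x"
  by (simp add: is_meet_iff)

lemma is_meet_ge: "x \<in> W \<Longrightarrow> y \<in> W \<Longrightarrow> NN y \<subseteq> NN x \<Longrightarrow> is_meet S x y y"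
  by (simp add: is_meet_iff)

lemma Th_convex:
  assumes "(p, q) \<in> \<Theta>" "m \<in> W" "NN p \<subseteq> NN m" "NN m \<subseteq> NN q" shows "(p, m) \<in> \<Theta>"
  using Th_meet[OF assms(1,2)] is_meet_le is_meet_ge Th_W[OF assms(1)] assms by blast

text \<open>Joining the congruent pair with \<open>y\<close> gives \<open>y\<close> itself on one
  side and the upper end of the edge on the other.\<close>

lemma edgeT:
  assumes e: "edge y a c" and pq: "(p, q) \<in> \<Theta>" and le: "NN p \<subseteq> NN y" "NN q \<subseteq> NN (swp a c \<circ> y)" "\<not> NN q \<subseteq> NN y"
  shows "Good y a c"
proof -
  let ?x = "swp a c \<circ> y"
  have W: "p \<in> W" "q \<in> W" "y \<in> W" "?x \<in> W" using Th_W[OF pq] edgeD[OF e] by auto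
  obtain r where r: "r \<in> NN q" "r \<notin> NN y" using le by blast
  have "NN ?x \<subseteq> NN z" if "z \<in> W" "NN q \<subseteq> NN z" "NN y \<subseteq> NN z" for z
    by (rule flip_least[OF e, of z r]) (use that r le in auto)
  then have "is_join S q y ?x" using is_join_iff[OF W(2,3)] W le edgeD(9)[OF e] by auto
  then show ?thesis using Th_join[OF pq W(3)] is_join_le[OF W(1,3)] le by blast
qed

lemma edgeT':
  assumes e: "edge y a c" and pq: "(p, q) \<in> \<Theta>"
    and le: "NN y \<subseteq> NN p" "NN (swp a c \<circ> y) \<subseteq> NN q" "\<not> NN (swp a c \<circ> y) \<subseteq> NN p"
  shows "Good y a c"
proof -
  let ?x = "swp a c \<circ> y"
  have W: "p \<in> W" "q \<in> W" "y \<in> W" "?x \<in> W" using Th_W[OF pq] edgeD[OF e] by auto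
  have "NN z \<subseteq> NN y" if "z \<in> W" "NN z \<subseteq> NN p" "NN z \<subseteq> NN ?x" for z
    using flip_least[OF e W(1) le(1)] le(3) that by blast
  then have "is_meet S p ?x y" using is_meet_iff[OF W(1,4)] W le edgeD(9)[OF e] by auto
  then show ?thesis using Th_meet[OF pq W(4)] is_meet_ge[OF W(2,4)] le by blast
qed

text \<open>Joining the congruent pair with \<open>y\<close> shows that \<open>y\<close> is
  congruent to its join with \<open>q\<close>. By the explicit form of joins this join lies above
  the upper end of the edge, and a meet brings it down to that end.\<close>

lemma edgeM:
  assumes e: "edge y a c" and pq: "(p, q) \<in> \<Theta>" and le: "NN p \<subseteq> NN y" and tr: "(a, c) \<in> (NN y \<union> NN q)\<^sup>+"
  shows "Good y a c"
proof -
  let ?x = "swp a c \<circ> y"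
  have W: "p \<in> W" "q \<in> W" "y \<in> W" "?x \<in> W" using Th_W[OF pq] edgeD[OF e] by auto
  obtain J where J: "J \<in> W" "NN J = (NN q \<union> NN y)\<^sup>+" using join_exists[OF W(2,3)] .
  have yJ: "NN y \<subseteq> NN J" using J(2) by auto
  have "is_join S q y J" by (rule is_join_trancl[OF W(2,3) J])
  then have "(y, J) \<in> \<Theta>" using Th_join[OF pq W(3) is_join_le[OF W(1,3) le]] by blast
  moreover have "(a, c) \<in> NN J" using tr J(2) by (simp add: Un_commute)
  then have "NN ?x \<subseteq> NN J" using flip_least[OF e J(1) yJ] edgeD(10,11)[OF e] by blast
  ultimately show ?thesis
    using Th_meet[OF _ W(4) is_meet_le[OF W(3,4)] is_meet_ge[OF J(1) W(4)]] edgeD(9)[OF e] by blast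
qed

lemma edgeM':
  assumes e: "edge y a c" and pq: "(p, q) \<in> \<Theta>" and le: "NN (swp a c \<circ> y) \<subseteq> NN q"
    and tr: "(a, c) \<in> (CN p \<union> CN (swp a c \<circ> y))\<^sup>+"
  shows "Good y a c"
proof -
  let ?x = "swp a c \<circ> y"
  have W: "p \<in> W" "q \<in> W" "y \<in> W" "?x \<in> W" using Th_W[OF pq] edgeD[OF e] by auto
  obtain m where m: "m \<in> W" "CN m = (CN p \<union> CN ?x)\<^sup>+" using meet_exists[OF W(1,4)] .
  have mx: "NN m \<subseteq> NN ?x" using m(2) unfolding CN_antimono[symmetric] by auto
  have "is_meet S p ?x m" by (rule is_meet_trancl[OF W(1,4) m])
  then have mx': "(m, ?x) \<in> \<Theta>" using Th_meet[OF pq W(4) _ is_meet_ge[OF W(2,4) le]] by blast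
  have nm: "(a, c) \<notin> NN m" using tr m(2) by (auto simp: CN_def)
  have my: "NN m \<subseteq> NN y"
  proof
    fix r assume r: "r \<in> NN m"
    have "(- c, - a) \<in> NN m \<longrightarrow> (a, c) \<in> NN m"
    proof
      assume m': "(- c, - a) \<in> NN m"
      then have "- a \<in> I" by (auto simp: NN_def)
      then have t using not_t_neg edgeD(4)[OF e] by blast
      then show "(a, c) \<in> NN m" using NN_sym[OF m(1) m'] by simp
    qed
    then show "r \<in> NN y" using r mx nm edgeD(9)[OF e] by auto
  qed
  show ?thesis
    using Th_join[OF mx' W(3) is_join_le[OF m(1) W(3) my] is_join_ge[OF W(4,3)]] edgeD(9)[OF e] by blast
qed

text \<open>Comparable edges that exchange the same pair are perspective, so contraction passes
  between them in both directions.\<close>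

lemma transfer:
  assumes e: "edge y a c" "edge y' a c" and le: "NN y \<subseteq> NN y' \<or> NN y' \<subseteq> NN y" and G: "Good y' a c"
  shows "Good y a c"
  using le
proof
  assume "NN y \<subseteq> NN y'"
  then show ?thesis using edgeT'[OF e(1) G] edgeD(9,10,11)[OF e(1)] edgeD(9,10,11)[OF e(2)] by blast
next
  assume "NN y' \<subseteq> NN y"
  then show ?thesis using edgeT[OF e(1) G] edgeD(9,10,11)[OF e(1)] edgeD(9,10,11)[OF e(2)] by blast
qed

lemma wit_consec:
  assumes "consec (inv y a) (inv y c)" "y \<in> W" "b \<in> I"
  shows "wit up (inv y) b a c \<longleftrightarrow> a < b \<and> b < c \<and> (if up b then inv y b < inv y a else inv y c < inv y b)"
  using assms by (auto simp: wit_def consec_def)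

lemma block3:
  assumes y: "y \<in> W" and c: "consec (inv y u) (inv y v)" "consec (inv y v) (inv y w)"
    and ne: "u \<noteq> - v" "v \<noteq> - w"
  shows "inv y v = inv y u + 1" "inv y w = inv y u + 2" "1 \<le> inv y u \<or> inv y u \<le> - 3"
    "u \<noteq> - w" "u \<noteq> v" "v \<noteq> w" "u \<noteq> w" "u \<in> I" "v \<in> I" "w \<in> I"
proof -
  have n: "inv y u \<noteq> - inv y v" "inv y v \<noteq> - inv y w"
    using ne inv_eq_iff[OF y] by (auto simp flip: inv_odd[OF y])
  show 1: "inv y v = inv y u + 1" "inv y w = inv y u + 2"
    using c n by (auto simp: consec_iff)
  show I: "u \<in> I" "v \<in> I" "w \<in> I" using c inv_I[OF y] by (auto simp: consec_def)
  have "inv y u \<noteq> 0" "inv y v \<noteq> 0" "inv y w \<noteq> 0" using I I_nz inv_zero_iff[OF y] by auto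
  then show 2: "1 \<le> inv y u \<or> inv y u \<le> - 3" using 1 by arith
  show "u \<noteq> - w" using 1 2 inv_odd[OF y, of w] by auto
  show "u \<noteq> v" "v \<noteq> w" "u \<noteq> w" using 1 by auto
qed

text \<open>The six orders of \<open>a\<close>, \<open>d\<close>, \<open>c\<close> in three
  neighbouring positions form a hexagon in which the exchange of \<open>a\<close> and
  \<open>c\<close> is a side edge. A narrower pair enclosing \<open>b\<close> occurs as the bottom
  or top edge of the opposite chain, and contracting it forces the side edge. The conditions
  \<open>ne\<close> keep the block of three positions away from its mirror image.\<close>

lemma hexagon:
  assumes IH: "\<And>y' a' c'. edge y' a' c' \<Longrightarrow> c' - a' < c - a \<Longrightarrow> wit up (inv y') b a' c' \<Longrightarrow> Good y' a' c'"
    and e: "edge y a c" and w: "wit up (inv y) b a c" and b: "b \<in> I" and d: "a < d" "d < c" "d \<noteq> b"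
    and ne: "a \<noteq> - c" "d \<noteq> - c" "d \<noteq> - a"
    and adj: "consec (inv y c) (inv y d) \<or> consec (inv y d) (inv y a)"
  shows "Good y a c"
  using adj
proof
  let ?f = "inv y"
  have y: "y \<in> W" and ac: "consec (?f a) (?f c)" and I: "a \<in> I" "c \<in> I" and nz: "a \<noteq> 0" "c \<noteq> 0"
    and xW: "swp a c \<circ> y \<in> W"
    using edgeD[OF e] by auto
  have bac: "a < b" "b < c" "if up b then ?f b < ?f a else ?f c < ?f b" using w wit_consec[OF ac y b] by auto
  note odd = inv_odd[OF y]
  have bpos: "?f b \<noteq> ?f a" "?f b \<noteq> ?f c" "?f b \<noteq> ?f d" using inv_eq_iff[OF y] bac d by auto
  note px = pos_flip[OF y nz]
  {
    assume cd: "consec (?f c) (?f d)"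
    have B: "?f c = ?f a + 1" "?f d = ?f a + 2" "1 \<le> ?f a \<or> ?f a \<le> - 3" "d \<in> I"
      using block3[OF y ac cd] ne by auto
    have dz: "d \<noteq> 0" using B I_nz by auto
    have "- ?f a \<noteq> ?f c" "- ?f a \<noteq> ?f d" "- ?f c \<noteq> ?f d" using B by auto
    show ?thesis
    \<comment> \<open>If \<open>b < d\<close>, the pair \<open>(a, d)\<close> encloses
      \<open>b\<close> and gives a bottom edge, handled by \<open>edgeM\<close>; otherwise
      \<open>(d, c)\<close> does and gives a top edge, handled by \<open>edgeM'\<close>.\<close>
    proof (cases "b < d")
      case True
      let ?p = "swp c d \<circ> y"
      have pW: "?p \<in> W" by (rule flip_W[OF y cd])
      have pf: "inv ?p r = ?f (swp c d r)" for r using pos_flip[OF y nz(2) dz] .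
      have pa: "inv ?p a = ?f a" and pd: "inv ?p d = ?f c" using pf ne d by (auto simp: swp_def)
      have ep: "edge ?p a d" unfolding edge_def using pW d pa pd ac by simp
      \<comment> \<open>The witness may be the negative of an exchanged letter. Its position then
        changes, but only inside the mirror block, hence on the same side of the pair.\<close>
      have pb: "inv ?p b = ?f b \<or> b = - c \<and> inv ?p b = - ?f d \<or> b = - d \<and> inv ?p b = - ?f c"
        using pf[of b] bac d odd dz nz by (auto simp: swp_def)
      have "wit up (inv ?p) b a d"
        unfolding wit_consec[OF edgeD(3)[OF ep] pW b] pa pd using bac True pb B bpos odd
        by (auto split: if_splits)
      then have G: "Good ?p a d" using IH[OF ep] d by simp
      have "(a, d) \<in> NN (swp a d \<circ> ?p)" by (rule edgeD(10)[OF ep])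
      moreover have "(d, c) \<in> NN y" using cd d I B by (auto simp: NN_def)
      ultimately have "(a, c) \<in> (NN y \<union> NN (swp a d \<circ> ?p))\<^sup>+" by (meson UnCI r_into_trancl trancl_trans)
      then show ?thesis using edgeM[OF e G flip_desc_le[OF y cd d(2)]] by blast
    next
      case False
      then have db: "d < b" using d by simp
      let ?x = "swp a c \<circ> y"
      let ?q = "swp a d \<circ> ?x"
      let ?p = "swp d c \<circ> ?q"
      have xa: "inv ?x a = ?f c" and xc: "inv ?x c = ?f a" and xd: "inv ?x d = ?f d"
        using px ne d by (auto simp: swp_def)
      have cx: "consec (inv ?x a) (inv ?x d)" using xa xd cd by simp
      have qW: "?q \<in> W" by (rule flip_W[OF xW cx])
      have qf: "inv ?q r = inv ?x (swp a d r)" for r using pos_flip[OF xW nz(1) dz] .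
      have qa: "inv ?q a = ?f d" and qd: "inv ?q d = ?f c" and qc: "inv ?q c = ?f a"
        using qf xa xd xc ne d by (auto simp: swp_def)
      have cq: "consec (inv ?q c) (inv ?q d)" using qc qd ac by simp
      have "?p = swp c d \<circ> ?q" using swp_commute[OF nz(2) dz] by simp
      then have pW: "?p \<in> W" using flip_W[OF qW cq] by simp
      have pf: "inv ?p r = inv ?q (swp d c r)" for r using pos_flip[OF qW dz nz(2)] .
      have pa: "inv ?p a = ?f d" and pd: "inv ?p d = ?f a" and pc: "inv ?p c = ?f c"
        using pf qa qd qc ne d by (auto simp: swp_def)
      have ep: "edge ?p d c" unfolding edge_def using pW d pc pd ac by simp
      have pb: "inv ?p b = ?f b \<or> b = - c \<and> inv ?p b = - ?f c \<or> b = - d \<and> inv ?p b = - ?f a \<or> b = - a \<and> inv ?p b = - ?f d"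
      proof (cases "b \<in> {- a, - c, - d}")
        case True then show ?thesis using inv_odd[OF pW] pa pd pc by auto
      next
        case False
        then have "b \<notin> {a, c, - a, - c}" "b \<notin> {a, d, - a, - d}" "b \<notin> {d, c, - d, - c}" using bac d by auto
        then show ?thesis using pf[of b] qf[of b] px[of b] swp_other by simp
      qed
      have "wit up (inv ?p) b d c"
        unfolding wit_consec[OF edgeD(3)[OF ep] pW b] pc pd using bac db pb B bpos odd
        by (auto split: if_splits)
      then have G: "Good ?p d c" using IH[OF ep] d by simp
      have Gq: "swp d c \<circ> ?p = ?q" using flip_flip[OF dz nz(2)] .
      have "(d, c) \<in> CN ?p" using edgeD(4,5,11)[OF ep] d by (simp add: CN_def)
      moreover have "(a, d) \<in> CN ?x" using xa xd cd d I B by (auto simp: CN_def NN_def)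
      ultimately have "(a, c) \<in> (CN ?p \<union> CN ?x)\<^sup>+" by (meson UnCI r_into_trancl trancl_trans)
      moreover have "NN ?x \<subseteq> NN ?q" by (rule flip_asc_le[OF xW cx d(1)])
      ultimately show ?thesis using edgeM'[OF e, of ?p ?q] G unfolding Gq by blast
    qed
  }
  {
    assume da: "consec (?f d) (?f a)"
    have B: "?f a = ?f d + 1" "?f c = ?f d + 2" "1 \<le> ?f d \<or> ?f d \<le> - 3" "d \<in> I"
      using block3[OF y da ac] ne by auto
    have dz: "d \<noteq> 0" using B I_nz by auto
    show ?thesis
    proof (cases "d < b")
      case True
      let ?p = "swp d a \<circ> y"
      have pW: "?p \<in> W" by (rule flip_W[OF y da])
      have pf: "inv ?p r = ?f (swp d a r)" for r using pos_flip[OF y dz nz(1)] .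
      have pc: "inv ?p c = ?f c" and pd: "inv ?p d = ?f a" using pf ne d by (auto simp: swp_def)
      have ep: "edge ?p d c" unfolding edge_def using pW d pc pd ac by simp
      have pb: "inv ?p b = ?f b \<or> b = - a \<and> inv ?p b = - ?f d \<or> b = - d \<and> inv ?p b = - ?f a"
        using pf[of b] bac d odd dz nz by (auto simp: swp_def)
      have "wit up (inv ?p) b d c"
        unfolding wit_consec[OF edgeD(3)[OF ep] pW b] pc pd using bac True pb B bpos odd
        by (auto split: if_splits)
      then have G: "Good ?p d c" using IH[OF ep] d by simp
      have "(d, c) \<in> NN (swp d c \<circ> ?p)" by (rule edgeD(10)[OF ep])
      moreover have "(a, d) \<in> NN y" using da d I B by (auto simp: NN_def)
      ultimately have "(a, c) \<in> (NN y \<union> NN (swp d c \<circ> ?p))\<^sup>+" by (meson UnCI r_into_trancl trancl_trans)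
      then show ?thesis using edgeM[OF e G flip_desc_le[OF y da d(1)]] by blast
    next
      case False
      then have db: "b < d" using d by simp
      let ?x = "swp a c \<circ> y"
      let ?q = "swp d c \<circ> ?x"
      let ?p = "swp a d \<circ> ?q"
      have xa: "inv ?x a = ?f c" and xc: "inv ?x c = ?f a" and xd: "inv ?x d = ?f d"
        using px ne d by (auto simp: swp_def)
      have cx: "consec (inv ?x d) (inv ?x c)" using xc xd da by simp
      have qW: "?q \<in> W" by (rule flip_W[OF xW cx])
      have qf: "inv ?q r = inv ?x (swp d c r)" for r using pos_flip[OF xW dz nz(2)] .
      have qa: "inv ?q a = ?f c" and qd: "inv ?q d = ?f a" and qc: "inv ?q c = ?f d"
        using qf xa xd xc ne d by (auto simp: swp_def)
      have cq: "consec (inv ?q d) (inv ?q a)" using qa qd ac by simp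
      have "?p = swp d a \<circ> ?q" using swp_commute[OF nz(1) dz] by simp
      then have pW: "?p \<in> W" using flip_W[OF qW cq] by simp
      have pf: "inv ?p r = inv ?q (swp a d r)" for r using pos_flip[OF qW nz(1) dz] .
      have pa: "inv ?p a = ?f a" and pd: "inv ?p d = ?f c" and pc: "inv ?p c = ?f d"
        using pf qa qd qc ne d by (auto simp: swp_def)
      have ep: "edge ?p a d" unfolding edge_def using pW d pa pd ac by simp
      have pb: "inv ?p b = ?f b \<or> b = - a \<and> inv ?p b = - ?f a \<or> b = - d \<and> inv ?p b = - ?f c \<or> b = - c \<and> inv ?p b = - ?f d"
      proof (cases "b \<in> {- a, - c, - d}")
        case True then show ?thesis using inv_odd[OF pW] pa pd pc by auto
      next
        case False
        then have "b \<notin> {a, c, - a, - c}" "b \<notin> {a, d, - a, - d}" "b \<notin> {d, c, - d, - c}" using bac d by auto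
        then show ?thesis using pf[of b] qf[of b] px[of b] swp_other by simp
      qed
      have "wit up (inv ?p) b a d"
        unfolding wit_consec[OF edgeD(3)[OF ep] pW b] pa pd using bac db pb B bpos odd
        by (auto split: if_splits)
      then have G: "Good ?p a d" using IH[OF ep] d by simp
      have Gq: "swp a d \<circ> ?p = ?q" using flip_flip[OF nz(1) dz] .
      have "(a, d) \<in> CN ?p" using edgeD(4,5,11)[OF ep] d by (simp add: CN_def)
      moreover have "(d, c) \<in> CN ?x" using xc xd da d I B by (auto simp: CN_def NN_def)
      ultimately have "(a, c) \<in> (CN ?p \<union> CN ?x)\<^sup>+" by (meson UnCI r_into_trancl trancl_trans)
      moreover have "NN ?x \<subseteq> NN ?q" by (rule flip_asc_le[OF xW cx d(2)])
      ultimately show ?thesis using edgeM'[OF e, of ?p ?q] G unfolding Gq by blast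
    qed
  }
qed

text \<open>Both letters lie inside the gap between the pair and its mirror image, or both lie
  outside. The exchange therefore disturbs neither the pair nor the side on which any letter lies,
  and the two edges are comparable.\<close>

lemma move:
  assumes e: "edge y a c" and i: "1 \<le> inv y a" and cr: "consec (inv y r) (inv y r')"
    and out: "\<bar>inv y r\<bar> < inv y a \<and> \<bar>inv y r'\<bar> < inv y a \<or> inv y c < \<bar>inv y r\<bar> \<and> inv y c < \<bar>inv y r'\<bar>"
  defines "y' \<equiv> swp r r' \<circ> y"
  shows "edge y' a c" "inv y' a = inv y a" "inv y' c = inv y c" "inv y' r = inv y r'" "inv y' r' = inv y r"
    "b \<in> I \<Longrightarrow> wit up (inv y') b a c \<longleftrightarrow> wit up (inv y) b a c" "Good y' a c \<Longrightarrow> Good y a c"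
proof -
  let ?f = "inv y"
  have y: "y \<in> W" and ac: "consec (?f a) (?f c)" "a < c" using edgeD[OF e] by auto
  have fc: "?f c = ?f a + 1" using consec_pos[OF ac(1) i] .
  have nz: "r \<noteq> 0" "r' \<noteq> 0" using consec_nz[OF cr] inv_zero_iff[OF y] by auto
  have y'W: "y' \<in> W" unfolding y'_def by (rule flip_W[OF y cr])
  have pf: "inv y' s = ?f (swp r r' s)" for s unfolding y'_def using pos_flip[OF y nz] .
  have dist: "a \<notin> {r, r', - r, - r'}" "c \<notin> {r, r', - r, - r'}"
    using out i fc inv_odd[OF y, of r] inv_odd[OF y, of r'] by auto
  show fa': "inv y' a = ?f a" and fc': "inv y' c = ?f c" using pf swp_other dist by auto
  show "inv y' r = ?f r'" "inv y' r' = ?f r" using pf by auto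
  show e': "edge y' a c" unfolding edge_def using y'W ac fa' fc' by simp
  show "wit up (inv y') b a c \<longleftrightarrow> wit up (inv y) b a c" if b: "b \<in> I"
  proof -
    let ?same = "\<lambda>v v'. \<bar>v\<bar> < ?f a \<and> \<bar>v'\<bar> < ?f a \<or> ?f c < v \<and> ?f c < v' \<or> v < - ?f c \<and> v' < - ?f c"
    have sg: "?same (?f r) (?f r')"
    proof (cases "?f r = -1 \<and> ?f r' = 1")
      case True then show ?thesis using out fc i by auto
    next
      case False
      then have "?f r' = ?f r + 1" "?f r \<noteq> 0" "?f r' \<noteq> 0" using cr consec_nz[OF cr] by (auto simp: consec_iff)
      then show ?thesis using out by arith
    qed
    have "inv y' b = ?f b \<or> ?same (?f b) (inv y' b)"
    proof (cases "b \<in> {r, r', - r, - r'}")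
      case True
      have "inv y' (- r) = - ?f r'" "inv y' (- r') = - ?f r" using pf inv_odd[OF y] nz by auto
      moreover have "?f (- r) = - ?f r" "?f (- r') = - ?f r'" by (rule inv_odd[OF y])+
      ultimately show ?thesis using True sg pf[of r] pf[of r'] by (elim insertE emptyE) auto
    next
      case False then show ?thesis using pf swp_other by simp
    qed
    then have "(inv y' b < ?f a \<longleftrightarrow> ?f b < ?f a) \<and> (?f c < inv y' b \<longleftrightarrow> ?f c < ?f b)"
      using fc i by arith
    then show ?thesis
      unfolding wit_consec[OF ac(1) y b] wit_consec[OF edgeD(3)[OF e'] y'W b] fa' fc' by simp
  qed
  have "NN y \<subseteq> NN y' \<or> NN y' \<subseteq> NN y"
  proof (cases "r < r'")
    case True then show ?thesis using flip_asc_le[OF y cr] y'_def by blast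
  next
    case False
    have "r \<noteq> r'" using cr by (auto simp: consec_def)
    then show ?thesis using False flip_desc_le[OF y cr] y'_def by simp
  qed
  then show "Good y' a c \<Longrightarrow> Good y a c" using transfer[OF e e'] by blast
qed

lemma at_pos: assumes "y \<in> W" "k \<in> I" obtains r where "r \<in> I" "inv y r = k"
  using that[of "y k"] inv_inv_W[OF assms(1)] W_I[OF assms] by simp

text \<open>As \<open>u\<close> is smaller than both \<open>a\<close> and \<open>c\<close> or larger
  than both, its exchanges with \<open>c\<close> and then with \<open>a\<close> go in the same
  direction of the weak order. The edges before and after are thus comparable. Only \<open>u\<close>
  and \<open>- u\<close> change sides, which is why the witness must differ from them.\<close>

lemma hop_left:
  assumes e: "edge y a c" and i: "1 \<le> inv y a" and ce: "consec (inv y c) (inv y u)" and u: "u < a \<or> c < u"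
  defines "y' \<equiv> swp a u \<circ> (swp c u \<circ> y)"
  shows "edge y' a c" "inv y' a = inv y a + 1" "inv y' u = inv y a"
    "b \<in> I \<Longrightarrow> b \<noteq> u \<Longrightarrow> b \<noteq> - u \<Longrightarrow> wit up (inv y') b a c \<longleftrightarrow> wit up (inv y) b a c" "Good y' a c \<Longrightarrow> Good y a c"
proof -
  let ?f = "inv y"
  have y: "y \<in> W" and ac: "consec (?f a) (?f c)" "a < c" and nz: "a \<noteq> 0" "c \<noteq> 0" using edgeD[OF e] by auto
  have fc: "?f c = ?f a + 1" using consec_pos[OF ac(1) i] .
  have fu: "?f u = ?f a + 2" using consec_pos[OF ce] fc i by simp
  have uz: "u \<noteq> 0" using consec_nz[OF ce] inv_zero_iff[OF y] by auto
  have dist: "a \<noteq> - c" "a \<noteq> - u" "c \<noteq> - u" by (rule pos_neq(2)[OF y], use fc fu i in simp, use fc fu i in simp)+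
  let ?y1 = "swp c u \<circ> y"
  have y1W: "?y1 \<in> W" by (rule flip_W[OF y ce])
  have p1: "inv ?y1 s = ?f (swp c u s)" for s using pos_flip[OF y nz(2) uz] .
  have 1: "inv ?y1 a = ?f a" "inv ?y1 u = ?f c" "inv ?y1 c = ?f u"
    using p1 dist ac u by (auto simp: swp_def)
  have c1: "consec (inv ?y1 a) (inv ?y1 u)" using 1 ac by simp
  have y'W: "y' \<in> W" unfolding y'_def by (rule flip_W[OF y1W c1])
  have p2: "inv y' s = inv ?y1 (swp a u s)" for s unfolding y'_def using pos_flip[OF y1W nz(1) uz] .
  have fa': "inv y' a = ?f c" and fu': "inv y' u = ?f a" and fc': "inv y' c = ?f u"
    using p2 1 dist ac u by (auto simp: swp_def)
  show "inv y' a = ?f a + 1" "inv y' u = ?f a" using fa' fu' fc by auto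
  show e': "edge y' a c" unfolding edge_def using y'W ac ce fa' fc' by simp
  show "wit up (inv y') b a c \<longleftrightarrow> wit up (inv y) b a c" if b: "b \<in> I" "b \<noteq> u" "b \<noteq> - u"
  proof (cases "a < b \<and> b < c")
    case True
    have "inv y' b = ?f b \<or> b = - a \<and> inv y' b = - ?f c \<or> b = - c \<and> inv y' b = - ?f u"
    proof (cases "b \<in> {- a, - c}")
      case True then show ?thesis using inv_odd[OF y'W] fa' fc' by auto
    next
      case False then show ?thesis using p1[of b] p2[of b] swp_other[of b] b \<open>a < b \<and> b < c\<close> by simp
    qed
    moreover have "?f b \<noteq> ?f a" "?f b \<noteq> ?f c" "?f b \<noteq> ?f u" using inv_eq_iff[OF y] True b by auto
    ultimately have "(inv y' b < ?f c \<longleftrightarrow> ?f b < ?f a) \<and> (?f u < inv y' b \<longleftrightarrow> ?f c < ?f b)"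
      using fc fu i inv_odd[OF y] by auto
    then show ?thesis
      unfolding wit_consec[OF ac(1) y b(1)] wit_consec[OF edgeD(3)[OF e'] y'W b(1)] fa' fc' by simp
  qed (auto simp: wit_def)
  have "NN y \<subseteq> NN y' \<or> NN y' \<subseteq> NN y"
    using u
  proof
    assume "u < a"
    then have "NN ?y1 \<subseteq> NN y" "NN y' \<subseteq> NN ?y1"
      unfolding y'_def using flip_desc_le[OF y ce] flip_desc_le[OF y1W c1] ac by auto
    then show ?thesis by blast
  next
    assume "c < u"
    then have "NN y \<subseteq> NN ?y1" "NN ?y1 \<subseteq> NN y'"
      unfolding y'_def using flip_asc_le[OF y ce] flip_asc_le[OF y1W c1] ac by auto
    then show ?thesis by blast
  qed
  then show "Good y' a c \<Longrightarrow> Good y a c" using transfer[OF e e'] by blast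
qed

lemma hop_right:
  assumes e: "edge y a c" and i: "2 \<le> inv y a" and ce: "inv y u = inv y a - 1" and u: "u < a \<or> c < u"
  defines "y' \<equiv> swp c u \<circ> (swp a u \<circ> y)"
  shows "edge y' a c" "inv y' a = inv y a - 1" "inv y' u = inv y c"
    "b \<in> I \<Longrightarrow> b \<noteq> u \<Longrightarrow> b \<noteq> - u \<Longrightarrow> wit up (inv y') b a c \<longleftrightarrow> wit up (inv y) b a c" "Good y' a c \<Longrightarrow> Good y a c"
proof -
  let ?f = "inv y"
  have y: "y \<in> W" and ac: "consec (?f a) (?f c)" "a < c" and nz: "a \<noteq> 0" "c \<noteq> 0" and I: "a \<in> I" using edgeD[OF e] by auto
  have fc: "?f c = ?f a + 1" using consec_pos[OF ac(1)] i by simp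
  have "?f a \<in> I" using I inv_I[OF y] by simp
  then have ce': "consec (?f u) (?f a)" using ce i by (auto simp: consec_iff I_def)
  have uz: "u \<noteq> 0" using consec_nz[OF ce'] inv_zero_iff[OF y] by auto
  have dist: "a \<noteq> - c" "a \<noteq> - u" "c \<noteq> - u" by (rule pos_neq(2)[OF y], use fc ce i in simp, use fc ce i in simp)+
  let ?y1 = "swp a u \<circ> y"
  have y1: "?y1 = swp u a \<circ> y" using swp_commute[OF nz(1) uz] by simp
  have y1W: "?y1 \<in> W" unfolding y1 by (rule flip_W[OF y ce'])
  have p1: "inv ?y1 s = ?f (swp a u s)" for s using pos_flip[OF y nz(1) uz] .
  have 1: "inv ?y1 a = ?f u" "inv ?y1 u = ?f a" "inv ?y1 c = ?f c"
    using p1 dist ac u by (auto simp: swp_def)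
  have c1: "consec (inv ?y1 u) (inv ?y1 c)" using 1 ac by simp
  have y': "y' = swp u c \<circ> ?y1" unfolding y'_def using swp_commute[OF nz(2) uz] by simp
  have y'W: "y' \<in> W" unfolding y' by (rule flip_W[OF y1W c1])
  have p2: "inv y' s = inv ?y1 (swp c u s)" for s unfolding y'_def using pos_flip[OF y1W nz(2) uz] .
  have fa': "inv y' a = ?f u" and fu': "inv y' u = ?f c" and fc': "inv y' c = ?f a"
    using p2 1 dist ac u by (auto simp: swp_def)
  show "inv y' a = ?f a - 1" "inv y' u = ?f c" using fa' fu' ce by auto
  show e': "edge y' a c" unfolding edge_def using y'W ac ce' fa' fc' by simp
  show "wit up (inv y') b a c \<longleftrightarrow> wit up (inv y) b a c" if b: "b \<in> I" "b \<noteq> u" "b \<noteq> - u"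
  proof (cases "a < b \<and> b < c")
    case True
    have "inv y' b = ?f b \<or> b = - a \<and> inv y' b = - ?f u \<or> b = - c \<and> inv y' b = - ?f a"
    proof (cases "b \<in> {- a, - c}")
      case True then show ?thesis using inv_odd[OF y'W] fa' fc' by auto
    next
      case False then show ?thesis using p1[of b] p2[of b] swp_other[of b] b \<open>a < b \<and> b < c\<close> by simp
    qed
    moreover have "?f b \<noteq> ?f a" "?f b \<noteq> ?f c" "?f b \<noteq> ?f u" using inv_eq_iff[OF y] True b by auto
    ultimately have "(inv y' b < ?f u \<longleftrightarrow> ?f b < ?f a) \<and> (?f a < inv y' b \<longleftrightarrow> ?f c < ?f b)"
      using fc ce i inv_odd[OF y] by auto
    then show ?thesis
      unfolding wit_consec[OF ac(1) y b(1)] wit_consec[OF edgeD(3)[OF e'] y'W b(1)] fa' fc' by simp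
  qed (auto simp: wit_def)
  have "NN y \<subseteq> NN y' \<or> NN y' \<subseteq> NN y"
    using u
  proof
    assume "u < a"
    then have "NN y \<subseteq> NN ?y1" "NN ?y1 \<subseteq> NN y'"
      unfolding y' y1 using flip_asc_le[OF y ce'] flip_asc_le[OF y1W c1] ac unfolding y1 by auto
    then show ?thesis by blast
  next
    assume "c < u"
    then have "NN ?y1 \<subseteq> NN y" "NN y' \<subseteq> NN ?y1"
      unfolding y' y1 using flip_desc_le[OF y ce'] flip_desc_le[OF y1W c1] ac unfolding y1 by auto
    then show ?thesis by blast
  qed
  then show "Good y' a c \<Longrightarrow> Good y a c" using transfer[OF e e'] by blast
qed

end


section \<open>Carrying a letter next to the pair\<close>

context forcing begin

text \<open>This serves as the induction hypothesis for narrower pairs, with the witness held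
  fixed.\<close>

definition forced :: "int \<Rightarrow> int \<Rightarrow> bool" where
  "forced k b \<longleftrightarrow> (\<forall>y a c. edge y a c \<longrightarrow> c - a < k \<longrightarrow> wit up (inv y) b a c \<longrightarrow> Good y a c)"

lemma hexagon_right:
  assumes F: "forced (c - a) b" and e: "edge y a c" and i: "1 \<le> inv y a"
    and w: "wit up (inv y) b a c" and b: "b \<in> I" and d: "a < d" "d < c" "d \<noteq> b"
    and adj: "consec (inv y c) (inv y d) \<or> consec (inv y d) (inv y a) \<and> 2 \<le> inv y a"
  shows "Good y a c"
proof -
  have y: "y \<in> W" and ac: "consec (inv y a) (inv y c)" using edgeD[OF e] by auto
  have fc: "inv y c = inv y a + 1" using consec_pos[OF ac i] .
  have fd: "inv y d = inv y c + 1 \<or> inv y d = inv y a - 1 \<and> 2 \<le> inv y a"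
    using adj i fc by (auto simp: consec_iff)
  have "a \<noteq> - c" by (rule pos_neq(2)[OF y]) (use fc i in simp_all)
  moreover have "d \<noteq> - c" by (rule pos_neq(2)[OF y]) (use fc i fd in auto)
  moreover have "d \<noteq> - a" by (rule pos_neq(2)[OF y]) (use fc i fd in auto)
  ultimately show ?thesis
    using hexagon[OF _ e w b d] F adj unfolding forced_def by blast
qed

lemma bring_right:
  assumes F: "forced (c - a) b" and b: "b \<in> I" and d: "a < d" "d < c" "d \<noteq> b"
    and e: "edge y a c" "1 \<le> inv y a" "wit up (inv y) b a c" "inv y c < inv y d"
  shows "Good y a c"
  using e
proof (induction "nat (inv y d)" arbitrary: y rule: less_induct)
  case less
  note e = less.prems
  have y: "y \<in> W" and ac: "consec (inv y a) (inv y c)" using edgeD[OF e(1)] by auto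
  have fc: "inv y c = inv y a + 1" using consec_pos[OF ac e(2)] .
  have cI: "inv y c \<in> I" using ac by (simp add: consec_def)
  show ?case
  proof (cases "consec (inv y c) (inv y d)")
    case True
    then show ?thesis using hexagon_right[OF F e(1,2,3) b d] by blast
  next
    case False
    have "d \<noteq> 0" using inv_zero[OF y] e fc by auto
    then have "d \<in> I" using d edgeD(4,5)[OF e(1)] by (auto simp: I_def)
    then have dI: "inv y d \<in> I" using inv_I[OF y] by simp
    then have gt: "inv y c + 1 < inv y d" using False cI e(4) fc by (auto simp: consec_iff)
    have kI: "inv y d - 1 \<in> I" using dI gt fc e(2) by (auto simp: I_def)
    obtain r where r: "inv y r = inv y d - 1" using at_pos[OF y kI] by blast
    have cr: "consec (inv y r) (inv y d)" using kI dI r by (simp add: consec_iff)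
    note m = move[OF e(1,2) cr]
    have out: "\<bar>inv y r\<bar> < inv y a \<and> \<bar>inv y d\<bar> < inv y a \<or> inv y c < \<bar>inv y r\<bar> \<and> inv y c < \<bar>inv y d\<bar>"
      using gt r fc e(2) by auto
    let ?y = "swp r d \<circ> y"
    have "Good ?y a c"
    proof (rule less.hyps)
      show "nat (inv ?y d) < nat (inv y d)" using m(5)[OF out] r gt fc e(2) by auto
      show "edge ?y a c" by (rule m(1)[OF out])
      show "1 \<le> inv ?y a" using m(2)[OF out] e by simp
      show "wit up (inv ?y) b a c" using m(6)[OF out b] e by simp
      show "inv ?y c < inv ?y d" using m(3,5)[OF out] r gt by simp
    qed
    then show ?thesis by (rule m(7)[OF out])
  qed
qed

lemma bring_middle:
  assumes F: "forced (c - a) b" and b: "b \<in> I" and d: "d \<in> I" "a < d" "d < c" "d \<noteq> b"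
    and e: "edge y a c" "1 \<le> inv y a" "wit up (inv y) b a c" "\<bar>inv y d\<bar> < inv y a"
  shows "Good y a c"
  using e
proof (induction "nat (inv y a - inv y d)" arbitrary: y rule: less_induct)
  case less
  note e = less.prems
  have y: "y \<in> W" and ac: "consec (inv y a) (inv y c)" using edgeD[OF e(1)] by auto
  have aI: "inv y a \<in> I" using ac by (simp add: consec_def)
  have dI: "inv y d \<in> I" using inv_I[OF y] d by simp
  show ?case
  proof (cases "consec (inv y d) (inv y a)")
    case True
    have "2 \<le> inv y a" using e(4) dI I_nz by fastforce
    then show ?thesis using hexagon_right[OF F e(1,2,3) b d(2-4)] True by blast
  next
    case False
    then have gt: "inv y d + 1 < inv y a" using aI dI e(4) by (force simp: consec_iff)
    \<comment> \<open>The next position to the right, with the nonexistent position \<open>0\<close>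
      skipped.\<close>
    define k where "k = (if inv y d = - 1 then 1 else inv y d + 1)"
    have kI: "k \<in> I" and ck: "consec (inv y d) k" and ka: "\<bar>k\<bar> < inv y a" "inv y d < k"
      using dI aI gt e(4) n1 unfolding consec_iff by (auto simp: k_def I_def)
    obtain r where r: "inv y r = k" using at_pos[OF y kI] by blast
    have cr: "consec (inv y d) (inv y r)" using ck r by simp
    note m = move[OF e(1,2) cr]
    have out: "\<bar>inv y d\<bar> < inv y a \<and> \<bar>inv y r\<bar> < inv y a \<or> inv y c < \<bar>inv y d\<bar> \<and> inv y c < \<bar>inv y r\<bar>"
      using ka r e by auto
    let ?y = "swp d r \<circ> y"
    have "Good ?y a c"
    proof (rule less.hyps)
      show "nat (inv ?y a - inv ?y d) < nat (inv y a - inv y d)" using m(2,4)[OF out] r ka by auto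
      show "edge ?y a c" by (rule m(1)[OF out])
      show "1 \<le> inv ?y a" using m(2)[OF out] e by simp
      show "wit up (inv ?y) b a c" using m(6)[OF out b] e by simp
      show "\<bar>inv ?y d\<bar> < inv ?y a" using m(2,4)[OF out] r ka by simp
    qed
    then show ?thesis by (rule m(7)[OF out])
  qed
qed

text \<open>A letter \<open>d\<close> left of the mirror pair cannot simply be moved through it.
  Instead \<open>- d\<close>, which lies to the right of the pair, is carried to it. If
  \<open>- d\<close> is between \<open>a\<close> and \<open>c\<close> in value, it can serve as the
  third letter; otherwise it may hop over the pair, which puts \<open>d\<close> into the
  middle.\<close>

lemma bring_left:
  assumes F: "forced (c - a) b" and b: "b \<in> I" and d: "d \<in> I" "a < d" "d < c" "d \<noteq> b" "d \<noteq> - b"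
    and e: "edge y a c" "1 \<le> inv y a" "wit up (inv y) b a c" "inv y d < - inv y c"
  shows "Good y a c"
proof (cases "a < - d \<and> - d < c")
  case True
  have "inv y c < inv y (- d)" using e inv_odd[of y d] edgeD(1)[OF e(1)] by simp
  then show ?thesis using bring_right[OF F b _ _ _ e(1-3), of "- d"] True d by auto
next
  case False
  show ?thesis
    using e
  proof (induction "nat (- inv y d)" arbitrary: y rule: less_induct)
    case less
    note e = less.prems
    have y: "y \<in> W" and ac: "consec (inv y a) (inv y c)" using edgeD[OF e(1)] by auto
    have fc: "inv y c = inv y a + 1" using consec_pos[OF ac e(2)] .
    have cI: "inv y c \<in> I" using ac by (simp add: consec_def)
    have fd: "inv y (- d) = - inv y d" by (rule inv_odd[OF y])
    have "inv y d \<in> I" using inv_I[OF y] d by simp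
    moreover have t using calculation e fc I_pos by fastforce
    ultimately have dI: "- inv y d \<in> I" using I_neg by blast
    show ?case
    proof (cases "consec (inv y c) (inv y (- d))")
      case True
      then have fd': "inv y d = - inv y a - 2" using consec_pos[OF True] fc e fd by simp
      have "- d \<noteq> a" "- d \<noteq> c" using fd fd' fc by auto
      then have u: "- d < a \<or> c < - d" using False by linarith
      note h = hop_left[OF e(1,2) True u]
      let ?y = "swp a (- d) \<circ> (swp c (- d) \<circ> y)"
      have W': "?y \<in> W" using edgeD(1)[OF h(1)] .
      have "inv ?y d = - inv y a" using h(3) inv_odd[OF W', of "- d"] by simp
      then have "\<bar>inv ?y d\<bar> < inv ?y a" using h(2) e(2) by simp
      moreover have "wit up (inv ?y) b a c" using h(4)[OF b] d(4,5) e(3) by force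
      ultimately have "Good ?y a c" using bring_middle[OF F b d(1-4) h(1)] h(2) e(2) by simp
      then show ?thesis by (rule h(5))
    next
      case False
      then have gt: "inv y c + 1 < - inv y d" using cI dI e fc fd by (auto simp: consec_iff)
      have kI: "- inv y d - 1 \<in> I" using dI gt fc e(2) by (auto simp: I_def)
      obtain r where r: "inv y r = - inv y d - 1" using at_pos[OF y kI] by blast
      have cr: "consec (inv y r) (inv y (- d))" using kI dI r fd by (simp add: consec_iff)
      note m = move[OF e(1,2) cr]
      have out: "\<bar>inv y r\<bar> < inv y a \<and> \<bar>inv y (- d)\<bar> < inv y a \<or> inv y c < \<bar>inv y r\<bar> \<and> inv y c < \<bar>inv y (- d)\<bar>"
        using gt r fc fd e(2) by auto
      let ?y = "swp r (- d) \<circ> y"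
      have W': "?y \<in> W" using edgeD(1)[OF m(1)[OF out]] .
      have fd': "inv ?y d = inv y d + 1" using m(5)[OF out] inv_odd[OF W', of "- d"] r by simp
      have "Good ?y a c"
      proof (rule less.hyps)
        show "nat (- inv ?y d) < nat (- inv y d)" using fd' gt fc e(2) by auto
        show "edge ?y a c" by (rule m(1)[OF out])
        show "1 \<le> inv ?y a" using m(2)[OF out] e by simp
        show "wit up (inv ?y) b a c" using m(6)[OF out b] e by simp
        show "inv ?y d < - inv ?y c" using m(3)[OF out] fd' gt by simp
      qed
      then show ?thesis by (rule m(7)[OF out])
    qed
  qed
qed

lemma bring:
  assumes F: "forced (c - a) b" and b: "b \<in> I" and d: "d \<in> I" "a < d" "d < c" "\<bar>d\<bar> \<notin> {\<bar>a\<bar>, \<bar>b\<bar>, \<bar>c\<bar>}"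
    and e: "edge y a c" "1 \<le> inv y a" "wit up (inv y) b a c"
  shows "Good y a c"
proof -
  have y: "y \<in> W" and ac: "consec (inv y a) (inv y c)" using edgeD[OF e(1)] by auto
  have fc: "inv y c = inv y a + 1" using consec_pos[OF ac e(2)] .
  have ne: "d \<noteq> b" "d \<noteq> - b" "d \<noteq> a" "d \<noteq> - a" "d \<noteq> c" "d \<noteq> - c" using d by auto
  have "inv y d \<noteq> inv y a" "inv y d \<noteq> - inv y a" "inv y d \<noteq> inv y c" "inv y d \<noteq> - inv y c"
    using ne inv_eq_iff[OF y] by (auto simp flip: inv_odd[OF y])
  then consider "inv y c < inv y d" | "\<bar>inv y d\<bar> < inv y a" | "inv y d < - inv y c" using fc by linarith
  then show ?thesis
  proof cases
    case 1 then show ?thesis using bring_right[OF F b d(2,3) ne(1) e] by blast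
  next
    case 2 then show ?thesis using bring_middle[OF F b d(1-3) ne(1) e] by blast
  next
    case 3 then show ?thesis using bring_left[OF F b d(1-3) ne(1,2) e] by blast
  qed
qed

section \<open>Base cases from the generating pairs\<close>

lemma NN_swp: "consec p q \<Longrightarrow> NN (swp p q) = {(p, q), (- q, - p)} \<inter> I \<times> I"
  using NN_flip[OF id_W, of p q] NN_id by (auto simp: consec_def)

lemma swp_W: "consec p q \<Longrightarrow> swp p q \<in> W"
  using S_W S_iff by blast

lemma inv_swp_consec: "consec p q \<Longrightarrow> inv (swp p q) = swp p q"
  using inv_swp consec_nz by blast

lemma NN_swp_le:
  assumes "y \<in> W" "(p, q) \<in> NN y" shows "{(p, q), (- q, - p)} \<inter> I \<times> I \<subseteq> NN y"
proof -
  have "t" if "- q \<in> I" using that assms not_t_neg by (auto simp: NN_def)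
  then show ?thesis using assms NN_sym by auto
qed

text \<open>The witness says that \<open>y\<close> already inverts \<open>b\<close> with
  \<open>b + 1\<close> if \<open>b\<close> is lower, and with \<open>b - 1\<close> if it is upper.
  So \<open>y\<close> lies above the lower element of the generating pair, and joining transports
  that pair to the given edge.\<close>

lemma base_pos:
  assumes e: "edge y (b - 1) (b + 1)" and w: "wit up (inv y) b (b - 1) (b + 1)" and b: "2 \<le> b" "b \<in> I"
  shows "Good y (b - 1) (b + 1)"
proof -
  note ed = edgeD[OF e]
  have bn: "b < int n" using ed(5) b by (auto simp: I_def)
  have c1: "consec b (b + 1)" "consec (b - 1) b" using ed b by (auto simp: consec_iff)
  show ?thesis
  proof (cases "up b")
    case False
    let ?p = "swp b (b + 1)"
    have pW: "?p \<in> W" by (rule swp_W[OF c1(1)])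
    have inv: "inv ?p (b - 1) = b - 1" "inv ?p (b + 1) = b"
      unfolding inv_swp_consec[OF c1(1)] using b by (auto simp: swp_def)
    have N: "NN (swp (b - 1) (b + 1) \<circ> ?p) = NN ?p \<union> {(b - 1, b + 1), (- (b + 1), - (b - 1))} \<inter> I \<times> I"
      by (rule NN_flip[OF pW]) (use inv c1 in simp_all)
    have "(b, b + 1) \<in> NN y" using w False ed b by (auto simp: wit_def NN_def)
    then have le: "NN ?p \<subseteq> NN y" unfolding NN_swp[OF c1(1)] by (rule NN_swp_le[OF ed(1)])
    show ?thesis
      by (rule edgeT[OF e gen_low[OF b(1) bn False] le]) (use N le ed(4,5,9,11) in auto)
  next
    case True
    let ?p = "swp (b - 1) b"
    have pW: "?p \<in> W" by (rule swp_W[OF c1(2)])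
    have inv: "inv ?p (b - 1) = b" "inv ?p (b + 1) = b + 1"
      unfolding inv_swp_consec[OF c1(2)] using b by (auto simp: swp_def)
    have N: "NN (swp (b - 1) (b + 1) \<circ> ?p) = NN ?p \<union> {(b - 1, b + 1), (- (b + 1), - (b - 1))} \<inter> I \<times> I"
      by (rule NN_flip[OF pW]) (use inv c1 in simp_all)
    have "(b - 1, b) \<in> NN y" using w True ed b by (auto simp: wit_def NN_def)
    then have le: "NN ?p \<subseteq> NN y" unfolding NN_swp[OF c1(2)] by (rule NN_swp_le[OF ed(1)])
    show ?thesis
      by (rule edgeT[OF e gen_up[OF b(1) bn True] le]) (use N le ed(4,5,9,11) in auto)
  qed
qed

lemma Good_mirror: "t \<Longrightarrow> edge y a c \<Longrightarrow> Good y (- c) (- a) \<Longrightarrow> Good y a c"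
  using edge_mirror(2) by metis

lemma I_small: assumes "t" "2 \<le> n" shows "1 \<in> I" "2 \<in> I" "- 1 \<in> I" "- 2 \<in> I"
  using assms by (auto simp: I_def)

text \<open>For label 4 the generating pair spans two covers. The middle element \<open>m\<close> is
  congruent to both ends by convexity, so each of the two covers can be used separately.\<close>

lemma gen0_up_chain:
  assumes t: t and n: "2 \<le> n"
  defines "p \<equiv> swp (- 1) 1" defines "m \<equiv> swp (- 1) 2 \<circ> p" defines "q \<equiv> swp (- 2) 2 \<circ> m"
  shows "p \<in> W" "m \<in> W" "q \<in> W" "NN p = {(- 1, 1)}" "NN m = {(- 1, 1), (- 1, 2), (- 2, 1)}"
    "NN q = {(- 1, 1), (- 1, 2), (- 2, 1), (- 2, 2)}"
proof -
  note I = I_small[OF t n]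
  have c: "consec (- 1) 1" using I by (simp add: consec_iff)
  show pW: "p \<in> W" unfolding p_def by (rule swp_W[OF c])
  show Np: "NN p = {(- 1, 1)}" unfolding p_def NN_swp[OF c] using I by auto
  have ip: "inv p = swp (- 1) 1" unfolding p_def by (rule inv_swp_consec[OF c])
  have cm: "consec (inv p (- 1)) (inv p 2)" unfolding ip using I by (simp add: swp_def consec_iff)
  show mW: "m \<in> W" unfolding m_def by (rule flip_W[OF pW cm])
  show Nm: "NN m = {(- 1, 1), (- 1, 2), (- 2, 1)}"
    unfolding m_def NN_flip[OF pW cm, simplified] Np using I by auto
  have im: "inv m r = swp (- 1) 1 (swp (- 1) 2 r)" for r
    unfolding m_def using pos_flip[OF pW, of "- 1" 2 r] ip by simp
  have cq: "consec (inv m (- 2)) (inv m 2)" unfolding im using I by (simp add: swp_def consec_iff)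
  show "q \<in> W" unfolding q_def by (rule flip_W[OF mW cq])
  show "NN q = {(- 1, 1), (- 1, 2), (- 2, 1), (- 2, 2)}"
    unfolding q_def NN_flip[OF mW cq, simplified] Nm using I by auto
qed

lemma gen0_low_chain:
  assumes t: t and n: "2 \<le> n"
  defines "p \<equiv> swp 1 2" defines "m \<equiv> swp (- 2) 2 \<circ> p" defines "q \<equiv> swp (- 2) 1 \<circ> m"
  shows "p \<in> W" "m \<in> W" "q \<in> W" "NN p = {(1, 2), (- 2, - 1)}" "NN m = {(1, 2), (- 2, - 1), (- 2, 2)}"
    "NN q = {(1, 2), (- 2, - 1), (- 2, 2), (- 2, 1), (- 1, 2)}"
proof -
  note I = I_small[OF t n]
  have c: "consec 1 2" using I by (simp add: consec_iff)
  show pW: "p \<in> W" unfolding p_def by (rule swp_W[OF c])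
  show Np: "NN p = {(1, 2), (- 2, - 1)}" unfolding p_def NN_swp[OF c] using I by auto
  have ip: "inv p = swp 1 2" unfolding p_def by (rule inv_swp_consec[OF c])
  have cm: "consec (inv p (- 2)) (inv p 2)" unfolding ip using I by (simp add: swp_def consec_iff)
  show mW: "m \<in> W" unfolding m_def by (rule flip_W[OF pW cm])
  show Nm: "NN m = {(1, 2), (- 2, - 1), (- 2, 2)}"
    unfolding m_def NN_flip[OF pW cm, simplified] Np using I by auto
  have im: "inv m r = swp 1 2 (swp (- 2) 2 r)" for r
    unfolding m_def using pos_flip[OF pW, of "- 2" 2 r] ip by simp
  have cq: "consec (inv m (- 2)) (inv m 1)" unfolding im using I by (simp add: swp_def consec_iff)
  show "q \<in> W" unfolding q_def by (rule flip_W[OF mW cq])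
  show "NN q = {(1, 2), (- 2, - 1), (- 2, 2), (- 2, 1), (- 1, 2)}"
    unfolding q_def NN_flip[OF mW cq, simplified] Nm using I by auto
qed

lemma base_mixed1:
  assumes t: t and e: "edge y (- 1) 2" "1 \<le> inv y (- 1)" and w: "wit up (inv y) 1 (- 1) 2"
  shows "Good y (- 1) 2"
proof -
  note ed = edgeD[OF e(1)]
  have n: "2 \<le> n" using ed(5) by (auto simp: I_def)
  note I = I_small[OF t n]
  note ch = gen0_up_chain[OF t n]
  have f1: "inv y 1 = - inv y (- 1)" using inv_odd[OF ed(1), of 1] by simp
  have f2: "inv y 2 = inv y (- 1) + 1" using consec_pos[OF ed(3) e(2)] .
  have u: "up 1" using w f1 f2 e(2) by (auto simp: wit_def split: if_splits)
  have G: "(swp (- 1) 1, swp (- 1) 2 \<circ> swp (- 1) 1) \<in> \<Theta>"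
    by (rule Th_convex[OF gen0_up[OF t n u] ch(2)]) (use ch(4-6) in auto)
  have 1: "(- 1, 1) \<in> NN y" using I f1 e(2) by (auto simp: NN_def)
  have N: "NN (swp (- 1) 2 \<circ> y) = NN y \<union> {(- 1, 2), (- 2, 1)}" using ed(9) I by auto
  show ?thesis
    by (rule edgeT[OF e(1) G]) (use ch(4,5) 1 N ed(11) in auto)
qed

lemma base_mixed2:
  assumes t: t and e: "edge y (- 2) 1" "1 \<le> inv y (- 2)" and w: "wit up (inv y) (- 1) (- 2) 1"
  shows "Good y (- 2) 1"
proof -
  note ed = edgeD[OF e(1)]
  have n: "2 \<le> n" using ed(4) by (auto simp: I_def)
  note I = I_small[OF t n]
  note ch = gen0_low_chain[OF t n]
  have f: "inv y (- 1) = - inv y 1" "inv y (- 2) = - inv y 2" using inv_odd[OF ed(1)] by auto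
  have f1: "inv y 1 = inv y (- 2) + 1" using consec_pos[OF ed(3) e(2)] .
  have u: "\<not> up 1" using w f f1 e(2) up_neg[OF t I(1)] by (auto simp: wit_def split: if_splits)
  have 1: "(1, 2) \<in> NN y" "(- 2, - 1) \<in> NN y" "(- 2, 2) \<in> NN y" using I f f1 e(2) by (auto simp: NN_def)
  have N: "NN (swp (- 2) 1 \<circ> y) = NN y \<union> {(- 2, 1), (- 1, 2)}" using ed(9) I by auto
  show ?thesis
    by (rule edgeT[OF e(1) gen0_low[OF t n u]]) (use ch(4,6) 1 N ed(11) in auto)
qed

lemma base_central:
  assumes t: t and e: "edge y (- 2) 2" and w: "wit up (inv y) 1 (- 2) 2"
  shows "Good y (- 2) 2"
proof -
  note ed = edgeD[OF e(1)]
  have n: "2 \<le> n" using ed(5) by (auto simp: I_def)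
  note I = I_small[OF t n]
  have f: "inv y (- 1) = - inv y 1" "inv y (- 2) = - inv y 2" using inv_odd[OF ed(1)] by auto
  have N: "NN (swp (- 2) 2 \<circ> y) = NN y \<union> {(- 2, 2)}" using ed(9) I by auto
  show ?thesis
  proof (cases "up 1")
    case True
    note ch = gen0_up_chain[OF t n]
    have lt: "inv y 1 < inv y (- 2)" "inv y 1 < inv y 2" using w True by (auto simp: wit_def)
    have 1: "(- 1, 1) \<in> NN y" "(- 1, 2) \<in> NN y" "(- 2, 1) \<in> NN y" using I f lt by (auto simp: NN_def)
    show ?thesis
      by (rule edgeT[OF e(1) gen0_up[OF t n True]]) (use ch(4,6) 1 N ed(11) in auto)
  next
    case False
    note ch = gen0_low_chain[OF t n]
    have G: "(swp 1 2, swp (- 2) 2 \<circ> swp 1 2) \<in> \<Theta>"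
      by (rule Th_convex[OF gen0_low[OF t n False] ch(2)]) (use ch(4-6) in auto)
    have lt: "inv y (- 2) < inv y 1" "inv y 2 < inv y 1" using w False by (auto simp: wit_def)
    have 1: "(1, 2) \<in> NN y" "(- 2, - 1) \<in> NN y" using I f lt by (auto simp: NN_def)
    show ?thesis
      by (rule edgeT[OF e(1) G]) (use ch(4,5) 1 N ed(11) in auto)
  qed
qed

section \<open>Octagons around the centre in type B\<close>

text \<open>The octagon permutes only the letters at positions \<open>-2\<close> to
  \<open>2\<close>. With \<open>b\<close> beyond them, its placement makes it a witness for every
  pair in the octagon that encloses it in value.\<close>

lemma wit_octagon:
  assumes "a' < b" "b < c'" "if up b then inv y b \<le> - 3 else 3 \<le> inv y b" "inv p b = inv y b"
    "\<bar>inv p a'\<bar> \<le> 2" "\<bar>inv p c'\<bar> \<le> 2"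
  shows "wit up (inv p) b a' c'"
  using assms by (auto simp: wit_def split: if_splits)

lemma flip_pos:
  assumes y: "y \<in> W" and c: "consec (inv y u) (inv y v)"
  shows "swp u v \<circ> y \<in> W" "inv (swp u v \<circ> y) u = inv y v" "inv (swp u v \<circ> y) v = inv y u"
    "inv (swp u v \<circ> y) (- u) = - inv y v" "inv (swp u v \<circ> y) (- v) = - inv y u"
    "r \<notin> {u, v, - u, - v} \<Longrightarrow> inv (swp u v \<circ> y) r = inv y r"
proof -
  have nz: "u \<noteq> 0" "v \<noteq> 0" using consec_nz[OF c] inv_zero_iff[OF y] by auto
  show W': "swp u v \<circ> y \<in> W" by (rule flip_W[OF y c])
  show uv: "inv (swp u v \<circ> y) u = inv y v" "inv (swp u v \<circ> y) v = inv y u" using pos_flip[OF y nz] by auto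
  show "inv (swp u v \<circ> y) (- u) = - inv y v" "inv (swp u v \<circ> y) (- v) = - inv y u"
    using uv inv_odd[OF W'] by auto
  show "r \<notin> {u, v, - u, - v} \<Longrightarrow> inv (swp u v \<circ> y) r = inv y r"
    using pos_flip[OF y nz] swp_other by simp
qed

text \<open>The smaller in absolute value of \<open>a\<close> and \<open>c\<close> has a negative
  lying strictly between \<open>a\<close> and \<open>c\<close>. This splits the pair into two
  narrower ones, one of which encloses \<open>b\<close>; it labels a bottom or a top edge of the
  octagon and forces the given inner edge.\<close>

lemma octagon_mixed:
  assumes t: t and F: "forced (c - a) b" and b: "b \<in> I" "\<bar>b\<bar> \<noteq> \<bar>a\<bar>" "\<bar>b\<bar> \<noteq> \<bar>c\<bar>"
    and e: "edge y a c" "inv y a = 1" and w: "wit up (inv y) b a c" and ac: "a < 0" "0 < c"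
  shows "Good y a c"
proof -
  let ?f = "inv y" and ?x = "swp a c \<circ> y"
  note ed = edgeD[OF e(1)]
  note y = ed(1)
  have nz: "a \<noteq> 0" "c \<noteq> 0" "- a \<noteq> 0" "- c \<noteq> 0" using ac by auto
  have f: "?f a = 1" "?f c = 2" "?f (- a) = - 1" "?f (- c) = - 2"
    using consec_pos[OF ed(3)] e(2) inv_odd[OF y] by auto
  have ne: "a \<noteq> - c" using f by auto
  have bb: "b \<notin> {a, c, - a, - c}" using b by auto
  then have "?f b \<noteq> ?f a" "?f b \<noteq> ?f c" "?f b \<noteq> ?f (- a)" "?f b \<noteq> ?f (- c)" "?f b \<noteq> 0"
    using inv_eq_iff[OF y] inv_zero_iff[OF y] I_nz[OF b(1)] by auto
  then have fb: "if up b then ?f b \<le> - 3 else 3 \<le> ?f b" and bac: "a < b" "b < c"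
    using w f by (auto simp: wit_def split: if_splits)
  have I: "1 \<in> I" "2 \<in> I" "- 1 \<in> I" "- 2 \<in> I" "a \<in> I" "c \<in> I" "- a \<in> I" "- c \<in> I"
    using ed(3-5) f I_neg[OF t] by (auto simp: consec_def)
  have cons: "consec 1 2" "consec (- 1) 1" "consec (- 2) (- 1)" using I by (auto simp: consec_iff)
  note xp = flip_pos[OF y ed(3)]
  have x: "inv ?x a = 2" "inv ?x c = 1" "inv ?x (- a) = - 2" "inv ?x (- c) = - 1" "inv ?x b = ?f b"
    using xp f bb by auto
  note xW = ed(8)
  \<comment> \<open>The narrower pairs in the four cases are \<open>(a, - a)\<close>,
    \<open>(- a, c)\<close>, \<open>(- c, c)\<close> and \<open>(a, - c)\<close>. The first and the
    last sit at the top of the octagon, the other two at the bottom.\<close>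
  consider "- a < c" "\<bar>b\<bar> < - a" | "- a < c" "- a < b" | "c < - a" "\<bar>b\<bar> < c" | "c < - a" "b < - c"
    using b ne bac ac by linarith
  then show ?thesis
  proof cases
    case 1
    have c1: "consec (inv ?x (- c)) (inv ?x c)" using x cons by simp
    let ?x1 = "swp (- c) c \<circ> ?x"
    note p1 = flip_pos[OF xW c1]
    have x1: "inv ?x1 (- c) = 1" "inv ?x1 a = 2" "inv ?x1 b = ?f b" using p1 x bb ne ac by auto
    have c2: "consec (inv ?x1 (- c)) (inv ?x1 a)" using x1 cons by simp
    let ?q = "swp (- c) a \<circ> ?x1"
    note p2 = flip_pos[OF p1(1) c2]
    have q: "inv ?q a = 1" "inv ?q (- a) = - 1" "inv ?q b = ?f b" using p2 x1 bb ne ac by auto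
    have c3: "consec (inv ?q (- a)) (inv ?q a)" using q cons by simp
    let ?p = "swp (- a) a \<circ> ?q"
    note p3 = flip_pos[OF p2(1) c3]
    have p: "inv ?p a = - 1" "inv ?p (- a) = 1" "inv ?p b = ?f b" using p3 q bb by auto
    have ep: "edge ?p a (- a)" unfolding edge_def using p3(1) p cons ac by simp
    have "wit up (inv ?p) b a (- a)" by (rule wit_octagon[OF _ _ fb]) (use p 1 bac in auto)
    moreover have "- a - a < c - a" using 1 by simp
    ultimately have "Good ?p a (- a)" using F ep unfolding forced_def by blast
    moreover have "swp a (- a) \<circ> ?p = ?q"
      unfolding swp_commute[OF nz(3,1)] by (rule flip_flip[OF nz(1,3)])
    ultimately have G: "(?p, ?q) \<in> \<Theta>" by simp
    have "NN ?x \<subseteq> NN ?x1" by (rule flip_asc_le[OF xW c1]) (use ac in simp)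
    moreover have "NN ?x1 \<subseteq> NN ?q" by (rule flip_asc_le[OF p1(1) c2]) (use 1 in simp)
    ultimately have le: "NN ?x \<subseteq> NN ?q" by blast
    have "(a, - a) \<in> CN ?p" "(- a, c) \<in> CN ?x" using p x I 1 ac by (auto simp: CN_def NN_def)
    then have "(a, c) \<in> (CN ?p \<union> CN ?x)\<^sup>+" by (meson UnCI r_into_trancl trancl_trans)
    then show ?thesis by (rule edgeM'[OF e(1) G le])
  next
    case 2
    have c1: "consec (inv y (- a)) (inv y a)" using f cons by simp
    let ?p = "swp (- a) a \<circ> y"
    note p1 = flip_pos[OF y c1]
    have p: "inv ?p (- a) = 1" "inv ?p c = 2" "inv ?p b = ?f b" using p1 f bb ne ac by auto
    have ep: "edge ?p (- a) c" unfolding edge_def using p1(1) p cons 2 by simp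
    have "wit up (inv ?p) b (- a) c" by (rule wit_octagon[OF _ _ fb]) (use p 2 bac in auto)
    moreover have "c - (- a) < c - a" using ac by simp
    ultimately have G: "Good ?p (- a) c" using F ep unfolding forced_def by blast
    have le: "NN ?p \<subseteq> NN y" by (rule flip_desc_le[OF y c1]) (use ac in simp)
    have "(a, - a) \<in> NN y" using f I ac by (auto simp: NN_def)
    then have "(a, c) \<in> (NN y \<union> NN (swp (- a) c \<circ> ?p))\<^sup>+"
      using edgeD(10)[OF ep] by (meson UnCI r_into_trancl trancl_trans)
    then show ?thesis by (rule edgeM[OF e(1) G le])
  next
    case 3
    have c1: "consec (inv y (- a)) (inv y a)" using f cons by simp
    let ?y1 = "swp (- a) a \<circ> y"
    note p1 = flip_pos[OF y c1]
    have y1: "inv ?y1 (- a) = 1" "inv ?y1 c = 2" "inv ?y1 b = ?f b" using p1 f bb ne ac by auto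
    have c2: "consec (inv ?y1 (- a)) (inv ?y1 c)" using y1 cons by simp
    let ?p = "swp (- a) c \<circ> ?y1"
    note p2 = flip_pos[OF p1(1) c2]
    have p: "inv ?p c = 1" "inv ?p (- c) = - 1" "inv ?p b = ?f b" using p2 y1 bb by auto
    have ep: "edge ?p (- c) c" unfolding edge_def using p2(1) p cons ac by simp
    have "wit up (inv ?p) b (- c) c" by (rule wit_octagon[OF _ _ fb]) (use p 3 bac in auto)
    moreover have "c - (- c) < c - a" using 3 by simp
    ultimately have G: "Good ?p (- c) c" using F ep unfolding forced_def by blast
    have "NN ?y1 \<subseteq> NN y" by (rule flip_desc_le[OF y c1]) (use ac in simp)
    moreover have "NN ?p \<subseteq> NN ?y1" by (rule flip_desc_le[OF p1(1) c2]) (use 3 in simp)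
    ultimately have le: "NN ?p \<subseteq> NN y" by blast
    have "(a, - c) \<in> NN y" using f I 3 by (auto simp: NN_def)
    then have "(a, c) \<in> (NN y \<union> NN (swp (- c) c \<circ> ?p))\<^sup>+"
      using edgeD(10)[OF ep] by (meson UnCI r_into_trancl trancl_trans)
    then show ?thesis by (rule edgeM[OF e(1) G le])
  next
    case 4
    have c1: "consec (inv ?x (- c)) (inv ?x c)" using x cons by simp
    let ?q = "swp (- c) c \<circ> ?x"
    note p1 = flip_pos[OF xW c1]
    have q: "inv ?q (- c) = 1" "inv ?q a = 2" "inv ?q b = ?f b" using p1 x bb ne ac by auto
    have c2: "consec (inv ?q (- c)) (inv ?q a)" using q cons by simp
    let ?p = "swp (- c) a \<circ> ?q"
    note p2 = flip_pos[OF p1(1) c2]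
    have p: "inv ?p a = 1" "inv ?p (- c) = 2" "inv ?p b = ?f b" using p2 q bb by auto
    have ep: "edge ?p a (- c)" unfolding edge_def using p2(1) p cons 4 by simp
    have "wit up (inv ?p) b a (- c)" by (rule wit_octagon[OF _ _ fb]) (use p 4 bac in auto)
    moreover have "- c - a < c - a" using ac by simp
    ultimately have "Good ?p a (- c)" using F ep unfolding forced_def by blast
    moreover have "swp a (- c) \<circ> ?p = ?q"
      unfolding swp_commute[OF nz(4,1)] by (rule flip_flip[OF nz(1,4)])
    ultimately have G: "(?p, ?q) \<in> \<Theta>" by simp
    have le: "NN ?x \<subseteq> NN ?q" by (rule flip_asc_le[OF xW c1]) (use ac in simp)
    have "(a, - c) \<in> CN ?p" "(- c, c) \<in> CN ?x" using p x I 4 ac by (auto simp: CN_def NN_def)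
    then have "(a, c) \<in> (CN ?p \<union> CN ?x)\<^sup>+" by (meson UnCI r_into_trancl trancl_trans)
    then show ?thesis by (rule edgeM'[OF e(1) G le])
  qed
qed

text \<open>Here \<open>d\<close> and \<open>- d\<close> divide the interval from \<open>- c\<close>
  to \<open>c\<close>. The narrower pair is the one between \<open>d\<close> and \<open>- d\<close>
  if it encloses \<open>b\<close>, and otherwise an outer one, \<open>(- c, - d)\<close> or
  \<open>(- d, c)\<close>. For an outer pair the witness may have to be replaced by its negative, so
  the hypothesis is needed for all witnesses.\<close>

lemma octagon_central:
  assumes t: t and F: "\<And>b. b \<in> I \<Longrightarrow> forced (c + c) b" and b: "b \<in> I" "\<bar>b\<bar> \<noteq> \<bar>d\<bar>" "\<bar>d\<bar> < c"
    and e: "edge y (- c) c" "inv y c = 1" "inv y d = 2" and w: "wit up (inv y) b (- c) c"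
  shows "Good y (- c) c"
proof -
  let ?f = "inv y" and ?x = "swp (- c) c \<circ> y"
  note ed = edgeD[OF e(1)]
  note y = ed(1)
  have f: "?f c = 1" "?f d = 2" "?f (- c) = - 1" "?f (- d) = - 2"
    using e inv_odd[OF y] by auto
  have c0: "0 < c" using ed(2) by simp
  have d0: "d \<noteq> 0" using f inv_zero[OF y] by auto
  have dne: "d \<noteq> c" "d \<noteq> - c" "- c \<noteq> d" "- d \<noteq> c" "c \<noteq> d" "c \<noteq> - d" using b(3) by linarith+
  have nz: "c \<noteq> 0" "d \<noteq> 0" "- c \<noteq> 0" "- d \<noteq> 0" using c0 d0 by auto
  have I: "1 \<in> I" "- 1 \<in> I" "c \<in> I" "- c \<in> I"
    using ed(3-5) f I_neg[OF t] by (auto simp: consec_def)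
  have "d \<in> I" using b(3) d0 I(3) t by (auto simp: I_def)
  then have dI: "d \<in> I" "- d \<in> I" using I_neg[OF t] by auto
  have I2: "2 \<in> I" "- 2 \<in> I" using inv_I[OF y] dI f by metis+
  have cons: "consec 1 2" "consec (- 1) 1" "consec (- 2) (- 1)" using I I2 by (auto simp: consec_iff)
  have wits: "b' \<notin> {c, d, - c, - d} \<and> - c < b' \<and> b' < c \<and> b' \<in> I \<and> (if up b' then ?f b' \<le> - 3 else 3 \<le> ?f b')"
    if b': "b' = b \<or> b' = - b" for b'
  proof -
    have w': "wit up ?f b' (- c) c" and b'I: "b' \<in> I"
      using b' w wit_mirror[OF y t b(1) w] I_neg[OF t b(1)] b(1) by auto
    then have lt: "- c < b'" "b' < c" by (auto simp: wit_def)
    moreover have ni: "b' \<notin> {c, d, - c, - d}" using lt b b' by auto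
    then have "?f b' \<noteq> ?f c" "?f b' \<noteq> ?f d" "?f b' \<noteq> ?f (- c)" "?f b' \<noteq> ?f (- d)" "?f b' \<noteq> 0"
      using inv_eq_iff[OF y] inv_zero_iff[OF y] I_nz[OF b'I] by auto
    then have "if up b' then ?f b' \<le> - 3 else 3 \<le> ?f b'"
      using w' f by (auto simp: wit_def split: if_splits)
    ultimately show ?thesis using b'I ni by blast
  qed
  note xp = flip_pos[OF y ed(3)]
  note xW = ed(8)
  have x: "inv ?x c = - 1" "inv ?x (- c) = 1" "inv ?x d = 2" "inv ?x (- d) = - 2"
  proof -
    show "inv ?x d = 2" "inv ?x (- d) = - 2" "inv ?x c = - 1" "inv ?x (- c) = 1"
      using xp(2,3) f xp(6)[of d] xp(6)[of "- d"] dne by auto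
  qed
  have xb: "inv ?x b' = ?f b'" if "b' \<notin> {c, d, - c, - d}" for b' using xp(6) that by auto
  consider "0 < d" "\<bar>b\<bar> < d" | "0 < d" "d < \<bar>b\<bar>" | "d < 0" "- d < \<bar>b\<bar>" | "d < 0" "\<bar>b\<bar> < - d"
    using b d0 by linarith
  then show ?thesis
  proof cases
    case 1
    have c1: "consec (inv y c) (inv y d)" using f cons by simp
    let ?p = "swp c d \<circ> y"
    note p1 = flip_pos[OF y c1]
    have p: "inv ?p d = 1" "inv ?p (- d) = - 1" "inv ?p b = ?f b" using p1 f wits[of b] by auto
    have ep: "edge ?p (- d) d" unfolding edge_def using p1(1) p cons 1 by simp
    have "wit up (inv ?p) b (- d) d" by (rule wit_octagon[of _ _ _ y]) (use p 1 wits[of b] in auto)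
    moreover have "d - (- d) < c + c" using 1 b by simp
    ultimately have G: "Good ?p (- d) d" using F[OF b(1)] ep unfolding forced_def by blast
    have le: "NN ?p \<subseteq> NN y" by (rule flip_desc_le[OF y c1]) (use b in simp)
    have "(- c, - d) \<in> NN y" "(d, c) \<in> NN y" using f I dI b by (auto simp: NN_def)
    then have "(- c, c) \<in> (NN y \<union> NN (swp (- d) d \<circ> ?p))\<^sup>+"
      using edgeD(10)[OF ep] by (meson UnCI r_into_trancl trancl_trans)
    then show ?thesis by (rule edgeM[OF e(1) G le])
  next
    case 2
    \<comment> \<open>The sign is chosen so that the witness falls between \<open>- c\<close> and
      \<open>- d\<close>.\<close>
    define b' where "b' = - \<bar>b\<bar>"
    have b': "b' = b \<or> b' = - b" by (auto simp: b'_def)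
    note wb = wits[OF b']
    have c1: "consec (inv ?x (- c)) (inv ?x d)" using x cons by simp
    let ?x1 = "swp (- c) d \<circ> ?x"
    note p1 = flip_pos[OF xW c1]
    have x1: "inv ?x1 d = 1" "inv ?x1 (- d) = - 1" "inv ?x1 (- c) = 2" "inv ?x1 b' = ?f b'"
      using p1 x wb xb[of b'] by auto
    have c2: "consec (inv ?x1 (- d)) (inv ?x1 d)" using x1 cons by simp
    let ?q = "swp (- d) d \<circ> ?x1"
    note p2 = flip_pos[OF p1(1) c2]
    have q: "inv ?q (- d) = 1" "inv ?q (- c) = 2" "inv ?q b' = ?f b'" using p2 x1 wb dne by auto
    have c3: "consec (inv ?q (- d)) (inv ?q (- c))" using q cons by simp
    let ?p = "swp (- d) (- c) \<circ> ?q"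
    note p3 = flip_pos[OF p2(1) c3]
    have p: "inv ?p (- c) = 1" "inv ?p (- d) = 2" "inv ?p b' = ?f b'" "inv ?p c = - 1" "inv ?p d = - 2"
      using p3 q wb by auto
    have ep: "edge ?p (- c) (- d)" unfolding edge_def using p3(1) p cons b by simp
    have "wit up (inv ?p) b' (- c) (- d)"
      by (rule wit_octagon[of _ _ _ y]) (use p 2 wb b'_def in auto)
    moreover have "- d - (- c) < c + c" using 2 c0 by simp
    ultimately have "Good ?p (- c) (- d)" using F[of b'] wb ep unfolding forced_def by blast
    moreover have "swp (- c) (- d) \<circ> ?p = ?q"
      unfolding swp_commute[OF nz(4,3)] by (rule flip_flip[OF nz(3,4)])
    ultimately have G: "(?p, ?q) \<in> \<Theta>" by simp
    have "NN ?x \<subseteq> NN ?x1" by (rule flip_asc_le[OF xW c1]) (use b in simp)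
    moreover have "NN ?x1 \<subseteq> NN ?q" by (rule flip_asc_le[OF p1(1) c2]) (use 2 in simp)
    ultimately have le: "NN ?x \<subseteq> NN ?q" by blast
    have "(- c, - d) \<in> CN ?p" "(d, c) \<in> CN ?p" "(- d, d) \<in> CN ?x"
      using p x I dI b 2 by (auto simp: CN_def NN_def)
    then have "(- c, c) \<in> (CN ?p \<union> CN ?x)\<^sup>+" by (meson UnCI r_into_trancl trancl_trans)
    then show ?thesis by (rule edgeM'[OF e(1) G le])
  next
    case 3
    \<comment> \<open>Here the outer pair is \<open>(- d, c)\<close>, so the positive sign is the
      right one.\<close>
    define b' where "b' = \<bar>b\<bar>"
    have b': "b' = b \<or> b' = - b" by (auto simp: b'_def)
    note wb = wits[OF b']
    have c1: "consec (inv y c) (inv y d)" using f cons by simp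
    let ?y1 = "swp c d \<circ> y"
    note p1 = flip_pos[OF y c1]
    have y1: "inv ?y1 d = 1" "inv ?y1 (- d) = - 1" "inv ?y1 c = 2" "inv ?y1 b' = ?f b'" using p1 f wb by auto
    have c2: "consec (inv ?y1 (- d)) (inv ?y1 d)" using y1 cons by simp
    let ?p = "swp (- d) d \<circ> ?y1"
    note p2 = flip_pos[OF p1(1) c2]
    have p: "inv ?p (- d) = 1" "inv ?p c = 2" "inv ?p b' = ?f b'" using p2 y1 wb dne by auto
    have ep: "edge ?p (- d) c" unfolding edge_def using p2(1) p cons b by simp
    have "wit up (inv ?p) b' (- d) c" by (rule wit_octagon[of _ _ _ y]) (use p 3 wb b'_def in auto)
    moreover have "c - (- d) < c + c" using 3 c0 by simp
    ultimately have G: "Good ?p (- d) c" using F[of b'] wb ep unfolding forced_def by blast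
    have "NN ?y1 \<subseteq> NN y" by (rule flip_desc_le[OF y c1]) (use b in simp)
    moreover have "NN ?p \<subseteq> NN ?y1" by (rule flip_desc_le[OF p1(1) c2]) (use 3 in simp)
    ultimately have le: "NN ?p \<subseteq> NN y" by blast
    have 1: "(- d, c) \<in> NN (swp (- d) c \<circ> ?p)" by (rule edgeD(10)[OF ep])
    have "(- c, d) \<in> NN (swp (- d) c \<circ> ?p)" using NN_sym[OF edgeD(8)[OF ep] 1 t] by simp
    moreover have "(d, - d) \<in> NN y" using f dI 3 by (auto simp: NN_def)
    ultimately have "(- c, c) \<in> (NN y \<union> NN (swp (- d) c \<circ> ?p))\<^sup>+"
      using 1 by (meson UnCI r_into_trancl trancl_trans)
    then show ?thesis by (rule edgeM[OF e(1) G le])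
  next
    case 4
    have c1: "consec (inv ?x (- c)) (inv ?x d)" using x cons by simp
    let ?q = "swp (- c) d \<circ> ?x"
    note p1 = flip_pos[OF xW c1]
    have q: "inv ?q d = 1" "inv ?q (- d) = - 1" "inv ?q b = ?f b" using p1 x wits[of b] xb[of b] by auto
    have c2: "consec (inv ?q (- d)) (inv ?q d)" using q cons by simp
    let ?p = "swp (- d) d \<circ> ?q"
    note p2 = flip_pos[OF p1(1) c2]
    have p: "inv ?p d = - 1" "inv ?p (- d) = 1" "inv ?p b = ?f b" using p2 q wits[of b] by auto
    have ep: "edge ?p d (- d)" unfolding edge_def using p2(1) p cons 4 by simp
    have "wit up (inv ?p) b d (- d)" by (rule wit_octagon[of _ _ _ y]) (use p 4 wits[of b] in auto)
    moreover have "- d - d < c + c" using 4 b by simp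
    ultimately have "Good ?p d (- d)" using F[OF b(1)] ep unfolding forced_def by blast
    moreover have "swp d (- d) \<circ> ?p = ?q"
      unfolding swp_commute[OF nz(4,2)] by (rule flip_flip[OF nz(2,4)])
    ultimately have G: "(?p, ?q) \<in> \<Theta>" by simp
    have le: "NN ?x \<subseteq> NN ?q" by (rule flip_asc_le[OF xW c1]) (use b in simp)
    have "(d, - d) \<in> CN ?p" "(- d, c) \<in> CN ?x" "(- c, d) \<in> CN ?x"
      using p x I dI b 4 by (auto simp: CN_def NN_def)
    then have "(- c, c) \<in> (CN ?p \<union> CN ?x)\<^sup>+" by (meson UnCI r_into_trancl trancl_trans)
    then show ?thesis by (rule edgeM'[OF e(1) G le])
  qed
qed

lemma bring_central:
  assumes t: t and F: "\<And>b. b \<in> I \<Longrightarrow> forced (c + c) b" and b: "b \<in> I" "\<bar>b\<bar> \<noteq> \<bar>d\<bar>" "\<bar>d\<bar> < c"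
    and e: "edge y (- c) c" "inv y c = 1" "2 \<le> inv y d" "wit up (inv y) b (- c) c"
  shows "Good y (- c) c"
  using e
proof (induction "nat (inv y d)" arbitrary: y rule: less_induct)
  case less
  note e = less.prems
  note ed = edgeD[OF e(1)]
  note y = ed(1)
  show ?case
  proof (cases "inv y d = 2")
    case True
    then show ?thesis using octagon_central[OF t F b e(1,2)] e(4) by blast
  next
    case False
    have "d \<noteq> 0" using e(3) inv_zero[OF y] by auto
    then have "d \<in> I" using b(3) ed(5) t by (auto simp: I_def)
    then have kI: "inv y d \<in> I" "inv y d - 1 \<in> I" using inv_I[OF y, of d] False e(3) by (auto simp: I_def)
    obtain r where r: "inv y r = inv y d - 1" using at_pos[OF y kI(2)] by blast
    have cr: "consec (inv y r) (inv y d)" using kI r by (simp add: consec_iff)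
    let ?y = "swp r d \<circ> y"
    note p = flip_pos[OF y cr]
    have dist: "c \<notin> {r, d, - r, - d}" using e False r inv_odd[OF y, of r] inv_odd[OF y, of d] by auto
    have fc: "inv ?y c = 1" "inv ?y (- c) = - 1" using p(6)[OF dist] e(2) inv_odd[OF p(1)] by auto
    have fc': "inv y (- c) = - 1" using e(2) inv_odd[OF y] by simp
    have e': "edge ?y (- c) c" unfolding edge_def using p(1) fc ed(2,3) fc' e(2) by simp
    have "inv ?y b = inv y b \<or> 2 \<le> inv y b \<and> 2 \<le> inv ?y b \<or> inv y b \<le> - 2 \<and> inv ?y b \<le> - 2"
    proof (cases "b \<in> {r, d, - r, - d}")
      case True
      then show ?thesis using p(2-5) r e(3) False inv_odd[OF y, of r] inv_odd[OF y, of d]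
        by (elim insertE emptyE) simp_all
    qed (use p(6) in simp)
    then have w': "wit up (inv ?y) b (- c) c" using e(4) fc fc' e(2) by (auto simp: wit_def split: if_splits)
    have "Good ?y (- c) c"
      by (rule less.hyps[OF _ e' fc(1) _ w']) (use p(3) r e(3) False in auto)
    moreover have "NN y \<subseteq> NN ?y \<or> NN ?y \<subseteq> NN y"
    proof (cases "r < d")
      case True then show ?thesis using flip_asc_le[OF y cr] by blast
    next
      case False
      have "r \<noteq> d" using cr by (auto simp: consec_def)
      then show ?thesis using False flip_desc_le[OF y cr] by simp
    qed
    ultimately show ?thesis using transfer[OF e(1) e'] by blast
  qed
qed

lemma forced_central:
  assumes F: "\<And>b. b \<in> I \<Longrightarrow> forced (c + c) b" and b: "b \<in> I" and e: "edge y (- c) c" "wit up (inv y) b (- c) c"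
  shows "Good y (- c) c"
proof -
  note ed = edgeD[OF e(1)]
  note y = ed(1)
  have t: t using not_t_neg[OF _ ed(5)] ed(4) by blast
  have c: "0 < c" using ed(2) by simp
  have "inv y (- c) = - inv y c" by (rule inv_odd[OF y])
  then have fc: "inv y c = 1" using ed(3) by (auto simp: consec_iff)
  show ?thesis
  proof (cases "\<exists>d. d \<noteq> 0 \<and> \<bar>d\<bar> < c \<and> \<bar>b\<bar> \<noteq> \<bar>d\<bar>")
    case True
    then obtain d where d: "d \<noteq> 0" "\<bar>d\<bar> < c" "\<bar>b\<bar> \<noteq> \<bar>d\<bar>" by blast
    have "inv y d \<noteq> inv y c" "inv y d \<noteq> inv y (- c)" "inv y d \<noteq> 0"
      using d inv_eq_iff[OF y] inv_zero_iff[OF y] by auto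
    then have "2 \<le> inv y d \<or> 2 \<le> inv y (- d)" using fc inv_odd[OF y] by auto
    then show ?thesis
      using bring_central[OF t F b, of d] bring_central[OF t F b, of "- d"] d e fc by auto
  next
    case False
    \<comment> \<open>Without such a \<open>d\<close> only \<open>b\<close> and \<open>- b\<close>
      lie between \<open>- c\<close> and \<open>c\<close>, which forces \<open>c = 2\<close> and
      \<open>b\<close> to be \<open>1\<close> or \<open>-1\<close>: the generating pair of label
      4.\<close>
    have bc: "- c < b" "b < c" "b \<noteq> 0" using e(2) I_nz[OF b] by (auto simp: wit_def)
    have "\<bar>b\<bar> = 1" using False[simplified, rule_format, of 1] bc by auto
    moreover have "\<not> 2 < c" using False[simplified, rule_format, of 2] calculation by auto
    then have "c = 2" using bc calculation by linarith
    moreover have "wit up (inv y) (- b) (- c) c" using wit_mirror[OF y t b e(2)] by simp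
    moreover have "b = 1 \<or> - b = 1" using calculation(1) by linarith
    ultimately show ?thesis using base_central[OF t, of y] e by auto
  qed
qed

text \<open>For \<open>a < 0 < c\<close> the letters between the pair and its mirror image are moved out, which leaves
  an octagon.\<close>
lemma clear_middle:
  assumes t: t and F: "forced (c - a) b" and b: "b \<in> I" and ac: "a < 0" "0 < c"
    and few: "\<And>d. d \<in> I \<Longrightarrow> a < d \<Longrightarrow> d < c \<Longrightarrow> \<bar>d\<bar> \<in> {\<bar>a\<bar>, \<bar>b\<bar>, \<bar>c\<bar>}"
    and oct: "\<And>y. edge y a c \<Longrightarrow> inv y a = 1 \<Longrightarrow> wit up (inv y) b a c \<Longrightarrow> Good y a c"
    and e: "edge y a c" "1 \<le> inv y a" "wit up (inv y) b a c"
  shows "Good y a c"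
  using e
proof (induction "nat (inv y a)" arbitrary: y rule: less_induct)
  case less
  note e = less.prems
  note ed = edgeD[OF e(1)]
  note y = ed(1)
  have fc: "inv y c = inv y a + 1" using consec_pos[OF ed(3) e(2)] .
  have aI: "inv y a \<in> I" using ed(3) by (simp add: consec_def)
  have outside: "u < a \<or> c < u" if "u \<in> I" "\<bar>inv y u\<bar> < inv y a" "\<bar>u\<bar> \<noteq> \<bar>b\<bar>" for u
  proof -
    have "inv y u \<noteq> inv y a" "inv y u \<noteq> - inv y a" "inv y u \<noteq> inv y c" "inv y u \<noteq> - inv y c" using that fc by auto
    then have "u \<noteq> a" "u \<noteq> - a" "u \<noteq> c" "u \<noteq> - c" using inv_odd[OF y] by auto
    then have "\<bar>u\<bar> \<notin> {\<bar>a\<bar>, \<bar>b\<bar>, \<bar>c\<bar>}" using that by auto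
    then show ?thesis using few[OF that(1)] \<open>u \<noteq> a\<close> \<open>u \<noteq> c\<close> by force
  qed
  show ?case
  proof (cases "inv y a = 1")
    case True
    then show ?thesis using oct e by blast
  next
    case False
    then have i: "2 \<le> inv y a" using e by simp
    have kI: "inv y a - 1 \<in> I" using aI i by (auto simp: I_def)
    obtain u where u: "u \<in> I" "inv y u = inv y a - 1" using at_pos[OF y kI] by blast
    have step: "Good y' a c" if e': "edge y' a c" "inv y' a = inv y a" "wit up (inv y') b a c"
      and v: "inv y' v = inv y a - 1" "v < a \<or> c < v" "\<bar>v\<bar> \<noteq> \<bar>b\<bar>" for y' v
    proof -
      have h: "2 \<le> inv y' a" "inv y' v = inv y' a - 1" using e' v i by auto
      note h = hop_right[OF e'(1) h v(2)]
      have "Good (swp c v \<circ> (swp a v \<circ> y')) a c"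
        by (rule less.hyps[OF _ h(1)]) (use h(2) h(4)[OF b] e' v(3) i in auto)
      then show ?thesis by (rule h(5))
    qed
    show ?thesis
    proof (cases "\<bar>u\<bar> = \<bar>b\<bar>")
      case False
      then show ?thesis using step[OF e(1) refl e(3) u(2)] outside[OF u(1)] u(2) i by auto
    next
      case ub: True
      \<comment> \<open>The witness or its negative blocks the way, and \<open>hop_right\<close>
        does not preserve it. If \<open>- b\<close> is also between \<open>a\<close> and
        \<open>c\<close>, it serves as the third letter; otherwise the blocking letter is dealt with
        below.\<close>
      then have ub': "u = b \<or> u = - b" by auto
      then have fb: "inv y b = inv y a - 1 \<or> inv y b = 1 - inv y a" using u inv_odd[OF y, of b] by auto
      have mb: "\<bar>inv y (- b)\<bar> < inv y a" "inv y (- b) = - inv y b" using fb inv_odd[OF y, of b] i by auto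
      show ?thesis
      proof (cases "a < - b \<and> - b < c")
        case True
        then show ?thesis
          using bring_middle[OF F b I_neg[OF t b] _ _ _ e mb(1)] I_nz[OF b] by auto
      next
        case out: False
        \<comment> \<open>Being placed before both letters of the pair, \<open>b\<close> can only be
          an upper witness.\<close>
        have bw: "a < b" "b < c" "up b" using e(3) fb fc i by (auto simp: wit_def split: if_splits)
        have bne: "- b \<noteq> a" "- b \<noteq> c"
          by (rule pos_neq(1)[OF y], use mb fb fc i in linarith, use mb fb fc i in linarith)+
        then have out': "- b < a \<or> c < - b" using out by linarith
        show ?thesis
        proof (cases "inv y a = 2")
          case two: True
          have flip: "Good y' a c" if e': "edge y' a c" "inv y' a = 2" "inv y' (- b) = 1" for y'
          proof -
            have h: "2 \<le> inv y' a" "inv y' (- b) = inv y' a - 1" using e' by auto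
            note h = hop_right[OF e'(1) h out']
            let ?z = "swp c (- b) \<circ> (swp a (- b) \<circ> y')"
            have zW: "?z \<in> W" using edgeD(1)[OF h(1)] .
            have fa: "inv ?z a = 1" using h(2) e' by simp
            have "inv y' c = 3" using consec_pos[OF edgeD(3)[OF e'(1)]] e' by simp
            \<comment> \<open>After \<open>- b\<close> has hopped over the pair, \<open>b\<close>
              sits at position \<open>-3\<close>, still before the pair; being upper, it is again a
              witness.\<close>
            then have "inv ?z b = - 3" using h(3) inv_odd[OF zW, of b] by simp
            moreover have "inv ?z c = 2" using consec_pos[OF edgeD(3)[OF h(1)]] fa by simp
            ultimately have "wit up (inv ?z) b a c" using bw fa by (simp add: wit_def)
            then have "Good ?z a c" using oct[OF h(1) fa] by blast
            then show ?thesis by (rule h(5))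
          qed
          show ?thesis
          proof (cases "u = - b")
            case True
            then show ?thesis using flip[OF e(1) two] u two by simp
          next
            case False
            then have "inv y b = 1" "inv y (- b) = - 1" using ub' u two mb by auto
            moreover have "1 \<in> I" "- 1 \<in> I" using n1 t by (auto simp: I_def)
            ultimately have cr: "consec (inv y (- b)) (inv y b)" by (simp add: consec_iff)
            note m = move[OF e(1,2) cr]
            have out2: "\<bar>inv y (- b)\<bar> < inv y a \<and> \<bar>inv y b\<bar> < inv y a \<or> inv y c < \<bar>inv y (- b)\<bar> \<and> inv y c < \<bar>inv y b\<bar>"
              using \<open>inv y b = 1\<close> \<open>inv y (- b) = - 1\<close> two by simp
            have "Good (swp (- b) b \<circ> y) a c"
              by (rule flip[OF m(1)[OF out2]]) (use m(2,4)[OF out2] two \<open>inv y b = 1\<close> in auto)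
            then show ?thesis by (rule m(7)[OF out2])
          qed
        next
          case False
          then have kI': "inv y a - 2 \<in> I" using aI i by (auto simp: I_def)
          \<comment> \<open>There is a further letter \<open>v\<close> behind the blocking one. The
            two are exchanged, and \<open>v\<close>, which differs from \<open>b\<close> and
            \<open>- b\<close>, hops over the pair.\<close>
          obtain v where v: "v \<in> I" "inv y v = inv y a - 2" using at_pos[OF y kI'] by blast
          have cr: "consec (inv y v) (inv y u)" using kI kI' u v by (simp add: consec_iff)
          note m = move[OF e(1,2) cr]
          have out2: "\<bar>inv y v\<bar> < inv y a \<and> \<bar>inv y u\<bar> < inv y a \<or> inv y c < \<bar>inv y v\<bar> \<and> inv y c < \<bar>inv y u\<bar>"
            using u v i False by auto
          have "inv y v \<noteq> inv y u" "inv y v \<noteq> - inv y u" using u v i False by auto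
          then have "v \<noteq> u" "v \<noteq> - u" using pos_neq[OF y] by blast+
          then have vb: "\<bar>v\<bar> \<noteq> \<bar>b\<bar>" using ub by linarith
          have "Good (swp v u \<circ> y) a c"
            by (rule step[OF m(1,2)[OF out2], of v])
              (use m(4)[OF out2] m(6)[OF out2 b] u v vb e(3) outside[OF v(1)] i False in auto)
          then show ?thesis by (rule m(7)[OF out2])
        qed
      qed
    qed
  qed
qed

text \<open>Either a letter between \<open>a\<close> and \<open>c\<close> can be carried to the
  pair, or the interval is so short that the edge comes from a generating pair or, when
  \<open>a\<close> and \<open>c\<close> have different signs, from an octagon.\<close>

lemma forced_right:
  assumes F: "forced (c - a) b" and b: "b \<in> I" and e: "edge y a c" "1 \<le> inv y a" "wit up (inv y) b a c"
  shows "Good y a c"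
proof (cases "\<exists>d \<in> I. a < d \<and> d < c \<and> \<bar>d\<bar> \<notin> {\<bar>a\<bar>, \<bar>b\<bar>, \<bar>c\<bar>}")
  case True
  then show ?thesis using bring[OF F b _ _ _ _ e] by blast
next
  case False
  then have few: "\<And>d. d \<in> I \<Longrightarrow> a < d \<Longrightarrow> d < c \<Longrightarrow> \<bar>d\<bar> \<in> {\<bar>a\<bar>, \<bar>b\<bar>, \<bar>c\<bar>}" by blast
  note ed = edgeD[OF e(1)]
  note y = ed(1)
  have bac: "a < b" "b < c" using e(3) by (auto simp: wit_def)
  consider "0 < a" | "c < 0" | "a < 0" "0 < c" using ed(6,7) by linarith
  then show ?thesis
  proof cases
    case 1
    have "a + 1 \<in> I" "c - 1 \<in> I" using 1 bac ed(4,5) by (auto simp: I_def)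
    then have "a + 1 = b" "c - 1 = b" using few[of "a + 1"] few[of "c - 1"] 1 bac by auto
    then have "a = b - 1" "c = b + 1" by auto
    then show ?thesis using base_pos[of y b] e b 1 by simp
  next
    case 2
    then have t: t using I_pos ed(5) by fastforce
    have "a + 1 \<in> I" "c - 1 \<in> I" using 2 bac ed(4,5) t by (auto simp: I_def)
    then have "a + 1 = b" "c - 1 = b" using few[of "a + 1"] few[of "c - 1"] 2 bac by auto
    then have "- c = - b - 1" "- a = - b + 1" by auto
    then have "Good y (- c) (- a)"
      using base_pos[of y "- b"] edge_mirror(1)[OF t e(1)] wit_mirror[OF y t b e(3)] I_neg[OF t b] 2 bac by simp
    then show ?thesis by (rule Good_mirror[OF t e(1)])
  next
    case 3
    then have t: t using I_pos ed(4) by fastforce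
    have oct: "Good y a c" if e: "edge y a c" "inv y a = 1" "wit up (inv y) b a c" for y
    proof (cases "\<bar>b\<bar> = \<bar>a\<bar> \<or> \<bar>b\<bar> = \<bar>c\<bar>")
      case False
      then show ?thesis using octagon_mixed[OF t F b _ _ e 3] by blast
    next
      case True
      have n1I: "1 \<in> I" "- 1 \<in> I" using n1 t by (auto simp: I_def)
      have small: "\<bar>d\<bar> \<in> {\<bar>a\<bar>, \<bar>c\<bar>}" if "d \<in> I" "a < d" "d < c" for d using few[OF that] True by auto
      have y: "y \<in> W" using edgeD[OF e(1)] by blast
      have "inv y c = 2" using consec_pos[OF edgeD(3)[OF e(1)]] e by simp
      then have "a \<noteq> - c" using inv_odd[OF y, of c] e(2) by auto
      have bI: "b \<noteq> 0" using I_nz b by blast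
      have I2: "2 \<in> I" if "3 \<le> c" using that edgeD(5)[OF e(1)] by (auto simp: I_def)
      have I2': "- 2 \<in> I" if "a \<le> - 3" using that edgeD(4)[OF e(1)] by (auto simp: I_def)
      have "(a = - 1 \<and> c = 2) \<or> (a = - 2 \<and> c = 1)"
      proof (cases "c = 1")
        case True
        have "\<not> a \<le> - 3" using small[OF I2'] True by auto
        then show ?thesis using True 3 \<open>a \<noteq> - c\<close> by auto
      next
        case False
        then have "a = - 1" using small[OF n1I(1)] 3 by auto
        moreover have "\<not> 3 \<le> c" using small[OF I2] calculation by auto
        ultimately show ?thesis using 3 False by auto
      qed
      then show ?thesis
      proof
        assume a: "a = - 1 \<and> c = 2"
        then have "b = 1" using bac bI by linarith
        then show ?thesis using base_mixed1[OF t, of y] e a by simp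
      next
        assume a: "a = - 2 \<and> c = 1"
        then have "b = - 1" using bac bI by linarith
        then show ?thesis using base_mixed2[OF t, of y] e a by simp
      qed
    qed
    show ?thesis by (rule clear_middle[OF t F b 3 few oct e])
  qed
qed

text \<open>The induction runs over the width \<open>c - a\<close>. A pair at negative positions is
  replaced by its mirror image with the negated witness; a pair at positions \<open>-1\<close> and
  \<open>1\<close> has the form \<open>(- c, c)\<close> and is treated separately.\<close>

theorem contracted_in_cong:
  assumes "edge y a c" "b \<in> I" "wit up (inv y) b a c" shows "Good y a c"
proof -
  have "\<forall>y a c b. c - a < int k \<longrightarrow> b \<in> I \<longrightarrow> edge y a c \<longrightarrow> wit up (inv y) b a c \<longrightarrow> Good y a c" for k
  proof (induction k)
    case 0
    then show ?case using edgeD(2) by force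
  next
    case (Suc k)
    show ?case
    proof (intro allI impI)
      fix y a c b assume k: "c - a < int (Suc k)" and b: "b \<in> I" and e: "edge y a c" and w: "wit up (inv y) b a c"
      note ed = edgeD[OF e]
      note y = ed(1)
      have F': "forced (c - a) b'" if "b' \<in> I" for b' unfolding forced_def
      proof (intro allI impI)
        fix y' a' c' assume *: "edge y' a' c'" "c' - a' < c - a" "wit up (inv y') b' a' c'"
        then have "c' - a' < int k" using k by simp
        then show "Good y' a' c'" using Suc.IH that * by blast
      qed
      have "inv y c = inv y a + 1 \<or> inv y a = - 1 \<and> inv y c = 1" using ed(3) by (simp add: consec_iff)
      then consider "1 \<le> inv y a" | "inv y c \<le> - 1" | "inv y a = - 1" "inv y c = 1"
        using consec_nz[OF ed(3)] by linarith
      then show "Good y a c"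
      proof cases
        case 1
        then show ?thesis using forced_right[OF F'[OF b] b e _ w] by blast
      next
        case 2
        have t using I_pos ed(3) 2 unfolding consec_def by fastforce
        have "forced (- a - (- c)) (- b)" using F'[OF I_neg[OF \<open>t\<close> b]] by simp
        then have "Good y (- c) (- a)"
          using forced_right[OF _ I_neg[OF \<open>t\<close> b] edge_mirror(1)[OF \<open>t\<close> e] _ wit_mirror[OF y \<open>t\<close> b w]]
            inv_odd[OF y] 2 by simp
        then show ?thesis by (rule Good_mirror[OF \<open>t\<close> e])
      next
        case 3
        then have "inv y (- c) = inv y a" using inv_odd[OF y] by simp
        then have a: "a = - c" using inv_eq_iff[OF y] by simp
        have "forced (c + c) b'" if "b' \<in> I" for b' using F'[OF that] a by simp
        then show ?thesis using forced_central[OF _ b, of c y] e w unfolding a by blast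
      qed
    qed
  qed
  from this[of "nat (c - a) + 1"] show ?thesis using assms edgeD(2)[OF assms(1)] by auto
qed

lemma camb_rel_subset: "camb_rel \<subseteq> \<Theta>"
proof -
  have st: "(x, y) \<in> \<Theta>" if "cstep x y" for x y
    using that contracted_in_cong unfolding cstep_def ctr_def edge_def by blast
  have sts: "(x, y) \<in> \<Theta>" if "cstep\<^sup>*\<^sup>* x y" "x \<in> W" for x y
    using that
  proof (induction rule: rtranclp_induct)
    case base then show ?case using Th_equiv by (meson equivE refl_onD)
  next
    case (step y z) then show ?case using st Th_trans by blast
  qed
  have "(x, y) \<in> \<Theta>" if xy: "(x, y) \<in> camb_rel" for x y
  proof -
    obtain b where b: "cstep\<^sup>*\<^sup>* b x" "cstep\<^sup>*\<^sup>* b y" using camb_rel_connected[OF xy] .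
    have "b \<in> W" using csteps_invariants(5)[OF b(1)] xy by (auto simp: camb_rel_def)
    then show ?thesis using sts b Th_sym Th_trans by meson
  qed
  then show ?thesis by auto
qed

end

section \<open>Cones and partial triangulations\<close>


context polygon begin

lemma Dg_cong: "(\<And>i. i \<in> I \<Longrightarrow> x i = y i) \<Longrightarrow> Dg x = Dg y"
  unfolding Dg_def using Lo_I Up_I by (metis (no_types, lifting))

lemma refine_exists:
  fixes x :: "int \<Rightarrow> 'a::linorder"
  obtains g :: "int \<Rightarrow> int" where "inj_on g I" "\<And>i j. i \<in> I \<Longrightarrow> j \<in> I \<Longrightarrow> g i < g j \<Longrightarrow> x i \<le> x j"
proof -
  define R where "R i j \<longleftrightarrow> x i < x j \<or> x i = x j \<and> i < j" for i j
  define g where "g i = int (card {j \<in> I. R j i})" for i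
  have mono: "g i < g j" if "i \<in> I" "j \<in> I" "R i j" for i j
  proof -
    have "{k \<in> I. R k i} \<subset> {k \<in> I. R k j}" using that by (auto simp: R_def)
    then show ?thesis unfolding g_def using fin by (simp add: psubset_card_mono)
  qed
  have tot: "R i j \<or> R j i" if "i \<noteq> j" for i j using that by (auto simp: R_def)
  have "inj_on g I" by (rule inj_onI) (metis mono tot less_irrefl)
  moreover have "x i \<le> x j" if "i \<in> I" "j \<in> I" "g i < g j" for i j
    using mono[of j i] that by (force simp: R_def)
  ultimately show ?thesis using that by blast
qed

text \<open>By compatibility each summand satisfies weakly the demands of the other's diagonals, so
  strictness in one of them suffices. Conversely a triangulation refining the sum reduces membership
  to the one inequality between \<open>lst\<close> and \<open>ust\<close>, and a sum is strict only
  if a summand is.\<close>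

lemma Dg_add:
  fixes x y :: "int \<Rightarrow> real"
  assumes nc: "\<And>e f. e \<in> Dg x \<Longrightarrow> f \<in> Dg y \<Longrightarrow> \<not> xing e f"
  shows "Dg (\<lambda>i. x i + y i) = Dg x \<union> Dg y"
proof
  let ?z = "\<lambda>i. x i + y i"
  have sub: "Dg x \<union> Dg y \<subseteq> Dg ?z"
  proof
    fix e assume e: "e \<in> Dg x \<union> Dg y"
    then have ed: "e \<in> diag" using Dg_diag by blast
    have "x l + y l < x u + y u" if lu: "l \<in> Lo e" "u \<in> Up e" for l u
    proof -
      have le: "x l \<le> x u" "y l \<le> y u"
        using e Dg_compat[of e x l u] Dg_compat[of e y l u] Dg_noncrossing nc lu ed diag_edges xing_sym
        by blast+
      have "x l < x u \<or> y l < y u" using e lu by (auto simp: Dg_def)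
      then show ?thesis using le by linarith
    qed
    then show "e \<in> Dg ?z" using ed by (auto simp: Dg_def)
  qed
  then show "Dg x \<union> Dg y \<subseteq> Dg ?z" .
  show "Dg ?z \<subseteq> Dg x \<union> Dg y"
  proof
    fix e assume e: "e \<in> Dg ?z"
    obtain g :: "int \<Rightarrow> int" where g: "inj_on g I" "\<And>i j. i \<in> I \<Longrightarrow> j \<in> I \<Longrightarrow> g i < g j \<Longrightarrow> ?z i \<le> ?z j"
      using refine_exists[of ?z] by blast
    have zg: "Dg ?z \<subseteq> Dg g" by (rule Dg_refine) (use g in auto)
    then have eg: "e \<in> Dg g" using e by blast
    have "?z (lst g e) < ?z (ust g e)" using mem_Dg_iff[OF g(1) zg eg] e by blast
    then have "x (lst g e) < x (ust g e) \<or> y (lst g e) < y (ust g e)" by linarith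
    then show "e \<in> Dg x \<union> Dg y"
      using mem_Dg_iff[OF g(1) _ eg, of x] mem_Dg_iff[OF g(1) _ eg, of y] sub zg by blast
  qed
qed

text \<open>A direction whose only threshold separates \<open>Lo e\<close> from \<open>Up e\<close>.
  The letters on either side of the edge get a constant value, chosen to agree with the endpoint, so
  that the path there runs along the boundary of the polygon.\<close>

definition ray :: "int \<times> int \<Rightarrow> int \<Rightarrow> real" where
  "ray e b = (if b \<le> fst e then (if up (fst e) then 0 else 1)
     else if b < snd e then (if up b then 1 else 0) else (if up (snd e) then 0 else 1))"

text \<open>Neither endpoint of \<open>e\<close> can lie strictly inside another diagonal of this
  point, nor the other way round, since its value would contradict a demand; and on a diagonal
  outside \<open>e\<close> the values are constant.\<close>

lemma Dg_ray: assumes e: "e \<in> diag" shows "Dg (ray e) = {e}"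
proof -
  have ed: "fst e < snd e" "fst e \<in> verts" "snd e \<in> verts" using e diag_edges edges_less by (auto simp: edges_def)
  have "ray e l = 0" if "l \<in> Lo e" for l
    using that ed by (auto simp: ray_def Lo_def)
  moreover have "ray e u = 1" if "u \<in> Up e" for u
    using that ed by (auto simp: ray_def Up_def)
  ultimately have 1: "e \<in> Dg (ray e)" using e by (auto simp: Dg_def)
  have "f = e" if f: "f \<in> Dg (ray e)" for f
  proof -
    have fd: "f \<in> diag" using f Dg_diag by blast
    have fe: "fst f < snd f" "fst f \<in> verts" "snd f \<in> verts" using fd diag_edges edges_less by (auto simp: edges_def)
    have val: "ray e b = 0 \<or> ray e b = 1" for b by (auto simp: ray_def)
    have ne: "Lo f \<noteq> {}" "Up f \<noteq> {}" using fd by (auto simp: diag_def)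
    have lt: "ray e l < ray e u" if "l \<in> Lo f" "u \<in> Up f" for l u using f that by (auto simp: Dg_def)
    have L0: "ray e l = 0" if l: "l \<in> Lo f" for l
    proof -
      obtain u where "u \<in> Up f" using ne by blast
      then show ?thesis using lt[OF l] val[of l] val[of u] by fastforce
    qed
    have U1: "ray e u = 1" if u: "u \<in> Up f" for u
    proof -
      obtain l where "l \<in> Lo f" using ne by blast
      then show ?thesis using lt[OF _ u] val[of l] val[of u] by fastforce
    qed
    have VI: "v \<in> I" if "v \<in> verts" "lo < v" "v < hi" for v using that by (auto simp: verts_def)
    have inI: "v \<in> I" if "v \<in> verts" "w \<in> verts" "w' \<in> verts" "w < v" "v < w'" for v w w'
      using VI[OF that(1)] verts_bnd[OF that(2)] verts_bnd[OF that(3)] that by linarith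
    have no_mid: "\<not> (fst f < v \<and> v < snd f)" if v: "v = fst e \<or> v = snd e" for v
    proof
      assume m: "fst f < v \<and> v < snd f"
      have "v \<in> I" using inI[of v "fst f" "snd f"] ed fe v m by auto
      then have "if up v then v \<in> Up f else v \<in> Lo f" using m by (auto simp: Up_def Lo_def)
      moreover have "ray e v = (if up v then 0 else 1)" using v ed by (auto simp: ray_def)
      ultimately show False using L0[of v] U1[of v] by (auto split: if_splits)
    qed
    have no_end: "\<not> (fst e < v \<and> v < snd e)" if v: "v = fst f \<or> v = snd f" for v
    proof
      assume m: "fst e < v \<and> v < snd e"
      have "v \<in> I" using inI[of v "fst e" "snd e"] ed fe v m by auto
      then have "if up v then v \<in> Lo f else v \<in> Up f" using v by (auto simp: Up_def Lo_def)
      moreover have "ray e v = (if up v then 1 else 0)" using m by (auto simp: ray_def)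
      ultimately show False using L0[of v] U1[of v] by (auto split: if_splits)
    qed
    have sp: "fst f \<le> b \<and> b \<le> snd f" if "b \<in> Lo f \<union> Up f" for b
      using that fe by (auto simp: Lo_def Up_def)
    obtain l u where lu: "l \<in> Lo f" "u \<in> Up f" using ne by blast
    have "\<not> snd f \<le> fst e"
    proof
      assume "snd f \<le> fst e"
      then have "ray e l = ray e u" using sp[of l] sp[of u] lu by (auto simp: ray_def)
      then show False using lt[OF lu] by simp
    qed
    moreover have "\<not> snd e \<le> fst f"
    proof
      assume "snd e \<le> fst f"
      then have "ray e l = ray e u" using sp[of l] sp[of u] lu ed(1) by (auto simp: ray_def)
      then show False using lt[OF lu] by simp
    qed
    ultimately have "fst f = fst e" "snd f = snd e"
      using no_mid[of "fst e"] no_mid[of "snd e"] no_end[of "fst f"] no_end[of "snd f"] ed fe by linarith+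
    then show "f = e" by (simp add: prod_eq_iff)
  qed
  then show ?thesis using 1 by blast
qed

definition noncrossing :: "(int \<times> int) set \<Rightarrow> bool" where
  "noncrossing D \<longleftrightarrow> D \<subseteq> diag \<and> (\<forall>e \<in> D. \<forall>f \<in> D. \<not> xing e f)"

lemma noncrossing_Dg: "noncrossing (Dg x)"
  unfolding noncrossing_def using Dg_noncrossing[of _ x] Dg_diag[of x] by blast

lemma noncrossing_is_Dg:
  assumes "noncrossing D" obtains x :: "int \<Rightarrow> real" where "Dg x = D"
proof -
  have "finite D" using assms finite_diag finite_subset by (auto simp: noncrossing_def)
  then have "\<exists>x :: int \<Rightarrow> real. Dg x = D" using assms
  proof (induction D rule: finite_induct)
    case empty
    have "Dg (\<lambda>_. 0 :: real) = {}" by (auto simp: Dg_def diag_def)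
    then show ?case by blast
  next
    case (insert e D)
    then have "noncrossing D" and e: "e \<in> diag" by (auto simp: noncrossing_def)
    then obtain x :: "int \<Rightarrow> real" where x: "Dg x = D" using insert.IH by blast
    have "Dg (\<lambda>i. ray e i + x i) = Dg (ray e) \<union> Dg x"
      by (rule Dg_add) (use insert.prems x Dg_ray[OF e] in \<open>auto simp: noncrossing_def\<close>)
    then show ?case using Dg_ray[OF e] x by auto
  qed
  then show ?thesis using that by blast
qed

end

lemma ext_neg: "x 0 = 0 \<Longrightarrow> ext x (- j) = - ext x j"
  by (auto simp: ext_def)

lemma Rn_zero: "x \<in> Rn n \<Longrightarrow> x 0 = 0"
  by (simp add: Rn_def)

lemma ext_vcomb: "ext (vcomb u a b) j = (1 - u) * ext a j + u * ext b j"
  by (auto simp: ext_def vcomb_def algebra_simps)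

lemma vcomb_Rn: "a \<in> Rn n \<Longrightarrow> b \<in> Rn n \<Longrightarrow> vcomb u a b \<in> Rn n"
  by (simp add: Rn_def vcomb_def)

section \<open>Cones of triangulations and their faces\<close>

context cambrian begin

definition chamber :: "vec set" where "chamber = (if t then chamber_B n else chamber_A n)"

lemma le_of_consec:
  fixes f :: "int \<Rightarrow> 'a::order"
  assumes "\<And>i j. consec i j \<Longrightarrow> f i \<le> f j" "i \<in> I" "j \<in> I" "i < j"
  shows "f i \<le> f j"
  using assms(2-4)
proof (induction "nat (j - i)" arbitrary: i j rule: less_induct)
  case less
  show ?case
  proof (cases "consec i j")
    case False
    then obtain k where k: "k \<in> I" "i < k" "k < j" using less.prems by (auto simp: consec_def)
    have "f i \<le> f k" using less.hyps[of k i] less.prems k by simp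
    also have "f k \<le> f j" using less.hyps[of j k] less.prems k by simp
    finally show ?thesis .
  qed (use assms in blast)
qed

lemma chamber_iff:
  "x \<in> chamber \<longleftrightarrow> x \<in> Rn n \<and> (\<forall>i \<in> I. \<forall>j \<in> I. i < j \<longrightarrow> ext x i \<le> ext x j)"
proof
  assume x: "x \<in> chamber"
  then have pos: "x k \<le> x (k + 1)" if "1 \<le> k" "k < int n" for k
    using that by (auto simp: chamber_def chamber_A_def chamber_B_def split: if_splits)
  have R: "x \<in> Rn n" using x by (auto simp: chamber_def chamber_A_def chamber_B_def split: if_splits)
  have "ext x i \<le> ext x j" if c: "consec i j" for i j
  proof -
    have ij: "i \<in> I" "j \<in> I" "j = i + 1 \<or> i = - 1 \<and> j = 1" using c by (auto simp: consec_iff)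
    consider "i = - 1" "j = 1" | "j = i + 1" "0 < i" | "j = i + 1" "j < 0"
      using ij I_nz[OF ij(1)] I_nz[OF ij(2)] by linarith
    then show ?thesis
    proof cases
      case 1
      then have "t" using ij I_pos by fastforce
      then show ?thesis using 1 x by (simp add: chamber_def chamber_B_def ext_def)
    next
      case 2
      then show ?thesis using pos[of i] ij by (auto simp: ext_def I_def)
    next
      case 3
      then show ?thesis using pos[of "- j"] ij by (auto simp: ext_def I_def)
    qed
  qed
  then show "x \<in> Rn n \<and> (\<forall>i \<in> I. \<forall>j \<in> I. i < j \<longrightarrow> ext x i \<le> ext x j)"
    using R le_of_consec by blast
next
  assume x: "x \<in> Rn n \<and> (\<forall>i \<in> I. \<forall>j \<in> I. i < j \<longrightarrow> ext x i \<le> ext x j)"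
  have "x k \<le> x (k + 1)" if "1 \<le> k" "k < int n" for k
  proof -
    have "k \<in> I" "k + 1 \<in> I" using that by (auto simp: I_def)
    then have "ext x k \<le> ext x (k + 1)" using x by simp
    then show ?thesis using that by (simp add: ext_def)
  qed
  moreover have "0 \<le> x 1" if t
  proof -
    have "1 \<in> I" "- 1 \<in> I" using n1 that by (auto simp: I_def)
    then have "ext x (- 1) \<le> ext x 1" using x by simp
    then show ?thesis by (simp add: ext_def)
  qed
  ultimately show "x \<in> chamber" using x by (auto simp: chamber_def chamber_A_def chamber_B_def)
qed

lemma act_Rn: "act n w x \<in> Rn n"
  by (auto simp: act_def Rn_def)

lemma ext_act: assumes w: "w \<in> W" and x: "x \<in> Rn n" and i: "i \<in> I"
  shows "ext (act n w x) i = ext x (inv w i)"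
proof (cases "i > 0")
  case True
  then show ?thesis using i by (auto simp: ext_def act_def I_def)
next
  case False
  then have "1 \<le> - i \<and> - i \<le> int n" using i by (auto simp: I_def)
  then have "act n w x (- i) = ext x (inv w (- i))" by (simp add: act_def)
  moreover have "ext (act n w x) i = - act n w x (- i)"
    using False I_nz[OF i] by (simp add: ext_def)
  ultimately have "ext (act n w x) i = - ext x (inv w (- i))" by simp
  then show ?thesis using inv_odd[OF w, of i] ext_neg[of x "inv w i"] Rn_zero[OF x] by simp
qed

lemma region: assumes w: "w \<in> W"
  shows "act n w ` chamber = {x \<in> Rn n. \<forall>i \<in> I. \<forall>j \<in> I. inv w i < inv w j \<longrightarrow> ext x i \<le> ext x j}"
proof (intro equalityI subsetI)
  fix z assume "z \<in> act n w ` chamber"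
  then obtain x where x: "x \<in> chamber" "z = act n w x" by blast
  then show "z \<in> {x \<in> Rn n. \<forall>i \<in> I. \<forall>j \<in> I. inv w i < inv w j \<longrightarrow> ext x i \<le> ext x j}"
    using act_Rn ext_act[OF w] inv_I[OF w] unfolding chamber_iff by auto
next
  fix x assume "x \<in> {x \<in> Rn n. \<forall>i \<in> I. \<forall>j \<in> I. inv w i < inv w j \<longrightarrow> ext x i \<le> ext x j}"
  then have x: "x \<in> Rn n" "\<And>i j. i \<in> I \<Longrightarrow> j \<in> I \<Longrightarrow> inv w i < inv w j \<Longrightarrow> ext x i \<le> ext x j" by auto
  let ?y = "act n (inv w) x"
  have ii: "inv (inv w) = w" using W_bij[OF w] by (simp add: inv_inv_eq)
  have ey: "ext ?y i = ext x (w i)" if "i \<in> I" for i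
    using ext_act[OF W_inverse[OF w] x(1) that] ii by simp
  have "?y \<in> chamber"
    unfolding chamber_iff using act_Rn x(2) ey W_I[OF w] inv_inv_W[OF w] by simp
  moreover have "act n w ?y = x"
  proof
    fix i
    show "act n w ?y i = x i"
    proof (cases "1 \<le> i \<and> i \<le> int n")
      case True
      then have "i \<in> I" by (auto simp: I_def)
      then show ?thesis using True ey[of "inv w i"] inv_I[OF w] inv_inv_W[OF w]
        by (simp add: act_def[of n w]) (simp add: ext_def)
    next
      case False
      then show ?thesis using x(1) by (auto simp: act_def Rn_def)
    qed
  qed
  ultimately show "x \<in> act n w ` chamber" by (metis image_eqI)
qed

definition cone :: "(int \<times> int) set \<Rightarrow> vec set" where
  "cone D = {x \<in> Rn n. Dg (ext x) \<subseteq> D}"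

lemma tiebreak_W:
  assumes x: "x \<in> Rn n" and w: "w \<in> W"
  obtains v where "v \<in> W" "\<And>i j. i \<in> I \<Longrightarrow> j \<in> I \<Longrightarrow> inv v i < inv v j \<longleftrightarrow> tiebreak (ext x) (inv w) i j"
proof (rule realize_order[of "tiebreak (ext x) (inv w)"])
  show "tiebreak (ext x) (inv w) i j \<or> tiebreak (ext x) (inv w) j i" if "i \<noteq> j" for i j
    using that inv_eq_iff[OF w, of i j] by (auto simp: tiebreak_def)
  show "tiebreak (ext x) (inv w) (- j) (- i)" if "tiebreak (ext x) (inv w) i j" for i j
    using that ext_neg[of x, OF Rn_zero[OF x]] inv_odd[OF w] by (auto simp: tiebreak_def)
qed (auto simp: tiebreak_def)

text \<open>Each region lies in the cone by refinement. Conversely, a point of the cone lies in the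
  region of the element that breaks its ties as \<open>w\<close> does, and by
  \<open>Dg_tiebreak\<close> this element is in the class of \<open>w\<close>.\<close>

lemma class_cone: assumes w: "w \<in> W"
  shows "(\<Union>v \<in> camb_rel `` {w}. act n v ` chamber) = cone (Dg (inv w))"
proof (intro equalityI subsetI)
  fix x assume "x \<in> (\<Union>v \<in> camb_rel `` {w}. act n v ` chamber)"
  then obtain v where v: "v \<in> W" "Dg (inv w) = Dg (inv v)" "x \<in> act n v ` chamber"
    by (auto simp: camb_rel_def)
  then have x: "x \<in> Rn n" "\<And>i j. i \<in> I \<Longrightarrow> j \<in> I \<Longrightarrow> inv v i < inv v j \<Longrightarrow> ext x i \<le> ext x j"
    using region[OF v(1)] by auto
  have "Dg (ext x) \<subseteq> Dg (inv v)" by (rule Dg_refine) (use x inj_inv[OF v(1)] in auto)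
  then show "x \<in> cone (Dg (inv w))" using x v by (simp add: cone_def)
next
  fix x assume "x \<in> cone (Dg (inv w))"
  then have x: "x \<in> Rn n" "Dg (ext x) \<subseteq> Dg (inv w)" by (auto simp: cone_def)
  obtain v where v: "v \<in> W" "\<And>i j. i \<in> I \<Longrightarrow> j \<in> I \<Longrightarrow> inv v i < inv v j \<longleftrightarrow> tiebreak (ext x) (inv w) i j"
    using tiebreak_W[OF x(1) w] by blast
  have "Dg (inv v) = Dg (inv w)"
    by (rule Dg_tiebreak[OF inj_inv[OF w] x(2) inj_inv[OF v(1)] v(2)])
  moreover have "x \<in> act n v ` chamber"
    unfolding region[OF v(1)] using x(1) v(2) by (auto simp: tiebreak_def)
  ultimately show "x \<in> (\<Union>v \<in> camb_rel `` {w}. act n v ` chamber)"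
    using v(1) w by (auto simp: camb_rel_def)
qed

lemma in_max_cone:
  assumes x: "x \<in> Rn n" obtains v where "v \<in> W" "Dg (ext x) \<subseteq> Dg (inv v)"
proof -
  obtain v where v: "v \<in> W" "\<And>i j. i \<in> I \<Longrightarrow> j \<in> I \<Longrightarrow> inv v i < inv v j \<longleftrightarrow> tiebreak (ext x) (inv id) i j"
    using tiebreak_W[OF x id_W] by blast
  have "Dg (ext x) \<subseteq> Dg (inv v)"
    by (rule Dg_refine) (use v(2) inj_inv[OF v(1)] in \<open>auto simp: tiebreak_def\<close>)
  then show ?thesis using that v by blast
qed

context
  fixes w assumes w: "w \<in> W"
begin

definition tr :: "(int \<times> int) set" where "tr = Dg (inv w)"
definition ht :: "int \<times> int \<Rightarrow> vec \<Rightarrow> real" where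
  "ht e x = ext x (ust (inv w) e) - ext x (lst (inv w) e)"

lemma ht_vcomb: "ht e (vcomb u a b) = (1 - u) * ht e a + u * ht e b"
  by (simp add: ht_def ext_vcomb algebra_simps)

lemma cone_tr_iff: "x \<in> cone tr \<longleftrightarrow> x \<in> Rn n \<and> (\<forall>e \<in> tr. 0 \<le> ht e x)"
  unfolding cone_def tr_def ht_def using Dg_subset_iff[OF inj_inv[OF w]] by auto

lemma mem_ht: "x \<in> cone tr \<Longrightarrow> e \<in> tr \<Longrightarrow> e \<in> Dg (ext x) \<longleftrightarrow> 0 < ht e x"
  unfolding cone_def tr_def ht_def using mem_Dg_iff[OF inj_inv[OF w], of "ext x" e] by auto

lemma cone_iff:
  assumes "D \<subseteq> tr"
  shows "x \<in> cone D \<longleftrightarrow> x \<in> cone tr \<and> (\<forall>e \<in> tr - D. ht e x = 0)"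
proof
  assume x: "x \<in> cone D"
  then have xt: "x \<in> cone tr" using assms by (auto simp: cone_def)
  have "ht e x = 0" if "e \<in> tr - D" for e
  proof -
    have "e \<notin> Dg (ext x)" using x that by (auto simp: cone_def)
    then have "\<not> 0 < ht e x" using mem_ht[OF xt] that by blast
    moreover have "0 \<le> ht e x" using xt that cone_tr_iff by blast
    ultimately show ?thesis by simp
  qed
  then show "x \<in> cone tr \<and> (\<forall>e \<in> tr - D. ht e x = 0)" using xt by blast
next
  assume x: "x \<in> cone tr \<and> (\<forall>e \<in> tr - D. ht e x = 0)"
  have "e \<in> D" if "e \<in> Dg (ext x)" for e
    using x mem_ht[of x e] that unfolding cone_def by force
  then show "x \<in> cone D" using x by (auto simp: cone_def)
qed

lemma cone_convex: assumes "D \<subseteq> tr" shows "vconvex (cone D)"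
  unfolding vconvex_def
proof (intro ballI allI impI)
  fix x y and u :: real assume xy: "x \<in> cone D" "y \<in> cone D" "0 \<le> u \<and> u \<le> 1"
  then have "0 \<le> ht e (vcomb u x y)" if "e \<in> tr" for e
    using that cone_iff[OF assms] unfolding cone_tr_iff ht_vcomb by simp
  moreover have "ht e (vcomb u x y) = 0" if "e \<in> tr - D" for e
    using that xy cone_iff[OF assms] unfolding ht_vcomb by simp
  ultimately show "vcomb u x y \<in> cone D"
    using xy cone_iff[OF assms] cone_tr_iff vcomb_Rn by blast
qed

lemma cone_face: assumes D: "D \<subseteq> tr" shows "vface_of (cone D) (cone tr)"
  unfolding vface_of_def
proof (intro conjI ballI impI)
  show "cone D \<subseteq> cone tr" using D by (auto simp: cone_def)
  show "vconvex (cone D)" by (rule cone_convex[OF D])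
  fix a b x assume ab: "a \<in> cone tr" "b \<in> cone tr" and x: "x \<in> cone D" "x \<in> vopen_segment a b"
  then obtain u where u: "x = vcomb u a b" "0 \<le> u" "u \<le> 1" "x \<noteq> a" "x \<noteq> b" by (auto simp: vopen_segment_def)
  have "u \<noteq> 0" "u \<noteq> 1" using u by (auto simp: vcomb_def)
  then have u': "0 < u" "u < 1" using u by auto
  have "ht e a = 0 \<and> ht e b = 0" if e: "e \<in> tr - D" for e
  proof -
    have "(1 - u) * ht e a + u * ht e b = 0" using x(1) e cone_iff[OF D] u(1) ht_vcomb by metis
    moreover have "0 \<le> ht e a" "0 \<le> ht e b" using ab e by (auto simp: cone_tr_iff)
    moreover have "0 \<le> (1 - u) * ht e a" "0 \<le> u * ht e b" using calculation u' by auto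
    ultimately have "(1 - u) * ht e a = 0" "u * ht e b = 0" by linarith+
    then show ?thesis using u' by auto
  qed
  then show "a \<in> cone D" "b \<in> cone D" using ab cone_iff[OF D] by auto
qed

text \<open>A point \<open>x0\<close> of the face with as many diagonals as possible plays the part
  of a relative interior point. Midpoints collect the diagonals of both ends, so maximality bounds
  the face by the cone of \<open>x0\<close>; prolonging segments through \<open>x0\<close> gives the
  other inclusion.\<close>

lemma face_is_cone:
  assumes F: "F \<noteq> {}" "vface_of F (cone tr)"
  obtains x where "x \<in> Rn n" "F = cone (Dg (ext x))" "Dg (ext x) \<subseteq> tr"
proof -
  have sub: "F \<subseteq> cone tr" and cv: "vconvex F"
    and fc: "\<And>a b x. a \<in> cone tr \<Longrightarrow> b \<in> cone tr \<Longrightarrow> x \<in> F \<Longrightarrow> x \<in> vopen_segment a b \<Longrightarrow> b \<in> F"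
    using F by (auto simp: vface_of_def)
  have fintr: "finite tr" unfolding tr_def by (rule finite_Dg)
  have bd: "card (Dg (ext x)) \<le> card tr" if "x \<in> F" for x
    using sub that fintr by (intro card_mono) (auto simp: cone_def)
  obtain x0 where x0: "x0 \<in> F" "\<And>x. x \<in> F \<Longrightarrow> card (Dg (ext x)) \<le> card (Dg (ext x0))"
  proof -
    obtain x1 where "x1 \<in> F" using F by blast
    then show ?thesis
      using ex_has_greatest_nat[of "\<lambda>x. x \<in> F" x1 "\<lambda>x. card (Dg (ext x))" "Suc (card tr)"] bd that
      by (auto simp: less_Suc_eq_le)
  qed
  let ?D = "Dg (ext x0)"
  have x0t: "x0 \<in> cone tr" using x0 sub by blast
  then have D: "?D \<subseteq> tr" "x0 \<in> Rn n" by (auto simp: cone_def)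
  have "Dg (ext x) \<subseteq> ?D" if x: "x \<in> F" for x
  proof -
    have xt: "x \<in> cone tr" using x sub by blast
    let ?z = "vcomb (1/2) x x0"
    have z: "?z \<in> F" using cv x x0(1) unfolding vconvex_def by simp
    then have zt: "?z \<in> cone tr" using sub by blast
    have sup: "Dg (ext x) \<union> ?D \<subseteq> Dg (ext ?z)"
    proof
      fix e assume e: "e \<in> Dg (ext x) \<union> ?D"
      then have et: "e \<in> tr" using xt D by (auto simp: cone_def)
      have "0 < ht e x \<or> 0 < ht e x0" "0 \<le> ht e x" "0 \<le> ht e x0"
        using e mem_ht[OF xt et] mem_ht[OF x0t et] xt x0t et by (auto simp: cone_tr_iff)
      then have "0 < ht e ?z" unfolding ht_vcomb by auto
      then show "e \<in> Dg (ext ?z)" using mem_ht[OF zt et] by blast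
    qed
    have "?D = Dg (ext ?z)"
      by (rule card_seteq) (use sup x0(2)[OF z] finite_Dg in auto)
    then show ?thesis using sup by blast
  qed
  then have 1: "F \<subseteq> cone ?D" using sub by (auto simp: cone_def)
  have 2: "y \<in> F" if y: "y \<in> cone ?D" for y
  proof (cases "y = x0")
    case False
    have yt: "y \<in> cone tr" using y cone_iff[OF D(1)] by blast
    have pos: "0 < ht e x0" "0 \<le> ht e y" if "e \<in> ?D" for e
      using mem_ht[OF x0t, of e] yt that D(1) by (auto simp: cone_tr_iff)
    define r where "r e = ht e y / ht e x0" for e
    have r0: "0 \<le> r e" if "e \<in> ?D" for e using pos[OF that] by (simp add: r_def)
    \<comment> \<open>The sum dominates every quotient \<open>r e\<close> and the added 1 keeps the
      denominator positive, so a single step size works for all diagonals of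
      \<open>x0\<close>.\<close>
    define \<epsilon> where "\<epsilon> = 1 / (1 + sum r ?D)"
    have s0: "0 \<le> sum r ?D" using r0 by (rule sum_nonneg)
    then have \<epsilon>0: "0 < \<epsilon>" by (simp add: \<epsilon>_def)
    have eps: "\<epsilon> * ht e y \<le> ht e x0" if e: "e \<in> ?D" for e
    proof -
      have "r e \<le> sum r ?D" using r0 e finite_Dg by (intro member_le_sum) auto
      then have "\<epsilon> * r e \<le> 1" using s0 r0[OF e] by (simp add: \<epsilon>_def)
      then have "\<epsilon> * r e * ht e x0 \<le> 1 * ht e x0" using pos[OF e] by (intro mult_right_mono) auto
      then show ?thesis using pos[OF e] by (simp add: r_def)
    qed
    \<comment> \<open>With a negative parameter \<open>vcomb\<close> prolongs the segment from
      \<open>y\<close> slightly beyond \<open>x0\<close>. The new end still lies in the cone, and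
      \<open>x0\<close> is interior to the segment, so the face must contain
      \<open>y\<close>.\<close>
    let ?z = "vcomb (- \<epsilon>) x0 y"
    have zt: "?z \<in> cone tr"
      unfolding cone_tr_iff
    proof (intro conjI ballI)
      show "?z \<in> Rn n" using vcomb_Rn D(2) yt by (auto simp: cone_def)
      fix e assume e: "e \<in> tr"
      show "0 \<le> ht e ?z"
      proof (cases "e \<in> ?D")
        case True
        have "0 \<le> \<epsilon> * ht e x0" using \<epsilon>0 pos[OF True] by simp
        then show ?thesis unfolding ht_vcomb using eps[OF True] by (simp add: algebra_simps)
      next
        case False
        then have "ht e y = 0" using y e cone_iff[OF D(1)] by blast
        moreover have "0 \<le> ht e x0" using x0t e by (simp add: cone_tr_iff)
        ultimately show ?thesis unfolding ht_vcomb using \<epsilon>0 by simp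
      qed
    qed
    have x0z: "x0 = vcomb (\<epsilon> / (1 + \<epsilon>)) ?z y"
    proof
      fix i
      let ?s = "\<epsilon> / (1 + \<epsilon>)"
      have "1 - ?s = 1 / (1 + \<epsilon>)" using \<epsilon>0 by (simp add: field_simps)
      then have s: "(1 - ?s) * (1 + \<epsilon>) = 1" "(1 - ?s) * \<epsilon> = ?s" using \<epsilon>0 by auto
      have "vcomb ?s ?z y i = ((1 - ?s) * (1 + \<epsilon>)) * x0 i - ((1 - ?s) * \<epsilon>) * y i + ?s * y i"
        unfolding vcomb_def by (simp only: algebra_simps)
      then show "x0 i = vcomb ?s ?z y i" unfolding s by simp
    qed
    moreover have "x0 \<noteq> ?z"
    proof
      assume eq: "x0 = ?z"
      have "y i = x0 i" for i
      proof -
        have "x0 i = (1 + \<epsilon>) * x0 i - \<epsilon> * y i" using fun_cong[OF eq, of i] by (simp add: vcomb_def)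
        then have "\<epsilon> * (x0 i - y i) = 0" by argo
        then show ?thesis using \<epsilon>0 by auto
      qed
      then show False using False by blast
    qed
    moreover have "0 \<le> \<epsilon> / (1 + \<epsilon>)" "\<epsilon> / (1 + \<epsilon>) \<le> 1" using \<epsilon>0 by auto
    ultimately have "x0 \<in> vopen_segment ?z y" using False unfolding vopen_segment_def by blast
    then show ?thesis using fc[OF zt yt x0(1)] by blast
  qed (use x0 in simp)
  have "F = cone ?D" using 1 2 by blast
  then show ?thesis using that D by blast
qed

end

lemma fan_cones: "cong_fan n S chamber camb_rel = {cone (Dg (ext x)) | x. x \<in> Rn n}"
proof -
  have mx: "cong_fan_max_cones n S chamber camb_rel = {cone (Dg (inv w)) | w. w \<in> W}"
  proof (intro equalityI subsetI)
    fix F assume "F \<in> cong_fan_max_cones n S chamber camb_rel"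
    then obtain w where w: "w \<in> W" "F = (\<Union>v \<in> camb_rel `` {w}. act n v ` chamber)"
      unfolding cong_fan_max_cones_def by blast
    then show "F \<in> {cone (Dg (inv w)) | w. w \<in> W}" using class_cone[OF w(1)] by blast
  next
    fix F assume "F \<in> {cone (Dg (inv w)) | w. w \<in> W}"
    then obtain w where w: "w \<in> W" "F = cone (Dg (inv w))" by blast
    then have "F = (\<Union>v \<in> camb_rel `` {w}. act n v ` chamber)" using class_cone[OF w(1)] by simp
    then show "F \<in> cong_fan_max_cones n S chamber camb_rel"
      using w(1) unfolding cong_fan_max_cones_def by blast
  qed
  show ?thesis
  proof (intro equalityI subsetI)
    fix F assume "F \<in> cong_fan n S chamber camb_rel"
    then obtain w where w: "w \<in> W" "F \<noteq> {}" "vface_of F (cone (Dg (inv w)))"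
      unfolding cong_fan_def mx by blast
    then obtain x where "x \<in> Rn n" "F = cone (Dg (ext x))"
      using face_is_cone[OF w(1), of F] tr_def[OF w(1)] by metis
    then show "F \<in> {cone (Dg (ext x)) | x. x \<in> Rn n}" by blast
  next
    fix F assume "F \<in> {cone (Dg (ext x)) | x. x \<in> Rn n}"
    then obtain x where x: "x \<in> Rn n" "F = cone (Dg (ext x))" by blast
    obtain v where v: "v \<in> W" "Dg (ext x) \<subseteq> Dg (inv v)" using in_max_cone[OF x(1)] .
    have "vface_of F (cone (Dg (inv v)))"
      using cone_face[OF v(1), of "Dg (ext x)"] tr_def[OF v(1)] v x by simp
    moreover have "x \<in> F" using x by (simp add: cone_def)
    ultimately show "F \<in> cong_fan n S chamber camb_rel" unfolding cong_fan_def mx using v by blast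
  qed
qed

section \<open>Central symmetry and the poset of cones\<close>

definition neg_edge :: "int \<times> int \<Rightarrow> int \<times> int" where "neg_edge e = (- snd e, - fst e)"

lemma neg_edge_neg [simp]: "neg_edge (neg_edge e) = e"
  by (simp add: neg_edge_def)

lemma verts_neg: assumes t: t and v: "v \<in> verts" shows "- v \<in> verts"
proof -
  have "lo = - hi" using t by (simp add: lo_def hi_def)
  moreover have "v = lo \<or> v = hi \<or> v \<in> I" using v by (simp add: verts_def)
  ultimately have "- v = hi \<or> - v = lo \<or> - v \<in> I" using I_neg[OF t, of v] by auto
  then show ?thesis by (auto simp: verts_def)
qed

lemma Lo_neg_edge: assumes t: t shows "Lo (neg_edge e) = uminus ` Up e"
proof -
  have "- l \<in> Up e \<longleftrightarrow> l \<in> Lo (neg_edge e)" for l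
    using up_neg[OF t, of l] up_neg[OF t, of "- l"] I_neg[OF t, of l] I_neg[OF t, of "- l"]
    unfolding Lo_def Up_def neg_edge_def by auto
  note iff = this
  show ?thesis
  proof (intro equalityI subsetI)
    fix l assume "l \<in> Lo (neg_edge e)"
    then have "- l \<in> Up e" using iff by blast
    then show "l \<in> uminus ` Up e" by (rule rev_image_eqI) simp
  next
    fix l assume "l \<in> uminus ` Up e"
    then have "- l \<in> Up e" by auto
    then show "l \<in> Lo (neg_edge e)" using iff by blast
  qed
qed

lemma Up_neg_edge: assumes t: t shows "Up (neg_edge e) = uminus ` Lo e"
  using Lo_neg_edge[OF t, of "neg_edge e"] by (simp add: image_image)

lemma diag_neg_edge: assumes t: t and e: "e \<in> diag" shows "neg_edge e \<in> diag"
  using e verts_neg[OF t] Lo_neg_edge[OF t, of e] Up_neg_edge[OF t, of e]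
  by (auto simp: diag_def edges_def neg_edge_def)

lemma Dg_negate:
  fixes x :: "int \<Rightarrow> real"
  assumes t: t shows "e \<in> Dg (\<lambda>i. - x (- i)) \<longleftrightarrow> neg_edge e \<in> Dg x"
proof -
  have "e \<in> diag \<longleftrightarrow> neg_edge e \<in> diag" using diag_neg_edge[OF t, of e] diag_neg_edge[OF t, of "neg_edge e"] by auto
  then show ?thesis unfolding Dg_def using Lo_neg_edge[OF t, of e] Up_neg_edge[OF t, of e] by auto
qed

definition sym_noncrossing :: "(int \<times> int) set set" where
  "sym_noncrossing = {D. noncrossing D \<and> (t \<longrightarrow> neg_edge ` D \<subseteq> D)}"

lemma Dg_ext_iff: "(\<exists>x \<in> Rn n. Dg (ext x) = D) \<longleftrightarrow> D \<in> sym_noncrossing"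
proof
  assume "\<exists>x \<in> Rn n. Dg (ext x) = D"
  then obtain x where x: "x \<in> Rn n" "Dg (ext x) = D" by blast
  have "neg_edge e \<in> D" if t "e \<in> D" for e
  proof -
    have "(\<lambda>i. - ext x (- i)) = ext x" using ext_neg[of x, OF Rn_zero[OF x(1)]] by auto
    then show ?thesis using Dg_negate[OF that(1), of e "ext x"] x that by simp
  qed
  then show "D \<in> sym_noncrossing" using x noncrossing_Dg by (auto simp: sym_noncrossing_def)
next
  assume D: "D \<in> sym_noncrossing"
  then have nc: "noncrossing D" by (simp add: sym_noncrossing_def)
  obtain y :: "int \<Rightarrow> real" where y: "Dg y = D" using noncrossing_is_Dg[OF nc] by blast
  obtain z :: "int \<Rightarrow> real" where z: "Dg z = D" "t \<Longrightarrow> z (- i) = - z i" for i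
  proof (cases t)
    case False
    then show ?thesis using that y by blast
  next
    case t: True
    have eq: "Dg (\<lambda>i. - y (- i)) = D"
    proof -
      have "e \<in> D \<longleftrightarrow> neg_edge e \<in> D" for e
        using D t unfolding sym_noncrossing_def by (metis (no_types, lifting) imageI mem_Collect_eq neg_edge_neg subsetD)
      then show ?thesis using Dg_negate[OF t] y by blast
    qed
    \<comment> \<open>Adding the point and its image under the half turn produces an odd function.
      Both have the symmetric set \<open>D\<close>, so the sum has it as well.\<close>
    have "Dg (\<lambda>i. y i + - y (- i)) = D"
      using Dg_add[of y "\<lambda>i. - y (- i)"] y eq nc unfolding noncrossing_def by auto
    then show ?thesis using that[of "\<lambda>i. y i + - y (- i)"] by simp
  qed
  define x where "x = (\<lambda>i. if 1 \<le> i \<and> i \<le> int n then z i else 0)"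
  have xR: "x \<in> Rn n" by (auto simp: x_def Rn_def)
  have "ext x i = z i" if i: "i \<in> I" for i
  proof (cases "0 < i")
    case True
    then show ?thesis using i by (auto simp: ext_def x_def I_def)
  next
    case False
    then have t using I_pos i by blast
    then show ?thesis using z(2)[of i] False i by (auto simp: ext_def x_def I_def)
  qed
  then have "Dg (ext x) = D" using Dg_cong[of "ext x" z] z by blast
  then show "\<exists>x \<in> Rn n. Dg (ext x) = D" using xR by blast
qed

lemma cone_mono_iff:
  assumes "D \<in> sym_noncrossing" shows "cone D \<subseteq> cone D' \<longleftrightarrow> D \<subseteq> D'"
proof
  obtain x where x: "x \<in> Rn n" "Dg (ext x) = D" using Dg_ext_iff assms by blast
  assume "cone D \<subseteq> cone D'"
  then have "x \<in> cone D'" using x by (auto simp: cone_def)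
  then show "D \<subseteq> D'" using x by (simp add: cone_def)
qed (auto simp: cone_def)

lemma fan_eq: "cong_fan n S chamber camb_rel = cone ` sym_noncrossing"
proof (intro equalityI subsetI)
  fix F assume "F \<in> cong_fan n S chamber camb_rel"
  then obtain x where x: "x \<in> Rn n" "F = cone (Dg (ext x))" unfolding fan_cones by blast
  then have "Dg (ext x) \<in> sym_noncrossing" using Dg_ext_iff[of "Dg (ext x)"] by blast
  then show "F \<in> cone ` sym_noncrossing" using x by blast
next
  fix F assume "F \<in> cone ` sym_noncrossing"
  then obtain D where D: "D \<in> sym_noncrossing" "F = cone D" by blast
  then obtain x where "x \<in> Rn n" "Dg (ext x) = D" using Dg_ext_iff[of D] by blast
  then show "F \<in> cong_fan n S chamber camb_rel" unfolding fan_cones using D by blast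
qed

end

section \<open>Labelling the polygon and the generating pairs\<close>


context polygon begin

definition isU :: "int \<Rightarrow> bool" where "isU v \<longleftrightarrow> v \<in> I \<and> up v"
definition size_N :: nat where "size_N = card verts"

text \<open>The cyclic labelling of the polygon: lower vertices from left to right, then upper vertices
  from right to left.\<close>
definition lab :: "int \<Rightarrow> nat" where
  "lab v = (if isU v then size_N - 1 - card {z \<in> verts. isU z \<and> z < v}
            else card {z \<in> verts. \<not> isU z \<and> z < v})"
definition labe :: "int \<times> int \<Rightarrow> nat \<times> nat" where
  "labe e = (min (lab (fst e)) (lab (snd e)), max (lab (fst e)) (lab (snd e)))"

lemma finite_verts: "finite verts"
  using fin by (simp add: verts_def)

lemma size_N_split: "size_N = card {z \<in> verts. \<not> isU z} + card {z \<in> verts. isU z}"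
proof -
  have "verts = {z \<in> verts. \<not> isU z} \<union> {z \<in> verts. isU z}" by blast
  then show ?thesis unfolding size_N_def
    using card_Un_disjoint[of "{z \<in> verts. \<not> isU z}" "{z \<in> verts. isU z}"] finite_verts by auto
qed

lemma card_below_less:
  assumes "finite A" "v \<in> A" "w \<in> A"
  shows "card {z \<in> A. z < v} < card {z \<in> A. z < w} \<longleftrightarrow> v < (w::int)"
proof -
  have mono: "card {z \<in> A. z < v} < card {z \<in> A. z < w}" if "v \<in> A" "v < w" for v w
    by (rule psubset_card_mono) (use assms(1) that in auto)
  show ?thesis using mono[of v w] mono[of w v] assms by (cases v w rule: linorder_cases) auto
qed

lemma card_below: "finite A \<Longrightarrow> v \<in> A \<Longrightarrow> card {z \<in> A. z < v} < card A" for v :: int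
  by (rule psubset_card_mono) auto

lemma lab_lower: "\<not> isU v \<Longrightarrow> v \<in> verts \<Longrightarrow> lab v < card {z \<in> verts. \<not> isU z}"
  using card_below[of "{z \<in> verts. \<not> isU z}" v] finite_verts by (simp add: lab_def conj_assoc)

lemma lab_upper:
  assumes "isU v" "v \<in> verts"
  shows "card {z \<in> verts. \<not> isU z} \<le> lab v" "lab v < size_N"
    "lab v + card {z \<in> verts. isU z \<and> z < v} = size_N - 1"
  using card_below[of "{z \<in> verts. isU z}" v] finite_verts assms size_N_split
  by (simp_all add: lab_def conj_assoc)

lemma lab_less:
  assumes v: "v \<in> verts" and w: "w \<in> verts"
  shows "lab v < lab w \<longleftrightarrow> (if isU v then isU w \<and> w < v else isU w \<or> v < w)"
proof -
  have lo: "card {z \<in> verts. \<not> isU z \<and> z < v} < card {z \<in> verts. \<not> isU z \<and> z < w} \<longleftrightarrow> v < w"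
    if "\<not> isU v" "\<not> isU w"
    using card_below_less[of "{z \<in> verts. \<not> isU z}" v w] finite_verts v w that by (simp add: conj_assoc)
  have up: "card {z \<in> verts. isU z \<and> z < w} < card {z \<in> verts. isU z \<and> z < v} \<longleftrightarrow> w < v"
    if "isU v" "isU w"
    using card_below_less[of "{z \<in> verts. isU z}" w v] finite_verts v w that by (simp add: conj_assoc)
  show ?thesis
  proof (cases "isU v"; cases "isU w")
    assume "isU v" "isU w"
    then show ?thesis using up lab_upper(3)[of v] lab_upper(3)[of w] v w by (simp; linarith)
  next
    assume a: "isU v" "\<not> isU w"
    then show ?thesis using lab_upper(1)[of v] lab_lower[of w] v w by simp
  next
    assume a: "\<not> isU v" "isU w"
    then show ?thesis using lab_upper(1)[of w] lab_lower[of v] v w by simp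
  next
    assume a: "\<not> isU v" "\<not> isU w"
    then show ?thesis using lo by (simp add: lab_def)
  qed
qed

lemma lab_bij: "bij_betw lab verts {..<size_N}"
proof -
  have inj: "inj_on lab verts"
  proof (rule inj_onI)
    fix v w assume vw: "v \<in> verts" "w \<in> verts" "lab v = lab w"
    then have "\<not> lab v < lab w" "\<not> lab w < lab v" by auto
    then show "v = w" using lab_less[OF vw(1,2)] lab_less[OF vw(2,1)] by (auto split: if_splits)
  qed
  have "lab v < size_N" if "v \<in> verts" for v
    using lab_lower[of v] lab_upper(2)[of v] size_N_split that by (cases "isU v") auto
  then have "lab ` verts \<subseteq> {..<size_N}" by auto
  moreover have "card (lab ` verts) = card {..<size_N}" using card_image[OF inj] by (simp add: size_N_def)
  ultimately have "lab ` verts = {..<size_N}" by (intro card_subset_eq) auto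
  then show ?thesis using inj by (simp add: bij_betw_def)
qed

lemma labe_edge:
  assumes "(a, c) \<in> edges" shows "labe (a, c) = (if isU a then (lab c, lab a) else (lab a, lab c))"
proof -
  have v: "a \<in> verts" "c \<in> verts" "a < c" using assms by (auto simp: edges_def)
  show ?thesis using lab_less[OF v(1,2)] lab_less[OF v(2,1)] v(3)
    by (auto simp: labe_def min_def max_def not_le)
qed

lemma labe_bij: "bij_betw labe edges {(i, j). i < j \<and> j < size_N}"
proof -
  have inj: "inj_on lab verts" and im: "lab ` verts = {..<size_N}" using lab_bij by (auto simp: bij_betw_def)
  have leq: "lab v = lab w \<longleftrightarrow> v = w" if "v \<in> verts" "w \<in> verts" for v w using inj that by (meson inj_onD)
  show ?thesis
    unfolding bij_betw_def
  proof (intro conjI equalityI subsetI)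
    show "inj_on labe edges"
    proof (rule inj_onI)
      fix e f assume ef: "e \<in> edges" "f \<in> edges" "labe e = labe f"
      obtain a c where e: "e = (a, c)" by (cases e)
      obtain a' c' where f: "f = (a', c')" by (cases f)
      have v: "a \<in> verts" "c \<in> verts" "a < c" "a' \<in> verts" "c' \<in> verts" "a' < c'"
        using ef e f by (auto simp: edges_def)
      have "{lab a, lab c} = {lab a', lab c'}" using ef(3) e f
        by (auto simp: labe_def min_def max_def split: if_splits)
      then have "a = a' \<and> c = c' \<or> a = c' \<and> c = a'" using leq v by (auto simp: doubleton_eq_iff)
      then show "e = f" using e f v by auto
    qed
  next
    fix p assume "p \<in> labe ` edges"
    then obtain a c where e: "(a, c) \<in> edges" "p = labe (a, c)" by auto
    then have v: "a \<in> verts" "c \<in> verts" "a < c" by (auto simp: edges_def)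
    then have "lab a \<noteq> lab c" "lab a < size_N" "lab c < size_N" using leq im by auto
    then show "p \<in> {(i, j). i < j \<and> j < size_N}" using e by (auto simp: labe_def)
  next
    fix p assume "p \<in> {(i, j). i < j \<and> j < size_N}"
    then obtain i j where ij: "p = (i, j)" "i < j" "j < size_N" by auto
    then have "i \<in> lab ` verts" "j \<in> lab ` verts" using im by auto
    then obtain v w where vw: "v \<in> verts" "w \<in> verts" "i = lab v" "j = lab w" by blast
    have "v \<noteq> w" using vw ij by auto
    then have "(min v w, max v w) \<in> edges" using vw by (auto simp: edges_def min_def max_def)
    moreover have "labe (min v w, max v w) = p" using ij vw by (auto simp: labe_def min_def max_def)
    ultimately show "p \<in> labe ` edges" by (metis image_eqI)
  qed
qed

lemma Lo_Up_meet:
  assumes "(a, c) \<in> edges" "(a', c') \<in> edges"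
  shows "Lo (a, c) \<inter> Up (a', c') \<noteq> {} \<longleftrightarrow>
    (\<not> isU a' \<and> a < a' \<and> a' < c) \<or> (\<not> isU c' \<and> a < c' \<and> c' < c) \<or>
    (isU a \<and> a' < a \<and> a < c') \<or> (isU c \<and> a' < c \<and> c < c')"
proof -
  have inI: "z \<in> I" if "z \<in> verts" "lo < z" "z < hi" for z using that by (auto simp: verts_def)
  have v: "a \<in> verts" "c \<in> verts" "a' \<in> verts" "c' \<in> verts" using assms by (auto simp: edges_def)
  have I: "z \<in> I" if "z \<in> verts" "u \<in> verts" "w \<in> verts" "u < z" "z < w" for u z w
    using inI[OF that(1)] verts_bnd[OF that(2)] verts_bnd[OF that(3)] that by linarith
  have "Lo (a, c) \<inter> Up (a', c') = {l. l \<in> I \<and> \<not> up l \<and> a < l \<and> l < c \<and> (l = a' \<or> l = c')} \<union>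
     {l. l \<in> I \<and> up l \<and> a' < l \<and> l < c' \<and> (l = a \<or> l = c)}"
    by (auto simp: Lo_def Up_def)
  also have "\<dots> \<noteq> {} \<longleftrightarrow> (a' \<in> I \<and> \<not> up a' \<and> a < a' \<and> a' < c) \<or> (c' \<in> I \<and> \<not> up c' \<and> a < c' \<and> c' < c) \<or>
    (a \<in> I \<and> up a \<and> a' < a \<and> a < c') \<or> (c \<in> I \<and> up c \<and> a' < c \<and> c < c')" by auto
  also have "(a' \<in> I \<and> \<not> up a' \<and> a < a' \<and> a' < c) \<longleftrightarrow> \<not> isU a' \<and> a < a' \<and> a' < c"
    using I[OF v(3) v(1,2)] unfolding isU_def by argo
  also have "(c' \<in> I \<and> \<not> up c' \<and> a < c' \<and> c' < c) \<longleftrightarrow> \<not> isU c' \<and> a < c' \<and> c' < c"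
    using I[OF v(4) v(1,2)] unfolding isU_def by argo
  finally show ?thesis unfolding isU_def by argo
qed

lemma xing_crosses:
  assumes e: "e \<in> edges" and f: "f \<in> edges" shows "xing e f \<longleftrightarrow> crosses (labe e) (labe f)"
proof -
  obtain a c where ee: "e = (a, c)" by (cases e)
  obtain a' c' where ff: "f = (a', c')" by (cases f)
  have e': "(a, c) \<in> edges" and f': "(a', c') \<in> edges" using e f ee ff by auto
  have v: "a \<in> verts" "c \<in> verts" "a' \<in> verts" "c' \<in> verts" and lt: "a < c" "a' < c'"
    using e' f' by (auto simp: edges_def)
  note ll = lab_less[OF v(1,3)] lab_less[OF v(1,4)] lab_less[OF v(2,3)] lab_less[OF v(2,4)]
    lab_less[OF v(3,1)] lab_less[OF v(3,2)] lab_less[OF v(4,1)] lab_less[OF v(4,2)]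
  \<comment> \<open>Vertices on different sides of the polygon are distinct and hence strictly
    comparable; this settles the ties in the case distinction.\<close>
  have ne: "isU a \<noteq> isU a' \<longrightarrow> a < a' \<or> a' < a" "isU a \<noteq> isU c' \<longrightarrow> a < c' \<or> c' < a"
    "isU c \<noteq> isU a' \<longrightarrow> c < a' \<or> a' < c" "isU c \<noteq> isU c' \<longrightarrow> c < c' \<or> c' < c"
    by (auto simp: not_less_iff_gr_or_eq)
  have x: "xing (a, c) (a', c') \<longleftrightarrow>
    (\<not> isU a' \<and> a < a' \<and> a' < c \<or> \<not> isU c' \<and> a < c' \<and> c' < c \<or> isU a \<and> a' < a \<and> a < c' \<or> isU c \<and> a' < c \<and> c < c') \<and>
    (\<not> isU a \<and> a' < a \<and> a < c' \<or> \<not> isU c \<and> a' < c \<and> c < c' \<or> isU a' \<and> a < a' \<and> a' < c \<or> isU c' \<and> a < c' \<and> c' < c)"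
    using Lo_Up_meet[OF e' f'] Lo_Up_meet[OF f' e'] unfolding xing_def by (simp add: Int_commute)
  show ?thesis
    unfolding ee ff x labe_edge[OF e'] labe_edge[OF f'] crosses_def
    using lt ne by (cases "isU a"; cases "isU c"; cases "isU a'"; cases "isU c'"; auto simp: ll)
qed

text \<open>Together with \<open>diagonals_iff\<close> this describes diagonals by crossings alone,
  so they are preserved by the labelling as soon as crossings are.\<close>

lemma diag_iff_xing: assumes e: "e \<in> edges" shows "e \<in> diag \<longleftrightarrow> (\<exists>f \<in> edges. xing e f)"
proof
  assume d: "e \<in> diag"
  then obtain l u where lu: "l \<in> Lo e" "u \<in> Up e" by (auto simp: diag_def)
  \<comment> \<open>The processed set containing only \<open>u\<close> violates \<open>e\<close>, so
    its path supplies a crossing edge.\<close>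
  then have "l \<notin> {u}" using Lo_Up_disj[OF e] by blast
  then obtain f where "f \<in> edges" "xing e f"
    by (rule crossing_path_edge[OF e lu(1) _ lu(2) singletonI]) blast
  then show "\<exists>f \<in> edges. xing e f" by blast
next
  assume "\<exists>f \<in> edges. xing e f"
  then show "e \<in> diag" using xing_diag[OF e] by blast
qed

lemma diagonals_iff:
  assumes "i < j" "j < N"
  shows "(i, j) \<in> diagonals N \<longleftrightarrow> (\<exists>p \<in> {(k, l). k < l \<and> l < N}. crosses (i, j) p)"
proof
  assume d: "(i, j) \<in> diagonals N"
  show "\<exists>p \<in> {(k, l). k < l \<and> l < N}. crosses (i, j) p"
  proof (cases "j + 1 < N")
    case True
    then have "crosses (i, j) (i + 1, j + 1)" using d by (simp add: crosses_def diagonals_def)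
    then show ?thesis using True assms by (intro bexI[of _ "(i + 1, j + 1)"]) auto
  next
    case False
    then have "0 < i" using d assms by (auto simp: diagonals_def)
    then have "crosses (i, j) (0, i + 1)" using d by (simp add: crosses_def diagonals_def)
    then show ?thesis using d assms by (intro bexI[of _ "(0, i + 1)"]) auto
  qed
next
  assume "\<exists>p \<in> {(k, l). k < l \<and> l < N}. crosses (i, j) p"
  then show "(i, j) \<in> diagonals N" using assms by (auto simp: crosses_def diagonals_def)
qed

lemma diag_diagonals: assumes e: "e \<in> edges" shows "e \<in> diag \<longleftrightarrow> labe e \<in> diagonals size_N"
proof -
  have im: "labe ` edges = {(i, j). i < j \<and> j < size_N}" using labe_bij by (simp add: bij_betw_def)
  obtain i j where ij: "labe e = (i, j)" "i < j" "j < size_N" using im e by (cases "labe e") blast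
  have "labe e \<in> diagonals size_N \<longleftrightarrow> (\<exists>p \<in> labe ` edges. crosses (labe e) p)"
    unfolding ij im by (rule diagonals_iff[OF ij(2,3)])
  also have "\<dots> \<longleftrightarrow> (\<exists>f \<in> edges. xing e f)" using xing_crosses[OF e] by auto
  finally show ?thesis using diag_iff_xing[OF e] by simp
qed

lemma noncrossing_labels:
  assumes "D \<subseteq> edges" shows "noncrossing D \<longleftrightarrow> labe ` D \<in> partial_triangulations size_N"
proof -
  have "D \<subseteq> diag \<longleftrightarrow> labe ` D \<subseteq> diagonals size_N" using diag_diagonals assms by blast
  moreover have "(\<forall>e \<in> D. \<forall>f \<in> D. \<not> xing e f) \<longleftrightarrow> (\<forall>d \<in> labe ` D. \<forall>d' \<in> labe ` D. \<not> crosses d d')"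
    using xing_crosses assms by blast
  ultimately show ?thesis unfolding noncrossing_def partial_triangulations_def by blast
qed

lemma partial_triangulation_labels:
  assumes "T \<in> partial_triangulations size_N" obtains D where "D \<subseteq> edges" "labe ` D = T" "noncrossing D"
proof -
  have "T \<subseteq> labe ` edges"
    using assms labe_bij by (auto simp: partial_triangulations_def diagonals_def bij_betw_def)
  then obtain D where "D \<subseteq> edges" "labe ` D = T" by (metis subset_image_iff)
  then show ?thesis using that noncrossing_labels assms by blast
qed

end

context cambrian begin

text \<open>Negation turns lower letters into upper ones and reverses their order, just as the
  labels run from left to right along the lower side and back along the upper one. Each side has
  \<open>n\<close> letters, and the extreme vertices get the labels \<open>0\<close> and
  \<open>n + 1\<close>.\<close>

lemma lab_antipode:
  assumes t: t and v: "v \<in> verts"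
  shows "size_N = 2 * n + 2" "lab (- v) = (lab v + n + 1) mod (2 * n + 2)"
proof -
  let ?U = "{z \<in> I. up z}" and ?L = "{z \<in> I. \<not> up z}"
  have fin: "finite ?U" "finite ?L" using finite_I by auto
  have UL: "?U = uminus ` ?L"
  proof (intro equalityI subsetI)
    fix z assume "z \<in> ?U"
    then have "- z \<in> ?L" using up_neg[OF t] I_neg[OF t] by auto
    then show "z \<in> uminus ` ?L" by (rule rev_image_eqI) simp
  qed (use up_neg[OF t] I_neg[OF t] in auto)
  have II: "I = {1..int n} \<union> {- int n..- 1}" using t by (auto simp: I_def)
  have "card I = 2 * n" unfolding II by (subst card_Un_disjoint) auto
  moreover have "card I = card ?U + card ?L"
    by (subst card_Un_disjoint[symmetric]) (use fin in \<open>auto intro: arg_cong[of _ _ card]\<close>)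
  moreover have "card ?U = card ?L" unfolding UL by (simp add: card_image)
  ultimately have cn: "card ?U = n" "card ?L = n" by auto
  have lh: "lo \<notin> I" "hi \<notin> I" "lo < hi" using bnd[of lo] bnd[of hi] lohi by blast+
  have neg: "- lo = hi" "- hi = lo" using t by (simp_all add: lo_def hi_def)
  have Uv: "{z \<in> verts. isU z} = ?U" by (auto simp: isU_def verts_def)
  have Lv: "{z \<in> verts. \<not> isU z} = insert lo (insert hi ?L)" using lh by (auto simp: isU_def verts_def)
  have cL: "card {z \<in> verts. \<not> isU z} = n + 2" unfolding Lv using fin lh cn by simp
  show N: "size_N = 2 * n + 2" using size_N_split cL Uv cn by simp
  have low: "lab (- v) = lab v + n + 1" if v: "v \<in> I" "\<not> up v" for v
  proof -
    have nu: "isU (- v)" "\<not> isU v" "- v \<in> verts" using v up_neg[OF t] I_neg[OF t] by (auto simp: isU_def verts_def)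
    have "{z \<in> verts. \<not> isU z \<and> z < v} = insert lo {z \<in> ?L. z < v}"
      using v bnd[OF v(1)] lh by (auto simp: isU_def verts_def)
    then have lv: "lab v = 1 + card {z \<in> ?L. z < v}" using nu finite_I lh by (simp add: lab_def)
    \<comment> \<open>The lower letters to the right of \<open>v\<close> are the negatives of the
      upper letters to the left of \<open>- v\<close>; together with \<open>v\<close> and the lower
      letters to its left they count to \<open>n\<close>.\<close>
    have "{z \<in> verts. isU z \<and> z < - v} = uminus ` {z \<in> ?L. v < z}"
    proof -
      have "{z \<in> verts. isU z \<and> z < - v} = {z \<in> ?U. z < - v}" by (auto simp: isU_def verts_def)
      then show ?thesis unfolding UL by force
    qed
    then have "lab (- v) + card {z \<in> ?L. v < z} = 2 * n + 1"
      using lab_upper(3)[OF nu(1,3)] N by (simp add: card_image)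
    moreover have "?L = insert v ({z \<in> ?L. z < v} \<union> {z \<in> ?L. v < z})" using v by auto
    then have "card ?L = Suc (card ({z \<in> ?L. z < v} \<union> {z \<in> ?L. v < z}))"
      using fin by (metis (no_types, lifting) UnE card_insert_disjoint finite_Un finite_subset less_irrefl mem_Collect_eq subset_insertI)
    then have "n = 1 + card {z \<in> ?L. z < v} + card {z \<in> ?L. v < z}"
      using cn finite_I by (subst (asm) card_Un_disjoint) auto
    ultimately show ?thesis using lv by linarith
  qed
  have llo: "lab lo = 0"
  proof -
    have "{z \<in> verts. \<not> isU z \<and> z < lo} = {}" using verts_bnd by force
    moreover have "\<not> isU lo" using lh by (simp add: isU_def)
    ultimately show ?thesis by (simp only: lab_def if_False card.empty)
  qed
  have lhi: "lab hi = n + 1"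
  proof -
    have "{z \<in> verts. \<not> isU z \<and> z < hi} = insert lo ?L"
      using lh bnd by (auto simp: isU_def verts_def)
    then show ?thesis using lh cn fin by (simp add: lab_def isU_def)
  qed
  have "lab v < size_N" using lab_bij v by (auto simp: bij_betw_def)
  consider "v = lo" | "v = hi" | "v \<in> I" "\<not> up v" | "v \<in> I" "up v" using v by (auto simp: verts_def)
  then show "lab (- v) = (lab v + n + 1) mod (2 * n + 2)"
  proof cases
    case 1 then show ?thesis using llo lhi neg(1) by simp
  next
    case 2
    then have "lab v + n + 1 = 2 * n + 2" using lhi by simp
    then have "(lab v + n + 1) mod (2 * n + 2) = 0" by (simp only: mod_self)
    then show ?thesis using 2 llo neg(2) by simp
  next
    case 3
    have "- v \<in> verts" using verts_neg[OF t v] .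
    then have "lab (- v) < 2 * n + 2" using lab_bij N by (auto simp: bij_betw_def)
    then show ?thesis using low[OF 3] by simp
  next
    case 4
    have "lab v = lab (- v) + n + 1" using low[of "- v"] 4 up_neg[OF t] I_neg[OF t] by simp
    then have "lab v + n + 1 = lab (- v) + (2 * n + 2)" by simp
    moreover have "lab (- v) < 2 * n + 2" using \<open>lab v < size_N\<close> N \<open>lab v = lab (- v) + n + 1\<close> by simp
    ultimately show ?thesis by (metis mod_add_self2 mod_less)
  qed
qed

lemma labe_antipode:
  assumes t: t and e: "e \<in> edges" shows "antipode n (labe e) = labe (neg_edge e)"
proof -
  have v: "fst e \<in> verts" "snd e \<in> verts" using e by (auto simp: edges_def)
  show ?thesis
    using lab_antipode(2)[OF t v(1)] lab_antipode(2)[OF t v(2)]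
    by (auto simp: antipode_def labe_def neg_edge_def Let_def min_def max_def)
qed

definition polygon_fan :: "(nat \<times> nat) set set" where
  "polygon_fan = (if t then cs_partial_triangulations n else partial_triangulations (n + 2))"

lemma sym_noncrossing_labels: "(`) labe ` sym_noncrossing = polygon_fan"
proof -
  have inj: "inj_on labe edges" using labe_bij by (simp add: bij_betw_def)
  have lohiV: "lo \<in> verts" by (simp add: verts_def)
  have N: "size_N = (if t then 2 * n + 2 else n + 2)"
  proof (cases t)
    case True then show ?thesis using lab_antipode(1)[OF True lohiV] by simp
  next
    case False
    have "I = {1..int n}" using False by (auto simp: I_def)
    then have "card I = n" by simp
    moreover have "lo \<notin> I" "hi \<notin> I" using bnd[of lo] bnd[of hi] by blast+
    moreover have "lo \<noteq> hi" using lohi by simp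
    ultimately have "size_N = n + 2" using finite_I by (simp add: size_N_def verts_def)
    then show ?thesis using False by simp
  qed
  have sym: "neg_edge ` D \<subseteq> D \<longleftrightarrow> (\<forall>d \<in> labe ` D. antipode n d \<in> labe ` D)"
    if t: t and D: "D \<subseteq> edges" for D
  proof -
    have ne: "neg_edge e \<in> edges" if "e \<in> D" for e
      using verts_neg[OF t] that D by (auto simp: edges_def neg_edge_def)
    have "neg_edge e \<in> D \<longleftrightarrow> antipode n (labe e) \<in> labe ` D" if "e \<in> D" for e
      using labe_antipode[OF t, of e] that D inj_on_image_mem_iff[OF inj ne[OF that] D] by (metis subsetD)
    then show ?thesis by auto
  qed
  show ?thesis
  proof (intro equalityI subsetI)
    fix T assume "T \<in> (`) labe ` sym_noncrossing"
    then obtain D where D: "noncrossing D" "t \<longrightarrow> neg_edge ` D \<subseteq> D" "T = labe ` D"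
      by (auto simp: sym_noncrossing_def)
    have De: "D \<subseteq> edges" using D diag_edges by (auto simp: noncrossing_def)
    then have "T \<in> partial_triangulations size_N" using noncrossing_labels D by blast
    then show "T \<in> polygon_fan"
      using N sym[OF _ De] D by (auto simp: polygon_fan_def cs_partial_triangulations_def)
  next
    fix T assume T: "T \<in> polygon_fan"
    then have "T \<in> partial_triangulations size_N"
      using N by (auto simp: polygon_fan_def cs_partial_triangulations_def split: if_splits)
    then obtain D where D: "D \<subseteq> edges" "labe ` D = T" "noncrossing D"
      using partial_triangulation_labels by blast
    have "neg_edge ` D \<subseteq> D" if t
      using sym[OF that D(1)] T that D(2) by (auto simp: polygon_fan_def cs_partial_triangulations_def)
    then show "T \<in> (`) labe ` sym_noncrossing" using D by (auto simp: sym_noncrossing_def)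
  qed
qed

lemma fan_iso: "comb_iso (cong_fan n S chamber camb_rel) polygon_fan"
proof -
  have inj: "inj_on labe edges" using labe_bij by (simp add: bij_betw_def)
  have De: "D \<subseteq> edges" if "D \<in> sym_noncrossing" for D
    using that diag_edges by (auto simp: sym_noncrossing_def noncrossing_def)
  have cinj: "inj_on cone sym_noncrossing"
    by (rule inj_onI) (use cone_mono_iff in blast)
  let ?g = "inv_into sym_noncrossing cone"
  have g: "?g (cone D) = D" if "D \<in> sym_noncrossing" for D using inv_into_f_f[OF cinj that] .
  have linj: "inj_on ((`) labe) sym_noncrossing"
    by (rule inj_onI) (use inj_on_image_eq_iff[OF inj] De in blast)
  have "bij_betw ((`) labe) sym_noncrossing polygon_fan"
    using linj sym_noncrossing_labels by (simp add: bij_betw_def)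
  moreover have "bij_betw ?g (cone ` sym_noncrossing) sym_noncrossing"
    by (rule bij_betw_inv_into) (use cinj in \<open>simp add: bij_betw_def\<close>)
  ultimately have bij: "bij_betw ((`) labe \<circ> ?g) (cone ` sym_noncrossing) polygon_fan"
    by (rule bij_betw_trans[rotated])
  have "C \<subseteq> C' \<longleftrightarrow> ((`) labe \<circ> ?g) C \<subseteq> ((`) labe \<circ> ?g) C'"
    if "C \<in> cone ` sym_noncrossing" "C' \<in> cone ` sym_noncrossing" for C C'
  proof -
    from that obtain D D' where D: "D \<in> sym_noncrossing" "C = cone D" "D' \<in> sym_noncrossing" "C' = cone D'"
      by auto
    have "e \<in> D'" if "e \<in> D" "labe ` D \<subseteq> labe ` D'" for e
      using inj_on_image_mem_iff[OF inj _ De[OF D(3)], of e] De[OF D(1)] that by blast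
    then have "labe ` D \<subseteq> labe ` D' \<longleftrightarrow> D \<subseteq> D'" by blast
    then show ?thesis using D g cone_mono_iff by simp
  qed
  then show ?thesis unfolding comb_iso_def fan_eq using bij by blast
qed

end

section \<open>Coxeter diagrams and generating pairs in terms of exchanges\<close>

lemma cox_orderI:
  assumes "0 < m" "(s \<circ> t) ^^ m = id" "\<And>j. 0 < j \<Longrightarrow> j < m \<Longrightarrow> (s \<circ> t) ^^ j \<noteq> id"
  shows "cox_order s t = m"
  unfolding cox_order_def by (rule Least_equality) (use assms in \<open>auto simp: not_less[symmetric]\<close>)

lemma cox_order_le: "0 < m \<Longrightarrow> (s \<circ> t) ^^ m = id \<Longrightarrow> cox_order s t \<le> m"
  unfolding cox_order_def by (rule Least_le) simp

lemma cox_order_commute_le: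
  assumes "s \<circ> s = id" "t \<circ> t = id" "s \<circ> t = t \<circ> s" shows "cox_order s t \<le> 2"
proof (rule cox_order_le)
  have "(s \<circ> t) \<circ> (s \<circ> t) = s \<circ> (t \<circ> s) \<circ> t" by (simp add: comp_assoc)
  also have "\<dots> = (s \<circ> s) \<circ> (t \<circ> t)" unfolding assms(3)[symmetric] by (simp only: comp_assoc)
  finally show "(s \<circ> t) ^^ 2 = id" using assms by (simp add: numeral_2_eq_2)
qed simp

lemma cox_order_sgen:
  assumes i: "1 \<le> i"
  shows "cox_order (sgen i) (sgen (i + 1)) = 3" "cox_order (sgen (i + 1)) (sgen i) = 3"
proof -
  let ?s = "sgen i" and ?u = "sgen (i + 1)"
  have fx: "?s k = k" "?u k = k" if "k \<notin> {i, i + 1, i + 2, - i, - i - 1, - i - 2}" for k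
    using that by (auto simp: sgen_def)
  have ev: "?s i = i + 1" "?s (i + 1) = i" "?s (i + 2) = i + 2" "?s (- i) = - i - 1" "?s (- i - 1) = - i"
    "?s (- i - 2) = - i - 2" "?u i = i" "?u (i + 1) = i + 2" "?u (i + 2) = i + 1" "?u (- i) = - i"
    "?u (- i - 1) = - i - 2" "?u (- i - 2) = - i - 1"
    using i by (auto simp: sgen_def)
  have "((?s \<circ> ?u) ^^ 3) k = k \<and> ((?u \<circ> ?s) ^^ 3) k = k" for k
  proof (cases "k \<in> {i, i + 1, i + 2, - i, - i - 1, - i - 2}")
    case True
    then show ?thesis by (elim insertE emptyE) (simp_all add: ev numeral_3_eq_3)
  next
    case False
    then show ?thesis by (simp add: fx numeral_3_eq_3)
  qed
  then have c: "(?s \<circ> ?u) ^^ 3 = id" "(?u \<circ> ?s) ^^ 3 = id" by auto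
  have n: "((?s \<circ> ?u) ^^ j) i \<noteq> i \<and> ((?u \<circ> ?s) ^^ j) i \<noteq> i" if "0 < j" "j < 3" for j
  proof -
    have "j = 1 \<or> j = 2" using that by auto
    then show ?thesis by (elim disjE) (simp_all add: ev numeral_2_eq_2)
  qed
  show "cox_order ?s ?u = 3" by (rule cox_orderI) (use c n in \<open>auto simp: fun_eq_iff\<close>)
  show "cox_order ?u ?s = 3" by (rule cox_orderI) (use c n in \<open>auto simp: fun_eq_iff\<close>)
qed

lemma cox_order_s0: "cox_order s0 (sgen 1) = 4" "cox_order (sgen 1) s0 = 4"
proof -
  let ?s = "s0" and ?u = "sgen 1"
  have fx: "?s k = k" "?u k = k" if "k \<notin> {1, 2, - 1, - 2}" for k
    using that by (auto simp: sgen_def s0_def)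
  have ev: "?s 1 = - 1" "?s (- 1) = 1" "?s 2 = 2" "?s (- 2) = - 2" "?u 1 = 2" "?u 2 = 1" "?u (- 1) = - 2" "?u (- 2) = - 1"
    by (auto simp: sgen_def s0_def)
  have 4: "(4::nat) = Suc (Suc (Suc (Suc 0)))" by simp
  have "((?s \<circ> ?u) ^^ 4) k = k \<and> ((?u \<circ> ?s) ^^ 4) k = k" for k
  proof (cases "k \<in> {1, 2, - 1, - 2}")
    case True
    then show ?thesis unfolding 4 by (elim insertE emptyE) (simp_all add: ev)
  next
    case False
    then show ?thesis unfolding 4 by (simp add: fx)
  qed
  then have c: "(?s \<circ> ?u) ^^ 4 = id" "(?u \<circ> ?s) ^^ 4 = id" by auto
  have n: "((?s \<circ> ?u) ^^ j) 1 \<noteq> 1 \<and> ((?u \<circ> ?s) ^^ j) 1 \<noteq> 1" if "0 < j" "j < 4" for j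
  proof -
    have "j = 1 \<or> j = 2 \<or> j = 3" using that by auto
    then show ?thesis by (elim disjE) (simp_all add: ev numeral_2_eq_2 numeral_3_eq_3)
  qed
  show "cox_order ?s ?u = 4" by (rule cox_orderI) (use c n in \<open>auto simp: fun_eq_iff\<close>)
  show "cox_order ?u ?s = 4" by (rule cox_orderI) (use c n in \<open>auto simp: fun_eq_iff\<close>)
qed

lemma alt_word_2: "alt_word t s 2 = t \<circ> s"
  by (simp add: alt_word_def word_prod_def upt_rec)

lemma alt_word_3: "alt_word t s 3 = t \<circ> (s \<circ> t)"
  by (simp add: alt_word_def word_prod_def upt_rec)

lemma sgen_neq: assumes "i < j" "1 \<le> i" shows "sgen i \<noteq> sgen j"
proof
  assume "sgen i = sgen j"
  then have "sgen i i = sgen j i" by simp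
  then show False using assms by (simp add: sgen_def)
qed

lemma sgen_s0: assumes "1 \<le> i" shows "sgen i \<noteq> s0"
proof
  assume "sgen i = s0"
  then have "sgen i (i + 1) = s0 (i + 1)" by simp
  then show False using assms by (simp add: sgen_def s0_def)
qed

context coxeter begin

lemma S_cases:
  assumes "s \<in> S" obtains i where "1 \<le> i" "i < int n" "s = sgen i" | "t" "s = s0"
  using assms by (auto simp: S_def S_A_def S_B_def t_def split: if_splits)

lemma sgen_S: "1 \<le> i \<Longrightarrow> i < int n \<Longrightarrow> sgen i \<in> S"
  by (auto simp: S_def S_A_def S_B_def)

lemma s0_S: "t \<Longrightarrow> s0 \<in> S"
  by (auto simp: S_def S_B_def)

lemma not_diagram_edge_far:
  assumes "1 \<le> i" "i + 1 < j"
  shows "\<not> diagram_edge S (sgen i) (sgen j)" "\<not> diagram_edge S (sgen j) (sgen i)"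
proof -
  have c: "sgen i \<circ> sgen j = sgen j \<circ> sgen i"
    using assms by (intro ext) (simp add: sgen_def)
  have inv: "sgen i \<circ> sgen i = id" "sgen j \<circ> sgen j = id"
    unfolding sgen_swp using assms by auto
  show "\<not> diagram_edge S (sgen i) (sgen j)" "\<not> diagram_edge S (sgen j) (sgen i)"
    using cox_order_commute_le[OF inv c] cox_order_commute_le[OF inv(2,1) c[symmetric]]
    by (auto simp: diagram_edge_def)
qed

lemma not_diagram_edge_s0:
  assumes "2 \<le> j" shows "\<not> diagram_edge S s0 (sgen j)" "\<not> diagram_edge S (sgen j) s0"
proof -
  have c: "s0 \<circ> sgen j = sgen j \<circ> s0" using assms by (intro ext) (simp add: sgen_def s0_def)
  have inv: "s0 \<circ> s0 = id" "sgen j \<circ> sgen j = id" unfolding sgen_swp s0_swp using assms by auto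
  show "\<not> diagram_edge S s0 (sgen j)" "\<not> diagram_edge S (sgen j) s0"
    using cox_order_commute_le[OF inv c] cox_order_commute_le[OF inv(2,1) c[symmetric]]
    by (auto simp: diagram_edge_def)
qed

lemma diagram_edge_sgen:
  assumes "2 \<le> b" "b < int n"
  shows "diagram_edge S (sgen (b - 1)) (sgen b)" "diagram_edge S (sgen b) (sgen (b - 1))"
  using cox_order_sgen[of "b - 1"] sgen_neq[of "b - 1" b] sgen_S[of b] sgen_S[of "b - 1"] assms
  by (simp_all add: diagram_edge_def)

lemma diagram_edge_s0:
  assumes "t" "2 \<le> n" shows "diagram_edge S s0 (sgen 1)" "diagram_edge S (sgen 1) s0"
  using cox_order_s0 sgen_s0[of 1] sgen_S[of 1] s0_S assms by (auto simp: diagram_edge_def)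

lemma diagram_edge_cases:
  assumes "diagram_edge S s r"
  obtains b where "2 \<le> b" "b < int n" "s = sgen (b - 1)" "r = sgen b"
  | b where "2 \<le> b" "b < int n" "s = sgen b" "r = sgen (b - 1)"
  | "t" "2 \<le> n" "s = s0" "r = sgen 1" | "t" "2 \<le> n" "s = sgen 1" "r = s0"
proof -
  have sr: "s \<in> S" "r \<in> S" "s \<noteq> r" using assms by (auto simp: diagram_edge_def)
  show ?thesis
  proof (rule S_cases[OF sr(1)]; rule S_cases[OF sr(2)])
    fix i j assume ij: "1 \<le> i" "i < int n" "s = sgen i" "1 \<le> j" "j < int n" "r = sgen j"
    have "i \<noteq> j" "\<not> i + 1 < j" "\<not> j + 1 < i"
      using ij sr not_diagram_edge_far[of i j] not_diagram_edge_far[of j i] assms by auto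
    then have "j = i + 1 \<or> i = j + 1" by linarith
    then show ?thesis using that(1)[of j] that(2)[of i] ij by auto
  next
    fix i assume i: "1 \<le> i" "i < int n" "s = sgen i" "t" "r = s0"
    have "i = 1" using i not_diagram_edge_s0[of i] assms by force
    then show ?thesis using that(4) i by simp
  next
    fix j assume j: "t" "s = s0" "1 \<le> j" "j < int n" "r = sgen j"
    have "j = 1" using j not_diagram_edge_s0[of j] assms by force
    then show ?thesis using that(3) j by simp
  next
    assume "s = s0" "r = s0"
    then show ?thesis using sr by simp
  qed
qed

end

text \<open>For \<open>b > 0\<close> the letter \<open>b\<close> belongs to the diagram edge between
  the two generators that move it, and it is upper if this edge leaves the generator moving it
  upwards. For an orientation the end letter \<open>n\<close>, and \<open>1\<close> in type A,
  correspond to no diagram edge and become lower by default; negative letters get the opposite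
  side.\<close>

definition up_orient :: "(perm \<times> perm) set \<Rightarrow> int \<Rightarrow> bool" where
  "up_orient Or b = (let u = (\<lambda>b. if b = 1 then (sgen 1, s0) \<in> Or else (sgen b, sgen (b - 1)) \<in> Or)
     in if 0 < b then u b else \<not> u (- b))"

locale oriented = coxeter +
  fixes Or :: "(perm \<times> perm) set"
  assumes orient: "orientation S Or"
begin

sublocale cambrian typeB n "up_orient Or"
  by unfold_locales (auto simp: up_orient_def Let_def dest: I_nz)

lemma Or_edge: "(s, r) \<in> Or \<Longrightarrow> diagram_edge S s r"
  using orient by (auto simp: orientation_def)

lemma Or_one: "diagram_edge S s r \<Longrightarrow> (s, r) \<in> Or \<longleftrightarrow> (r, s) \<notin> Or"
  using orient by (auto simp: orientation_def)

lemma Or_sgen: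
  assumes "2 \<le> b" "b < int n"
  shows "(sgen b, sgen (b - 1)) \<in> Or \<longleftrightarrow> up_orient Or b" "(sgen (b - 1), sgen b) \<in> Or \<longleftrightarrow> \<not> up_orient Or b"
  using Or_one[OF diagram_edge_sgen(1)[OF assms]] assms by (auto simp: up_orient_def)

lemma Or_s0:
  assumes "t" "2 \<le> n"
  shows "(sgen 1, s0) \<in> Or \<longleftrightarrow> up_orient Or 1" "(s0, sgen 1) \<in> Or \<longleftrightarrow> \<not> up_orient Or 1"
  using Or_one[OF diagram_edge_s0(1)[OF assms]] by (auto simp: up_orient_def)

lemma gen_words:
  assumes b: "2 \<le> b" "b < int n"
  shows "alt_word (sgen b) (sgen (b - 1)) (cox_order (sgen (b - 1)) (sgen b) - 1) = swp (b - 1) (b + 1) \<circ> swp b (b + 1)"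
    "alt_word (sgen (b - 1)) (sgen b) (cox_order (sgen b) (sgen (b - 1)) - 1) = swp (b - 1) (b + 1) \<circ> swp (b - 1) b"
proof -
  have o: "cox_order (sgen (b - 1)) (sgen b) = 3" "cox_order (sgen b) (sgen (b - 1)) = 3"
    using cox_order_sgen[of "b - 1"] b by auto
  have W: "sgen b \<in> W" "sgen (b - 1) \<in> W" using S_W sgen_S b by auto
  \<comment> \<open>Conjugation carries the second factor to the left. The alternating word thus
    becomes the exchange of \<open>b - 1\<close> and \<open>b + 1\<close> on top of the generator it
    is paired with.\<close>
  have "sgen b \<circ> swp (b - 1) b = swp (b - 1) (b + 1) \<circ> sgen b"
    using conj_swp[OF W(1), of "b - 1" b] b by (simp add: sgen_def)
  then show "alt_word (sgen b) (sgen (b - 1)) (cox_order (sgen (b - 1)) (sgen b) - 1) = swp (b - 1) (b + 1) \<circ> swp b (b + 1)"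
    unfolding o by (simp add: alt_word_2 sgen_swp)
  have "sgen (b - 1) \<circ> swp b (b + 1) = swp (b - 1) (b + 1) \<circ> sgen (b - 1)"
    using conj_swp[OF W(2), of b "b + 1"] b by (simp add: sgen_def)
  then show "alt_word (sgen (b - 1)) (sgen b) (cox_order (sgen b) (sgen (b - 1)) - 1) = swp (b - 1) (b + 1) \<circ> swp (b - 1) b"
    unfolding o by (simp add: alt_word_2 sgen_swp)
qed

lemma gen0_words:
  shows "alt_word (sgen 1) s0 (cox_order s0 (sgen 1) - 1) = swp (- 2) 1 \<circ> (swp (- 2) 2 \<circ> swp 1 2)"
    "alt_word s0 (sgen 1) (cox_order (sgen 1) s0 - 1) = swp (- 2) 2 \<circ> (swp (- 1) 2 \<circ> swp (- 1) 1)"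
  unfolding cox_order_s0
  by (simp_all add: alt_word_3 fun_eq_iff sgen_def s0_def swp_def)

lemma gens_iff:
  "(\<forall>(s, r) \<in> Or. (r, alt_word r s (cox_order s r - 1)) \<in> \<Theta>) \<longleftrightarrow>
   (\<forall>b. 2 \<le> b \<and> b < int n \<and> \<not> up_orient Or b \<longrightarrow> (swp b (b + 1), swp (b - 1) (b + 1) \<circ> swp b (b + 1)) \<in> \<Theta>) \<and>
   (\<forall>b. 2 \<le> b \<and> b < int n \<and> up_orient Or b \<longrightarrow> (swp (b - 1) b, swp (b - 1) (b + 1) \<circ> swp (b - 1) b) \<in> \<Theta>) \<and>
   (t \<and> 2 \<le> n \<and> \<not> up_orient Or 1 \<longrightarrow> (swp 1 2, swp (- 2) 1 \<circ> (swp (- 2) 2 \<circ> swp 1 2)) \<in> \<Theta>) \<and>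
   (t \<and> 2 \<le> n \<and> up_orient Or 1 \<longrightarrow> (swp (- 1) 1, swp (- 2) 2 \<circ> (swp (- 1) 2 \<circ> swp (- 1) 1)) \<in> \<Theta>)"
  (is "?L \<longleftrightarrow> ?R1 \<and> ?R2 \<and> ?R3 \<and> ?R4")
proof -
  have sw: "sgen b = swp b (b + 1)" "sgen (b - 1) = swp (b - 1) b" "sgen 1 = swp 1 2" "s0 = swp (- 1) 1" for b
    by (simp_all add: sgen_swp s0_swp)
  have D: "(r, alt_word r s (cox_order s r - 1)) \<in> \<Theta>" if ?L "(s, r) \<in> Or" for s r using that by auto
  show ?thesis
  proof (intro iffI conjI allI impI)
    fix b assume L: ?L and b: "2 \<le> b \<and> b < int n \<and> \<not> up_orient Or b"
    then show "(swp b (b + 1), swp (b - 1) (b + 1) \<circ> swp b (b + 1)) \<in> \<Theta>"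
      using D[OF L, of "sgen (b - 1)" "sgen b"] Or_sgen(2)[of b] gen_words(1)[of b] sw(1)[of b] by simp
  next
    fix b assume L: ?L and b: "2 \<le> b \<and> b < int n \<and> up_orient Or b"
    then show "(swp (b - 1) b, swp (b - 1) (b + 1) \<circ> swp (b - 1) b) \<in> \<Theta>"
      using D[OF L, of "sgen b" "sgen (b - 1)"] Or_sgen(1)[of b] gen_words(2)[of b] sw(2)[of b] by simp
  next
    assume L: ?L and b: "t \<and> 2 \<le> n \<and> \<not> up_orient Or 1"
    then show "(swp 1 2, swp (- 2) 1 \<circ> (swp (- 2) 2 \<circ> swp 1 2)) \<in> \<Theta>"
      using D[OF L, of s0 "sgen 1"] Or_s0(2) gen0_words(1) sw(3) by simp
  next
    assume L: ?L and b: "t \<and> 2 \<le> n \<and> up_orient Or 1"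
    then show "(swp (- 1) 1, swp (- 2) 2 \<circ> (swp (- 1) 2 \<circ> swp (- 1) 1)) \<in> \<Theta>"
      using D[OF L, of "sgen 1" s0] Or_s0(1) gen0_words(2) sw(4) by simp
  next
    assume R: "?R1 \<and> ?R2 \<and> ?R3 \<and> ?R4"
    have "(r, alt_word r s (cox_order s r - 1)) \<in> \<Theta>" if Or: "(s, r) \<in> Or" for s r
    proof (rule diagram_edge_cases[OF Or_edge[OF Or]])
      fix b assume b: "2 \<le> b" "b < int n" "s = sgen (b - 1)" "r = sgen b"
      then show ?thesis using R Or Or_sgen(2)[of b] gen_words(1)[of b] sw(1)[of b] by simp
    next
      fix b assume b: "2 \<le> b" "b < int n" "s = sgen b" "r = sgen (b - 1)"
      then show ?thesis using R Or Or_sgen(1)[of b] gen_words(2)[of b] sw(2)[of b] by simp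
    next
      assume b: "t" "2 \<le> n" "s = s0" "r = sgen 1"
      then show ?thesis using R Or Or_s0(2) gen0_words(1) sw(3) by simp
    next
      assume b: "t" "2 \<le> n" "s = sgen 1" "r = s0"
      then show ?thesis using R Or Or_s0(1) gen0_words(2) sw(4) by simp
    qed
    then show ?L by blast
  qed
qed

lemma cstepI:
  "x \<in> W \<Longrightarrow> p < q \<Longrightarrow> consec (inv x p) (inv x q) \<Longrightarrow> ctr I (up_orient Or) (inv x) p q \<Longrightarrow>
    cstep x (swp p q \<circ> x)"
  unfolding cstep_def by blast

lemma cstep_camb_rel: assumes "cstep x y" shows "(x, y) \<in> camb_rel"
  using cstep_W[OF assms] cstep_invariants(1)[OF assms] by (simp add: camb_rel_def)

lemma camb_rel_trans: "(x, y) \<in> camb_rel \<Longrightarrow> (y, z) \<in> camb_rel \<Longrightarrow> (x, z) \<in> camb_rel"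
  by (simp add: camb_rel_def)

lemma camb_rel_gens: "\<forall>(s, r) \<in> Or. (r, alt_word r s (cox_order s r - 1)) \<in> camb_rel"
  unfolding gens_iff
proof (intro conjI allI impI)
  fix b assume b: "2 \<le> b \<and> b < int n \<and> \<not> up_orient Or b"
  have I: "b - 1 \<in> I" "b \<in> I" "b + 1 \<in> I" using b by (auto simp: I_def)
  have c: "consec b (b + 1)" "consec (b - 1) b" using I by (auto simp: consec_iff)
  have W: "swp b (b + 1) \<in> W" using S_W S_iff c by blast
  have iv: "inv (swp b (b + 1)) = swp b (b + 1)" using inv_swp b by simp
  have "wit (up_orient Or) (inv (swp b (b + 1))) b (b - 1) (b + 1)"
    unfolding iv using b by (simp add: wit_def swp_def)
  then have "ctr I (up_orient Or) (inv (swp b (b + 1))) (b - 1) (b + 1)" using I by (auto simp: ctr_def)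
  moreover have "consec (inv (swp b (b + 1)) (b - 1)) (inv (swp b (b + 1)) (b + 1))"
    unfolding iv using b c by (simp add: swp_def)
  ultimately have "cstep (swp b (b + 1)) (swp (b - 1) (b + 1) \<circ> swp b (b + 1))"
    using W by (intro cstepI) auto
  then show "(swp b (b + 1), swp (b - 1) (b + 1) \<circ> swp b (b + 1)) \<in> camb_rel" by (rule cstep_camb_rel)
next
  fix b assume b: "2 \<le> b \<and> b < int n \<and> up_orient Or b"
  have I: "b - 1 \<in> I" "b \<in> I" "b + 1 \<in> I" using b by (auto simp: I_def)
  have c: "consec b (b + 1)" "consec (b - 1) b" using I by (auto simp: consec_iff)
  have W: "swp (b - 1) b \<in> W" using S_W S_iff c by blast
  have iv: "inv (swp (b - 1) b) = swp (b - 1) b" using inv_swp b by simp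
  have "wit (up_orient Or) (inv (swp (b - 1) b)) b (b - 1) (b + 1)"
    unfolding iv using b by (simp add: wit_def swp_def)
  then have "ctr I (up_orient Or) (inv (swp (b - 1) b)) (b - 1) (b + 1)" using I by (auto simp: ctr_def)
  moreover have "consec (inv (swp (b - 1) b) (b - 1)) (inv (swp (b - 1) b) (b + 1))"
    unfolding iv using b c by (simp add: swp_def)
  ultimately have "cstep (swp (b - 1) b) (swp (b - 1) (b + 1) \<circ> swp (b - 1) b)"
    using W by (intro cstepI) auto
  then show "(swp (b - 1) b, swp (b - 1) (b + 1) \<circ> swp (b - 1) b) \<in> camb_rel" by (rule cstep_camb_rel)
next
  assume b: "t \<and> 2 \<le> n \<and> \<not> up_orient Or 1"
  \<comment> \<open>The generating pair of label 4 consists of two contracted covers: the central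
    exchange of \<open>-2\<close> and \<open>2\<close> with the lower witness \<open>1\<close>,
    followed by that of \<open>-2\<close> and \<open>1\<close> with the upper witness
    \<open>-1\<close>.\<close>
  let ?p = "swp 1 2" let ?m = "swp (- 2) 2 \<circ> ?p"
  have I: "1 \<in> I" "2 \<in> I" "- 1 \<in> I" "- 2 \<in> I" using b by (auto simp: I_def)
  have c: "consec 1 2" "consec (- 1) 1" using I by (auto simp: consec_iff)
  have W: "?p \<in> W" using S_W S_iff c by blast
  have iv: "inv ?p = swp 1 2" using inv_swp by simp
  have up1: "up_orient Or (- 1)" using b up_neg[of 1] I by simp
  have "wit (up_orient Or) (inv ?p) 1 (- 2) 2" unfolding iv using b by (simp add: wit_def swp_def)
  then have "ctr I (up_orient Or) (inv ?p) (- 2) 2" using I by (auto simp: ctr_def)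
  moreover have "consec (inv ?p (- 2)) (inv ?p 2)" unfolding iv using c by (simp add: swp_def)
  ultimately have 1: "cstep ?p ?m" using W by (intro cstepI) auto
  have im: "inv ?m r = swp 1 2 (swp (- 2) 2 r)" for r using inv_flip[OF W, of "- 2" 2] iv by simp
  have "wit (up_orient Or) (inv ?m) (- 1) (- 2) 1" using up1 by (simp add: wit_def im) (simp add: swp_def)
  then have "ctr I (up_orient Or) (inv ?m) (- 2) 1" using I by (auto simp: ctr_def)
  moreover have "consec (inv ?m (- 2)) (inv ?m 1)" unfolding im using c by (simp add: swp_def)
  ultimately have 2: "cstep ?m (swp (- 2) 1 \<circ> ?m)" using cstep_W(2)[OF 1] by (intro cstepI) auto
  show "(?p, swp (- 2) 1 \<circ> ?m) \<in> camb_rel"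
    by (rule camb_rel_trans[OF cstep_camb_rel[OF 1] cstep_camb_rel[OF 2]])
next
  assume b: "t \<and> 2 \<le> n \<and> up_orient Or 1"
  \<comment> \<open>The upper letter \<open>1\<close> witnesses both covers, first the exchange of
    \<open>-1\<close> and \<open>2\<close> and then the central exchange of \<open>-2\<close> and
    \<open>2\<close>.\<close>
  let ?p = "swp (- 1) 1" let ?m = "swp (- 1) 2 \<circ> ?p"
  have I: "1 \<in> I" "2 \<in> I" "- 1 \<in> I" "- 2 \<in> I" using b by (auto simp: I_def)
  have c: "consec 1 2" "consec (- 1) 1" using I by (auto simp: consec_iff)
  have W: "?p \<in> W" using S_W S_iff c by blast
  have iv: "inv ?p = swp (- 1) 1" using inv_swp by simp
  have "wit (up_orient Or) (inv ?p) 1 (- 1) 2" unfolding iv using b by (simp add: wit_def swp_def)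
  then have "ctr I (up_orient Or) (inv ?p) (- 1) 2" using I by (auto simp: ctr_def)
  moreover have "consec (inv ?p (- 1)) (inv ?p 2)" unfolding iv using c by (simp add: swp_def)
  ultimately have 1: "cstep ?p ?m" using W by (intro cstepI) auto
  have im: "inv ?m r = swp (- 1) 1 (swp (- 1) 2 r)" for r using inv_flip[OF W, of "- 1" 2] iv by simp
  have "wit (up_orient Or) (inv ?m) 1 (- 2) 2" using b by (simp add: wit_def im) (simp add: swp_def)
  then have "ctr I (up_orient Or) (inv ?m) (- 2) 2" using I by (auto simp: ctr_def)
  moreover have "consec (inv ?m (- 2)) (inv ?m 2)" unfolding im using c by (simp add: swp_def)
  ultimately have 2: "cstep ?m (swp (- 2) 2 \<circ> ?m)" using cstep_W(2)[OF 1] by (intro cstepI) auto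
  show "(?p, swp (- 2) 2 \<circ> ?m) \<in> camb_rel"
    by (rule camb_rel_trans[OF cstep_camb_rel[OF 1] cstep_camb_rel[OF 2]])
qed

lemma cambrian_cong_eq: "cambrian_cong S Or = camb_rel"
proof
  show "cambrian_cong S Or \<subseteq> camb_rel"
    unfolding cambrian_cong_def using lattice_cong_camb_rel camb_rel_gens by blast
  have "camb_rel \<subseteq> \<Theta>"
    if cg: "lattice_cong S \<Theta>" and g: "\<forall>(s, r) \<in> Or. (r, alt_word r s (cox_order s r - 1)) \<in> \<Theta>" for \<Theta>
  proof -
    interpret forcing typeB n "up_orient Or" \<Theta>
      by unfold_locales (use cg g[unfolded gens_iff] in blast)+
    show ?thesis by (rule camb_rel_subset)
  qed
  then show "camb_rel \<subseteq> cambrian_cong S Or" unfolding cambrian_cong_def by blast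
qed

end

theorem theorem1p3:
  fixes n :: nat
  assumes "n \<ge> 1"
  shows "(\<forall>Or. orientation (S_A n) Or \<longrightarrow>
            comb_iso (cong_fan n (S_A n) (chamber_A n) (cambrian_cong (S_A n) Or))
                     (assoc_normal_fan_A n))
       \<and> (\<forall>Or. orientation (S_B n) Or \<longrightarrow>
            comb_iso (cong_fan n (S_B n) (chamber_B n) (cambrian_cong (S_B n) Or))
                     (assoc_normal_fan_B n))"
proof (intro conjI allI impI)
  fix Or assume Or: "orientation (S_A n) Or"
  interpret A: coxeter False n by unfold_locales (rule assms)
  have S: "A.S = S_A n" by (simp add: A.S_def A.t_def)
  interpret A: oriented False n Or by unfold_locales (use Or S in simp)
  have "A.chamber = chamber_A n" "A.polygon_fan = assoc_normal_fan_A n"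
    by (simp_all add: A.chamber_def A.polygon_fan_def A.t_def assoc_normal_fan_A_def)
  then show "comb_iso (cong_fan n (S_A n) (chamber_A n) (cambrian_cong (S_A n) Or)) (assoc_normal_fan_A n)"
    using A.fan_iso A.cambrian_cong_eq S by simp
next
  fix Or assume Or: "orientation (S_B n) Or"
  interpret B: coxeter True n by unfold_locales (rule assms)
  have S: "B.S = S_B n" by (simp add: B.S_def B.t_def)
  interpret B: oriented True n Or by unfold_locales (use Or S in simp)
  have "B.chamber = chamber_B n" "B.polygon_fan = assoc_normal_fan_B n"
    by (simp_all add: B.chamber_def B.polygon_fan_def B.t_def assoc_normal_fan_B_def)
  then show "comb_iso (cong_fan n (S_B n) (chamber_B n) (cambrian_cong (S_B n) Or)) (assoc_normal_fan_B n)"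
    using B.fan_iso B.cambrian_cong_eq S by simp
qed

end
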